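(* Let $\langle P_I[X_I|\Theta_I]\rangle_{I\in D}$ be a projective family of exponential family models with sufficient statistics $S_I$, and let $\langle P^{\theta}_I[\Theta_I|Y_I]\rangle_{I\in D}$ be the family of corresponding canonical conjugate priors. If the priors and the sufficient statistics both form projective families, the projective limit Bayesian model is conjugate with posterior index $$T^{(n)}_D(x_D^n,y_D):=\Bigl(\lambda+n,\ \gamma_D+\sum_{k=1}^n S_D(x_D^{(k)})\Bigr),$$ where $x_D^n=(x_D^{(1)},\dots,x_D^{(n)})$, $y_D=(\lambda,\gamma_D)$ and $S_D:=\varprojlim\langle S_I\rangle_{I\in D}$ is the sufficient statistic of $P_D[X_D|\Theta_D]$. Analogously, if the model is pulled back under a Borel embedding $\phi:\tilde{\mathcal{X}}\to\mathcal{X}_D$, $$\tilde T^{(n)}(\tilde x^n,\tilde y):=\Bigl(\lambda+n,\ \tilde\gamma+\sum_{k=1}^n\tilde S(\tilde x^{(k)})\Bigr)$$ is a conjugate posterior index of the pullback model, where $\tilde y=(\lambda,\tilde\gamma)$ and $\tilde S=S_D\circ\phi$ is the sufficient statistic of the pullback model.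
   Context: $(\Omega,\mathcal{A},\mathbb{P})$ is an abstract probability space, the common domain of all random variables. Exponential family marginals: for each $I\in D$, with respect to suitable carrier measures on $\mathcal{X}_I$ and $\mathcal{T}_I$, the kernels $P_I[X_I|\Theta_I]$ and $P_I^\theta[\Theta_I|Y_I]$ have conditional densities $$p^x_I(x_I|\theta_I)=\frac{H_I(x_I)}{Z_I(\theta_I)}e^{\langle S_I(x_I),\theta_I\rangle},\qquad p^{\theta}_I(\theta_I|\lambda,\gamma_I)=\frac{e^{\langle\theta_I,\gamma_I\rangle-\lambda\log Z_I(\theta_I)}}{K_I(\lambda,\gamma_I)}.$$ Here $S_I:\mathcal{X}_I\to\mathcal{U}_I$ is a sufficient statistic with values in a Polish topological vector space $\mathcal{U}_I$ which contains the parameter space $\mathcal{T}_I$ as a subspace and carries an inner product $\langle\cdot,\cdot\rangle$; $H_I\ge0$; $Z_I,K_I$ are normalization functions; $\lambda\in\mathbb{R}_+$ and $\gamma_I\in\mathrm{conv}(S_I(\mathcal{X}_I))$ (convex hull of the image of $S_I$). The hyperparameter space is $\mathcal{Y}_I:=\mathbb{R}_+\times\mathcal{U}_I$ with $y_I=(\lambda,\gamma_I)$. Projective system: $(D,\preceq)$ is a countable directed partially ordered set; a projective system $\langle\mathcal{X}_I,\mathcal{B}(\mathcal{X}_I),f_{JI}\rangle$ consists of Polish spaces with Borel $\sigma$-algebras and continuous maps $f_{JI}:\mathcal{X}_J\to\mathcal{X}_I$ ($I\preceq J$) with $f_{II}=\mathrm{Id}$ and $f_{KI}=f_{JI}\circ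 f_{KJ}$ for $I\preceq J\preceq K$; its projective limit $\mathcal{X}_D$ is the set of $(x_I)\in\prod_I\mathcal{X}_I$ with $x_I=f_{JI}x_J$, with canonical maps $f_I$. The spaces $\mathcal{X}_I$, $\mathcal{T}_I$, $\mathcal{U}_I$, $\mathcal{Y}_I$ form projective systems (the maps on $\mathcal{Y}_I$ being the identity on $\lambda$). The models (kernels on $\mathcal X_I$, with maps $f_{JI}$) and priors (kernels on $\mathcal T_I$, with maps $g_{JI}$) are projective if $P_J[f_{JI}^{-1}\,\cdot\,|\Theta_J]=P_I[\,\cdot\,|\Theta_I]$ and $P^\theta_J[g_{JI}^{-1}\,\cdot\,|Y_J]=P^\theta_I[\,\cdot\,|Y_I]$ a.e. for $I\preceq J$; the statistics are projective if $h_{JI}\circ S_J=S_I\circ f_{JI}$, $h_{JI}$ being the maps on the $\mathcal{U}_I$. $S_D$ is the unique map with $h_I\circ S_D=S_I\circ f_I$ for all $I$. The projective limit Bayesian model consists of the unique (up to equivalence) kernels $P_D[X_D|\Theta_D]$, $P_D^\theta[\Theta_D|Y_D]$ with the given families as marginals. Posterior index: for a Bayesian model $P[X|\Theta]$, $P^\theta[\Theta|Y]$ (observations $X^{(1)},X^{(2)},\dots$ exchangeable, conditionally i.i.d. given $\Theta$), measurable mappings $T^{(n)}:\mathcal{X}^n\times\mathcal{Y}\to\mathcal{W}$ into a Polish space for which there is a probability kernel $k:\mathcal{B}(\mathcal{T})\times\mathcal{W}\to[0,1]$ with $P^{\theta}[A|X^n=x^n,Y=y]=_{\text{a.e.}}k(A,T^{(n)}(x^n,y))$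 for every $A\in\mathcal{B}(\mathcal{T})$. The index (and model) is conjugate if $\mathcal{W}\subset\mathcal{Y}$ and $k(A,y')=P^{\theta}[A|Y=y']$ for all $y'\in\mathcal{Y}$. Pullback model: the pullback of a measure $\nu$ under $\phi$ (existing when $\nu^*(\phi(\tilde{\mathcal{X}}))=\nu(\mathcal{X}_D)$, $\nu^*$ the outer measure) is the unique measure $\tilde\nu$ on $\phi^{-1}\mathcal{B}_D$, $\mathcal{B}_D=\mathcal{B}(\mathcal{X}_D)$, with $\tilde\nu\circ\phi^{-1}=\nu$. A Borel embedding is a Borel isomorphism onto its image with the trace $\sigma$-algebra. The pullback model consists of the pullbacks under $\phi$ of $P_D[\,\cdot\,|\Theta_D=\theta]$ for $\theta\in\tilde{\mathcal{T}}:=\{\theta:P_D^{*}[\phi(\tilde{\mathcal{X}})|\Theta_D=\theta]=1\}$, and of the pullbacks under the inclusion $\tilde{\mathcal{T}}\hookrightarrow\mathcal{T}_D$ of the priors $P_D^\theta[\,\cdot\,|Y_D=y]$ for those $y$ with $P_D^{\theta,*}[\tilde{\mathcal{T}}|Y_D=y]=1$; these $y$ form the hyperparameter space $\tilde{\mathcal{Y}}$ of the pullback model, with elements $\tilde y=(\lambda,\tilde\gamma)$.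
   Formalization: Prior densities are assumed also at normalizable posterior updates of (λ,γ); priors are projective at every such y; the maps h_JI are linear; the index claim for the pullback model requires φ(X̃) Borel or T̃^(n) a.s. in Ỹ, and T̃^(n) takes values in Ỹ only a.s. *)

theory Defs
  imports "HOL-Probability.Probability"
begin

section \<open>Polish spaces and projective systems\<close>

text \<open>
  The spaces of a family indexed by \<open>D\<close> are given by topologies on a common type; the
  carrier of the \<open>I\<close>-th space is the topspace of the \<open>I\<close>-th topology, so different indices
  may have unrelated spaces.  The index set \<open>D\<close> is a type of class \<^class>\<open>order\<close>.
\<close>

definition polish :: "'a topology \<Rightarrow> bool" where
  "polish T \<longleftrightarrow> completely_metrizable_space T \<and> separable_space T"

definition borel_of :: "'a topology \<Rightarrow> 'a measure" where
  "borel_of T = sigma (topspace T) {G. openin T G}"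

text \<open>A map \<open>f J I\<close> goes from the space at \<open>J\<close> to the space at \<open>I\<close>, where \<open>I \<le> J\<close>.\<close>

definition projective_system ::
    "('i::order \<Rightarrow> 'a topology) \<Rightarrow> ('i \<Rightarrow> 'i \<Rightarrow> 'a \<Rightarrow> 'a) \<Rightarrow> bool" where
  "projective_system T f \<longleftrightarrow>
     (\<forall>I. polish (T I)) \<and>
     (\<forall>I J. I \<le> J \<longrightarrow> continuous_map (T J) (T I) (f J I)) \<and>
     (\<forall>I. \<forall>x\<in>topspace (T I). f I I x = x) \<and>
     (\<forall>I J K. I \<le> J \<longrightarrow> J \<le> K \<longrightarrow> (\<forall>x\<in>topspace (T K). f K I x = f J I (f K J x)))"

text \<open>The canonical maps out of the projective limit are the evaluations \<open>\<lambda>x. x I\<close>.\<close>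

definition limit_topology ::
    "('i::order \<Rightarrow> 'a topology) \<Rightarrow> ('i \<Rightarrow> 'i \<Rightarrow> 'a \<Rightarrow> 'a) \<Rightarrow> ('i \<Rightarrow> 'a) topology" where
  "limit_topology T f =
     subtopology (product_topology T UNIV) {x. \<forall>I J. I \<le> J \<longrightarrow> x I = f J I (x J)}"

text \<open>
  Topological vector spaces are linear subspaces of a common real vector space, with their
  own topology.  The inner product need not induce the topology; it is only required to be
  jointly Borel, which is what makes the densities below jointly measurable.
\<close>

definition tvs :: "'u::real_vector topology \<Rightarrow> bool" where
  "tvs T \<longleftrightarrow>
     subspace (topspace T) \<and>
     continuous_map (prod_topology T T) T (\<lambda>(u, v). u + v) \<and>
     continuous_map (prod_topology euclideanreal T) T (\<lambda>(c, u). c *\<^sub>R u)"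

definition inner_product_on ::
    "'u::real_vector topology \<Rightarrow> ('u \<Rightarrow> 'u \<Rightarrow> real) \<Rightarrow> bool" where
  "inner_product_on T b \<longleftrightarrow>
     (\<forall>u\<in>topspace T. \<forall>v\<in>topspace T. b u v = b v u) \<and>
     (\<forall>u\<in>topspace T. \<forall>v\<in>topspace T. \<forall>w\<in>topspace T. b (u + v) w = b u w + b v w) \<and>
     (\<forall>c. \<forall>u\<in>topspace T. \<forall>v\<in>topspace T. b (c *\<^sub>R u) v = c * b u v) \<and>
     (\<forall>u\<in>topspace T. u \<noteq> 0 \<longrightarrow> b u u > 0) \<and>
     (\<lambda>(u, v). b u v) \<in> borel_measurable (borel_of T \<Otimes>\<^sub>M borel_of T)"

definition linear_between ::
    "'u::real_vector topology \<Rightarrow> 'u topology \<Rightarrow> ('u \<Rightarrow> 'u) \<Rightarrow> bool" where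
  "linear_between T T' h \<longleftrightarrow>
     (\<forall>u\<in>topspace T. \<forall>v\<in>topspace T. h (u + v) = h u + h v) \<and>
     (\<forall>c. \<forall>u\<in>topspace T. h (c *\<^sub>R u) = c *\<^sub>R h u)"

section \<open>Exponential family models and canonical conjugate priors\<close>

text \<open>
  The data attached to one index.  \<open>base\<close> is the factor \<open>H\<close> of the density, \<open>obs_carrier\<close> and
  \<open>par_carrier\<close> are the carrier measures; the parameter space is a topological subspace of
  the space in which the sufficient statistic takes its values.
\<close>

record ('x, 'u) exp_data =
  obs_top :: "'x topology"
  stat_top :: "'u topology"
  par_set :: "'u set"
  ip :: "'u \<Rightarrow> 'u \<Rightarrow> real"
  stat :: "'x \<Rightarrow> 'u"
  base :: "'x \<Rightarrow> real"
  obs_carrier :: "'x measure"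
  par_carrier :: "'u measure"
  model :: "'u \<Rightarrow> 'x measure"
  prior :: "real \<times> 'u \<Rightarrow> 'u measure"

definition par_top :: "('x, 'u) exp_data \<Rightarrow> 'u topology" where
  "par_top E = subtopology (stat_top E) (par_set E)"

text \<open>\<open>\<real>\<^sub>+\<close> is \<open>[0, \<infinity>)\<close>.\<close>

definition hyper_top :: "'u topology \<Rightarrow> (real \<times> 'u) topology" where
  "hyper_top U = prod_topology (top_of_set {0..}) U"

definition model_normalizer :: "('x, 'u) exp_data \<Rightarrow> 'u \<Rightarrow> real" where
  "model_normalizer E \<theta> =
     enn2real (\<integral>\<^sup>+x. ennreal (base E x * exp (ip E (stat E x) \<theta>)) \<partial>obs_carrier E)"

definition prior_normalizer :: "('x, 'u) exp_data \<Rightarrow> real \<Rightarrow> 'u \<Rightarrow> ennreal" where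
  "prior_normalizer E l \<gamma> =
     (\<integral>\<^sup>+\<theta>. ennreal (exp (ip E \<theta> \<gamma> - l * ln (model_normalizer E \<theta>))) \<partial>par_carrier E)"

text \<open>
  The hyperparameters at which the prior is required to have its canonical density: pairs
  \<open>(\<lambda>, \<gamma>)\<close> with \<open>\<lambda> \<in> \<real>\<^sub>+\<close> and \<open>\<gamma>\<close> in the convex hull of the image of the statistic, together
  with everything reached from such a pair by a posterior update
  \<open>(\<lambda>, \<gamma>) \<mapsto> (\<lambda> + n, \<gamma> + S x\<^sub>1 + \<dots> + S x\<^sub>n)\<close> (which leaves the convex hull), in each case
  provided that the density can be normalized.
\<close>

definition canonical_hyper :: "('x, 'u::real_vector) exp_data \<Rightarrow> (real \<times> 'u) set" where
  "canonical_hyper E =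
     {(l + real n, \<gamma> + (\<Sum>k<n. stat E (x k))) | l \<gamma> n x.
        0 \<le> l \<and> \<gamma> \<in> convex hull (stat E ` topspace (obs_top E)) \<and>
        (\<forall>k<n. x k \<in> topspace (obs_top E))}
     \<inter> {(l, \<gamma>). 0 < prior_normalizer E l \<gamma> \<and> prior_normalizer E l \<gamma> < \<infinity>}"

definition exp_family_model :: "('x, 'u::real_vector) exp_data \<Rightarrow> bool" where
  "exp_family_model E \<longleftrightarrow>
     polish (obs_top E) \<and> polish (stat_top E) \<and> tvs (stat_top E) \<and>
     inner_product_on (stat_top E) (ip E) \<and>
     par_set E \<subseteq> topspace (stat_top E) \<and> polish (par_top E) \<and>
     stat E \<in> borel_of (obs_top E) \<rightarrow>\<^sub>M borel_of (stat_top E) \<and>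
     base E \<in> borel_measurable (borel_of (obs_top E)) \<and>
     (\<forall>x\<in>topspace (obs_top E). 0 \<le> base E x) \<and>
     sets (obs_carrier E) = sets (borel_of (obs_top E)) \<and>
     sigma_finite_measure (obs_carrier E) \<and>
     model E \<in> borel_of (par_top E) \<rightarrow>\<^sub>M prob_algebra (borel_of (obs_top E)) \<and>
     (\<forall>\<theta>\<in>par_set E. model E \<theta> =
        density (obs_carrier E)
          (\<lambda>x. ennreal (base E x / model_normalizer E \<theta> * exp (ip E (stat E x) \<theta>))))"

definition canonical_conjugate_prior :: "('x, 'u::real_vector) exp_data \<Rightarrow> bool" where
  "canonical_conjugate_prior E \<longleftrightarrow>
     sets (par_carrier E) = sets (borel_of (par_top E)) \<and>
     sigma_finite_measure (par_carrier E) \<and>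
     prior E \<in> borel_of (hyper_top (stat_top E)) \<rightarrow>\<^sub>M prob_algebra (borel_of (par_top E)) \<and>
     (\<forall>(l, \<gamma>)\<in>canonical_hyper E. prior E (l, \<gamma>) =
        density (par_carrier E)
          (\<lambda>\<theta>. ennreal (exp (ip E \<theta> \<gamma> - l * ln (model_normalizer E \<theta>))
                        / enn2real (prior_normalizer E l \<gamma>))))"

section \<open>Projective families and their limits\<close>

text \<open>
  The identity between the models holds almost everywhere under every prior.  The one between
  the priors holds at every canonical hyperparameter: null sets of a single law of the
  hyperparameter would not control the prior at the posterior hyperparameters.
\<close>

definition projective_models ::
    "('i::order \<Rightarrow> ('x, 'u::real_vector) exp_data) \<Rightarrow> ('i \<Rightarrow> 'i \<Rightarrow> 'x \<Rightarrow> 'x) \<Rightarrow>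
     ('i \<Rightarrow> 'i \<Rightarrow> 'u \<Rightarrow> 'u) \<Rightarrow> bool" where
  "projective_models E f g \<longleftrightarrow>
     (\<forall>I J. I \<le> J \<longrightarrow> (\<forall>y\<in>canonical_hyper (E J). AE \<theta> in prior (E J) y.
        distr (model (E J) \<theta>) (borel_of (obs_top (E I))) (f J I) = model (E I) (g J I \<theta>)))"

definition projective_priors ::
    "('i::order \<Rightarrow> ('x, 'u::real_vector) exp_data) \<Rightarrow> ('i \<Rightarrow> 'i \<Rightarrow> 'u \<Rightarrow> 'u) \<Rightarrow>
     ('i \<Rightarrow> 'i \<Rightarrow> 'u \<Rightarrow> 'u) \<Rightarrow> bool" where
  "projective_priors E g h \<longleftrightarrow>
     (\<forall>I J. I \<le> J \<longrightarrow> (\<forall>(l, \<gamma>)\<in>canonical_hyper (E J).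
        (l, h J I \<gamma>) \<in> canonical_hyper (E I) \<longrightarrow>
        distr (prior (E J) (l, \<gamma>)) (borel_of (par_top (E I))) (g J I)
          = prior (E I) (l, h J I \<gamma>)))"

definition projective_statistics ::
    "('i::order \<Rightarrow> ('x, 'u) exp_data) \<Rightarrow> ('i \<Rightarrow> 'i \<Rightarrow> 'x \<Rightarrow> 'x) \<Rightarrow>
     ('i \<Rightarrow> 'i \<Rightarrow> 'u \<Rightarrow> 'u) \<Rightarrow> bool" where
  "projective_statistics E f h \<longleftrightarrow>
     (\<forall>I J. I \<le> J \<longrightarrow> (\<forall>x\<in>topspace (obs_top (E J)). h J I (stat (E J) x) = stat (E I) (f J I x)))"

definition obs_limit ::
    "('i::order \<Rightarrow> ('x, 'u) exp_data) \<Rightarrow> ('i \<Rightarrow> 'i \<Rightarrow> 'x \<Rightarrow> 'x) \<Rightarrow> ('i \<Rightarrow> 'x) topology" where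
  "obs_limit E f = limit_topology (\<lambda>I. obs_top (E I)) f"

definition par_limit ::
    "('i::order \<Rightarrow> ('x, 'u) exp_data) \<Rightarrow> ('i \<Rightarrow> 'i \<Rightarrow> 'u \<Rightarrow> 'u) \<Rightarrow> ('i \<Rightarrow> 'u) topology" where
  "par_limit E g = limit_topology (\<lambda>I. par_top (E I)) g"

definition stat_limit ::
    "('i::order \<Rightarrow> ('x, 'u) exp_data) \<Rightarrow> ('i \<Rightarrow> 'i \<Rightarrow> 'u \<Rightarrow> 'u) \<Rightarrow> ('i \<Rightarrow> 'u) topology" where
  "stat_limit E h = limit_topology (\<lambda>I. stat_top (E I)) h"

text \<open>
  The connecting maps of the hyperparameter spaces \<open>\<real>\<^sub>+ \<times> U\<^sub>I\<close> are the identity on the first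
  factor and \<open>D\<close> is directed, so their projective limit is \<open>\<real>\<^sub>+ \<times> U\<^sub>D\<close>.
\<close>

definition hyper_limit ::
    "('i::order \<Rightarrow> ('x, 'u) exp_data) \<Rightarrow> ('i \<Rightarrow> 'i \<Rightarrow> 'u \<Rightarrow> 'u) \<Rightarrow> (real \<times> ('i \<Rightarrow> 'u)) topology" where
  "hyper_limit E h = hyper_top (stat_limit E h)"

definition limit_stat :: "('i \<Rightarrow> ('x, 'u) exp_data) \<Rightarrow> ('i \<Rightarrow> 'x) \<Rightarrow> ('i \<Rightarrow> 'u)" where
  "limit_stat E x = (\<lambda>I. stat (E I) (x I))"

definition limit_canonical_hyper ::
    "('i::order \<Rightarrow> ('x, 'u::real_vector) exp_data) \<Rightarrow> ('i \<Rightarrow> 'i \<Rightarrow> 'u \<Rightarrow> 'u) \<Rightarrow>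
     (real \<times> ('i \<Rightarrow> 'u)) set" where
  "limit_canonical_hyper E h =
     {(l, \<gamma>) \<in> topspace (hyper_limit E h). \<forall>I. (l, \<gamma> I) \<in> canonical_hyper (E I)}"

text \<open>The kernels \<open>P\<close>, \<open>Q\<close> on the projective limits have the given families as marginals.\<close>

definition projective_limit_model ::
    "('i::order \<Rightarrow> ('x, 'u::real_vector) exp_data) \<Rightarrow> ('i \<Rightarrow> 'i \<Rightarrow> 'x \<Rightarrow> 'x) \<Rightarrow>
     ('i \<Rightarrow> 'i \<Rightarrow> 'u \<Rightarrow> 'u) \<Rightarrow> ('i \<Rightarrow> 'i \<Rightarrow> 'u \<Rightarrow> 'u) \<Rightarrow>
     (('i \<Rightarrow> 'u) \<Rightarrow> ('i \<Rightarrow> 'x) measure) \<Rightarrow> (real \<times> ('i \<Rightarrow> 'u) \<Rightarrow> ('i \<Rightarrow> 'u) measure) \<Rightarrow> bool" where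
  "projective_limit_model E f g h P Q \<longleftrightarrow>
     P \<in> borel_of (par_limit E g) \<rightarrow>\<^sub>M prob_algebra (borel_of (obs_limit E f)) \<and>
     Q \<in> borel_of (hyper_limit E h) \<rightarrow>\<^sub>M prob_algebra (borel_of (par_limit E g)) \<and>
     (\<forall>I. \<forall>y\<in>limit_canonical_hyper E h. AE \<theta> in Q y.
        distr (P \<theta>) (borel_of (obs_top (E I))) (\<lambda>x. x I) = model (E I) (\<theta> I)) \<and>
     (\<forall>I. \<forall>(l, \<gamma>)\<in>limit_canonical_hyper E h.
        distr (Q (l, \<gamma>)) (borel_of (par_top (E I))) (\<lambda>\<theta>. \<theta> I) = prior (E I) (l, \<gamma> I))"

section \<open>Bayesian models, sufficiency and posterior indices\<close>

text \<open>\<open>given_prob M Z N A\<close> is a version of the conditional probability \<open>P[A | Z]\<close>, for a random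
  variable \<open>Z\<close> with values in \<open>N\<close>.\<close>

definition given_prob :: "'w measure \<Rightarrow> ('w \<Rightarrow> 'z) \<Rightarrow> 'z measure \<Rightarrow> 'w set \<Rightarrow> 'w \<Rightarrow> real" where
  "given_prob M Z N A = real_cond_exp M (vimage_algebra (space M) Z N) (indicator A)"

text \<open>
  \<open>\<Theta>\<close> has conditional law \<open>Q Y\<close> given \<open>Y\<close>, and the observations \<open>X 0, X 1, \<dots>\<close> are
  conditionally independent with law \<open>P \<Theta>\<close> given the parameter (and the hyperparameter).
\<close>

definition bayesian_model ::
    "'w measure \<Rightarrow> 'x measure \<Rightarrow> 't measure \<Rightarrow> 'y measure \<Rightarrow> ('t \<Rightarrow> 'x measure) \<Rightarrow>
     ('y \<Rightarrow> 't measure) \<Rightarrow> (nat \<Rightarrow> 'w \<Rightarrow> 'x) \<Rightarrow> ('w \<Rightarrow> 't) \<Rightarrow> ('w \<Rightarrow> 'y) \<Rightarrow> bool" where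
  "bayesian_model M MX MT MY P Q X \<Theta> Y \<longleftrightarrow>
     prob_space M \<and> (\<forall>k. X k \<in> M \<rightarrow>\<^sub>M MX) \<and> \<Theta> \<in> M \<rightarrow>\<^sub>M MT \<and> Y \<in> M \<rightarrow>\<^sub>M MY \<and>
     (\<forall>A\<in>sets MT. AE \<omega> in M.
        given_prob M Y MY (\<Theta> -` A \<inter> space M) \<omega> = measure (Q (Y \<omega>)) A) \<and>
     (\<forall>n A. (\<forall>k<n. A k \<in> sets MX) \<longrightarrow> (AE \<omega> in M.
        given_prob M (\<lambda>\<omega>. (\<Theta> \<omega>, Y \<omega>)) (MT \<Otimes>\<^sub>M MY) {\<omega>\<in>space M. \<forall>k<n. X k \<omega> \<in> A k} \<omega>
          = (\<Prod>k<n. measure (P (\<Theta> \<omega>)) (A k))))"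

text \<open>The conditional law of the observation given the statistic does not depend on the
  parameter.\<close>

definition sufficient_statistic ::
    "'w measure \<Rightarrow> 'x measure \<Rightarrow> 't measure \<Rightarrow> 's measure \<Rightarrow> ('w \<Rightarrow> 'x) \<Rightarrow> ('w \<Rightarrow> 't) \<Rightarrow>
     ('x \<Rightarrow> 's) \<Rightarrow> bool" where
  "sufficient_statistic M MX MT MU X \<Theta> S \<longleftrightarrow>
     S \<in> MX \<rightarrow>\<^sub>M MU \<and>
     (\<forall>A\<in>sets MX. AE \<omega> in M.
        given_prob M (\<lambda>\<omega>. (S (X \<omega>), \<Theta> \<omega>)) (MU \<Otimes>\<^sub>M MT) (X -` A \<inter> space M) \<omega>
          = given_prob M (\<lambda>\<omega>. S (X \<omega>)) MU (X -` A \<inter> space M) \<omega>)"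

text \<open>
  The index takes its values in the Polish space \<open>V\<close>, almost surely in \<open>W\<close>; the kernel \<open>k\<close> is
  defined on \<open>W\<close>.  The choice \<open>W = topspace V\<close> is the case of an index with values in a
  Polish space.  A proper subset is needed for pullback models, whose hyperparameter space is
  only a subset of a Polish space, and is left by the index on a null set.
\<close>

definition posterior_index ::
    "'w measure \<Rightarrow> 'x measure \<Rightarrow> 't measure \<Rightarrow> 'y measure \<Rightarrow>
     (nat \<Rightarrow> 'w \<Rightarrow> 'x) \<Rightarrow> ('w \<Rightarrow> 't) \<Rightarrow> ('w \<Rightarrow> 'y) \<Rightarrow>
     'v topology \<Rightarrow> 'v set \<Rightarrow> ('v \<Rightarrow> 't measure) \<Rightarrow> (nat \<Rightarrow> (nat \<Rightarrow> 'x) \<Rightarrow> 'y \<Rightarrow> 'v) \<Rightarrow> bool" where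
  "posterior_index M MX MT MY X \<Theta> Y V W k T \<longleftrightarrow>
     polish V \<and> W \<subseteq> topspace V \<and>
     k \<in> restrict_space (borel_of V) W \<rightarrow>\<^sub>M prob_algebra MT \<and>
     (\<forall>n. (\<lambda>(x, y). T n x y) \<in> (\<Pi>\<^sub>M i\<in>{..<n}. MX) \<Otimes>\<^sub>M MY \<rightarrow>\<^sub>M borel_of V) \<and>
     (\<forall>n. AE \<omega> in M. T n (\<lambda>i\<in>{..<n}. X i \<omega>) (Y \<omega>) \<in> W) \<and>
     (\<forall>n. \<forall>A\<in>sets MT. AE \<omega> in M.
        given_prob M (\<lambda>\<omega>. (\<lambda>i\<in>{..<n}. X i \<omega>, Y \<omega>)) ((\<Pi>\<^sub>M i\<in>{..<n}. MX) \<Otimes>\<^sub>M MY)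
            (\<Theta> -` A \<inter> space M) \<omega>
          = measure (k (T n (\<lambda>i\<in>{..<n}. X i \<omega>) (Y \<omega>))) A)"

definition conjugate_posterior_index ::
    "'w measure \<Rightarrow> 'x measure \<Rightarrow> 't measure \<Rightarrow> 'y measure \<Rightarrow> ('y \<Rightarrow> 't measure) \<Rightarrow>
     (nat \<Rightarrow> 'w \<Rightarrow> 'x) \<Rightarrow> ('w \<Rightarrow> 't) \<Rightarrow> ('w \<Rightarrow> 'y) \<Rightarrow>
     'y topology \<Rightarrow> (nat \<Rightarrow> (nat \<Rightarrow> 'x) \<Rightarrow> 'y \<Rightarrow> 'y) \<Rightarrow> bool" where
  "conjugate_posterior_index M MX MT MY Q X \<Theta> Y V T \<longleftrightarrow>
     (\<exists>W k. posterior_index M MX MT MY X \<Theta> Y V W k T \<and> W \<subseteq> space MY \<and>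
        (\<forall>y\<in>space MY. \<forall>A\<in>sets MT. measure (k y) A = measure (Q y) A))"

definition update_index ::
    "('x \<Rightarrow> 'i \<Rightarrow> 'u::real_vector) \<Rightarrow> nat \<Rightarrow> (nat \<Rightarrow> 'x) \<Rightarrow> real \<times> ('i \<Rightarrow> 'u) \<Rightarrow>
     real \<times> ('i \<Rightarrow> 'u)" where
  "update_index S n x = (\<lambda>(l, \<gamma>). (l + real n, \<lambda>I. \<gamma> I + (\<Sum>k<n. S (x k) I)))"

section \<open>Pullbacks\<close>

definition borel_embedding :: "'z measure \<Rightarrow> 'a measure \<Rightarrow> ('z \<Rightarrow> 'a) \<Rightarrow> bool" where
  "borel_embedding N B \<phi> \<longleftrightarrow>
     inj_on \<phi> (space N) \<and> \<phi> \<in> N \<rightarrow>\<^sub>M B \<and>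
     the_inv_into (space N) \<phi> \<in> restrict_space B (\<phi> ` space N) \<rightarrow>\<^sub>M N"

text \<open>The pullback of \<open>\<nu>\<close> to the set \<open>S\<close> under \<open>\<phi>\<close>; unspecified if there is none.\<close>

definition pullback_measure :: "'z set \<Rightarrow> ('z \<Rightarrow> 'a) \<Rightarrow> 'a measure \<Rightarrow> 'z measure" where
  "pullback_measure S \<phi> \<nu> =
     (THE N. sets N = sets (vimage_algebra S \<phi> \<nu>) \<and> distr N \<nu> \<phi> = \<nu>)"

definition pullback_model :: "'z measure \<Rightarrow> ('z \<Rightarrow> 'a) \<Rightarrow> ('t \<Rightarrow> 'a measure) \<Rightarrow> 't \<Rightarrow> 'z measure" where
  "pullback_model N \<phi> P \<theta> = pullback_measure (space N) \<phi> (P \<theta>)"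

text \<open>
  The parameter and hyperparameter spaces of the pullback model are subsets of the given
  ones (\<open>BT\<close>, \<open>BY\<close>) with the trace \<open>\<sigma>\<close>-algebra; they need not be measurable subsets.
\<close>

definition pullback_par ::
    "'z measure \<Rightarrow> ('z \<Rightarrow> 'a) \<Rightarrow> 't measure \<Rightarrow> ('t \<Rightarrow> 'a measure) \<Rightarrow> 't measure" where
  "pullback_par N \<phi> BT P =
     restrict_space BT {\<theta>\<in>space BT. outer_measure_of (P \<theta>) (\<phi> ` space N) = 1}"

definition pullback_prior :: "'t measure \<Rightarrow> ('y \<Rightarrow> 't measure) \<Rightarrow> 'y \<Rightarrow> 't measure" where
  "pullback_prior BT' Q y = pullback_measure (space BT') (\<lambda>\<theta>. \<theta>) (Q y)"

definition pullback_hyper ::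
    "'t measure \<Rightarrow> 'y measure \<Rightarrow> ('y \<Rightarrow> 't measure) \<Rightarrow> 'y measure" where
  "pullback_hyper BT' BY Q =
     restrict_space BY {y\<in>space BY. outer_measure_of (Q y) (space BT') = 1}"

end

theory Submission
  imports Defs
begin

text \<open>
  At a single index \<open>I\<close> the theorem is the classical computation: the canonical prior density at
  \<open>(\<lambda>, \<gamma>)\<close>, multiplied by the likelihood of \<open>n\<close> observations, is as a function of \<open>\<theta>\<close> a multiple of
  \<open>exp (\<langle>\<theta>, \<gamma> + S x\<^sub>1 + \<dots> + S x\<^sub>n\<rangle> - (\<lambda> + n) ln (Z \<theta>))\<close>, the unnormalized prior density at the
  updated hyperparameter (\<open>bayes_canonical\<close>).  The updated hyperparameter has to admit a normalized
  density.  It does so almost surely: its normalizer is a multiple of the marginal density of the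
  data, and a density is almost surely positive and finite at the random point whose law it
  describes (\<open>bayes_density\<close>).  There are countably many indices, so this holds at all of them at
  once (\<open>index_canonical\<close>).

  The passage to the limit rests on the fact that the Borel \<open>\<sigma>\<close>-algebra of a countable projective
  limit of Polish spaces is generated by the coordinate maps.  As the index set is directed, a
  finite measure is then determined by its images at the single indices
  (\<open>measure_eqI_directed_marginals\<close>).  The joint law of parameter, data and hyperparameter has the
  same image at every index as the measure under which the parameter is redrawn from the prior at
  the updated hyperparameter (\<open>posterior_at\<close>); hence the two agree, which is the claim
  (\<open>posterior\<close>).

  Sufficiency does not follow from conjugacy, where one conditions on the hyperparameter as well.
  Conditional independence of observation and parameter given the statistic is a symmetric
  relation (\<open>cond_indep_swap\<close>), so it is enough that the conditional law of the parameter given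
  the observation is a function of the statistic.  Given only the component at one index this is
  again Bayes' formula, in which the factor \<open>H\<close> cancels (\<open>posterior_single_factors\<close>).  Functions
  of single components are dense in \<open>L\<^sup>1\<close> of the full observation, and this carries the property
  over to the limit (\<open>real_cond_exp_directed\<close>).

  For the pullback model, a pulled back measure gives the preimage of a set the mass that the
  original measure gives the set.  Therefore \<open>\<phi> \<circ> X'\<close>, \<open>\<Theta>'\<close>, \<open>Y'\<close> obey the model on the projective
  limit (\<open>pushed_bayesian_model\<close>).  The \<open>\<sigma>\<close>-algebras on which one conditions are the same on both
  sides, so the statements transfer.  The index must stay almost surely in the hyperparameter
  space of the pullback model; if the image of \<open>\<phi>\<close> is measurable, it does so because the posterior
  mass outside the parameter space of the pullback model has expectation \<open>0\<close>
  (\<open>pushed_index_in_hyper\<close>).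
\<close>

section \<open>Borel \<open>\<sigma>\<close>-algebras of Polish spaces and of projective limits\<close>

text \<open>
  Countability of a base enters through its members: measurability of a map into the Borel
  \<open>\<sigma>\<close>-algebra is checked on them, and products of such bases are written down explicitly.
\<close>

definition countable_base :: "'a topology \<Rightarrow> 'a set set \<Rightarrow> bool" where
  "countable_base X \<B> \<longleftrightarrow> countable \<B> \<and> (\<forall>V\<in>\<B>. openin X V) \<and>
     (\<forall>U x. openin X U \<and> x \<in> U \<longrightarrow> (\<exists>V\<in>\<B>. x \<in> V \<and> V \<subseteq> U))"

lemma second_countable_iff_base: "second_countable X \<longleftrightarrow> (\<exists>\<B>. countable_base X \<B>)"
  by (simp add: second_countable_def countable_base_def)

lemma space_borel_of [simp]: "space (borel_of X) = topspace X"
  unfolding borel_of_def by (simp add: openin_subset subset_eq space_measure_of_conv)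

lemma sets_borel_of: "sets (borel_of X) = sigma_sets (topspace X) {U. openin X U}"
  unfolding borel_of_def by (rule sets_measure_of) (auto dest: openin_subset)

lemma openin_in_borel_of: "openin X U \<Longrightarrow> U \<in> sets (borel_of X)"
  by (auto simp: sets_borel_of)

lemma measurable_borel_ofI:
  assumes "f \<in> space M \<rightarrow> topspace X"
    and "\<And>U. openin X U \<Longrightarrow> f -` U \<inter> space M \<in> sets M"
  shows "f \<in> M \<rightarrow>\<^sub>M borel_of X"
  unfolding borel_of_def
  by (rule measurable_measure_of) (use assms in \<open>auto dest: openin_subset\<close>)

lemma measurable_continuous_map:
  assumes "continuous_map X Y f"
  shows "f \<in> borel_of X \<rightarrow>\<^sub>M borel_of Y"
proof (rule measurable_borel_ofI)
  show "f \<in> space (borel_of X) \<rightarrow> topspace Y"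
    using assms by (auto simp: continuous_map_def)
next
  fix U assume "openin Y U"
  then have "openin X {x \<in> topspace X. f x \<in> U}"
    using assms by (auto simp: continuous_map_def)
  moreover have "f -` U \<inter> space (borel_of X) = {x \<in> topspace X. f x \<in> U}" by auto
  ultimately show "f -` U \<inter> space (borel_of X) \<in> sets (borel_of X)"
    by (simp add: openin_in_borel_of)
qed

lemma measurable_borel_of_base:
  assumes base: "countable_base X \<B>"
    and f: "f \<in> space M \<rightarrow> topspace X"
    and *: "\<And>V. V \<in> \<B> \<Longrightarrow> f -` V \<inter> space M \<in> sets M"
  shows "f \<in> M \<rightarrow>\<^sub>M borel_of X"
proof (rule measurable_borel_ofI[OF f])
  fix U assume U: "openin X U"
  define \<V> where "\<V> = {V \<in> \<B>. V \<subseteq> U}"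
  have "U = \<Union>\<V>"
    using base U unfolding countable_base_def \<V>_def by blast
  then have "f -` U \<inter> space M = (\<Union>V\<in>\<V>. f -` V \<inter> space M)" by auto
  also have "\<dots> \<in> sets M"
    using base * by (intro sets.countable_UN') (auto simp: countable_base_def \<V>_def)
  finally show "f -` U \<inter> space M \<in> sets M" .
qed

lemma polish_imp_second_countable:
  assumes "polish X"
  shows "second_countable X"
proof -
  obtain S d where "Metric_space S d" and X: "X = Metric_space.mtopology S d"
    using assms completely_metrizable_imp_metrizable_space
    unfolding polish_def metrizable_space_def by metis
  then interpret Metric_space S d by simp
  obtain C where C: "countable C" "C \<subseteq> S" "X closure_of C = S"
    using assms unfolding polish_def separable_space_def X by auto
  let ?B = "(\<lambda>(c, n). mball c (inverse (Suc n))) ` (C \<times> (UNIV :: nat set))"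
  have "\<exists>V\<in>?B. x \<in> V \<and> V \<subseteq> U" if U: "openin X U" "x \<in> U" for U x
  proof -
    obtain r where r: "0 < r" "mball x r \<subseteq> U" and x: "x \<in> S"
      using U unfolding X openin_mtopology by blast
    obtain n where n: "inverse (real (Suc n)) < r / 2"
      using reals_Archimedean[of "r / 2"] r by auto
    have op: "openin X (mball x (inverse (Suc n)))" using X by simp
    moreover have xm: "x \<in> mball x (inverse (Suc n))" using x by simp
    ultimately obtain c where c: "c \<in> C" "c \<in> mball x (inverse (Suc n))"
    proof -
      have "x \<in> X closure_of C" using C(3) x by simp
      then show ?thesis using that x op xm
        unfolding in_closure_of by blast
    qed
    have "mball c (inverse (Suc n)) \<subseteq> mball x r"
    proof
      fix y assume y: "y \<in> mball c (inverse (Suc n))"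
      have "d x y \<le> d x c + d c y"
        using y c x by (intro triangle) auto
      also have "\<dots> < r" using y c n by auto
      finally show "y \<in> mball x r" using x y by auto
    qed
    moreover have "x \<in> mball c (inverse (Suc n))"
      using c by (simp add: commute)
    ultimately show ?thesis using r c by blast
  qed
  moreover have "countable ?B" using C by auto
  moreover have "\<forall>V\<in>?B. openin X V" using X by auto
  ultimately have "countable_base X ?B"
    unfolding countable_base_def by simp
  then show ?thesis unfolding second_countable_iff_base ..
qed

lemma polish_iff_second_countable:
  "polish X \<longleftrightarrow> completely_metrizable_space X \<and> second_countable X"
  using polish_imp_second_countable second_countable_imp_separable_space
  by (auto simp: polish_def)

lemma countable_base_prod_topology:
  assumes A: "countable_base X \<A>" and B: "countable_base Y \<B>"
  shows "countable_base (prod_topology X Y) ((\<lambda>(V, W). V \<times> W) ` (\<A> \<times> \<B>))"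
  unfolding countable_base_def
proof (intro conjI ballI allI impI)
  show "countable ((\<lambda>(V, W). V \<times> W) ` (\<A> \<times> \<B>))"
    using A B by (auto simp: countable_base_def)
next
  fix V assume "V \<in> (\<lambda>(V, W). V \<times> W) ` (\<A> \<times> \<B>)"
  then show "openin (prod_topology X Y) V"
    using A B by (auto simp: countable_base_def openin_prod_Times_iff)
next
  fix U z assume "openin (prod_topology X Y) U \<and> z \<in> U"
  then obtain V W where VW: "openin X V" "openin Y W" "z \<in> V \<times> W" "V \<times> W \<subseteq> U"
    unfolding openin_prod_topology_alt by (metis mem_Sigma_iff prod.collapse)
  obtain V' where V': "V' \<in> \<A>" "fst z \<in> V'" "V' \<subseteq> V"
    using A VW unfolding countable_base_def by (metis mem_Times_iff)
  obtain W' where W': "W' \<in> \<B>" "snd z \<in> W'" "W' \<subseteq> W"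
    using B VW unfolding countable_base_def by (metis mem_Times_iff)
  have "z \<in> V' \<times> W'" using V'(2) W'(2) by (simp add: mem_Times_iff)
  moreover have "V' \<times> W' \<subseteq> U" using Sigma_mono[OF V'(3) W'(3)] VW(4) by (rule order_trans)
  moreover have "V' \<times> W' \<in> (\<lambda>(V, W). V \<times> W) ` (\<A> \<times> \<B>)" using V'(1) W'(1) by auto
  ultimately show "\<exists>V\<in>(\<lambda>(V, W). V \<times> W) ` (\<A> \<times> \<B>). z \<in> V \<and> V \<subseteq> U"
    by (intro bexI[of _ "V' \<times> W'"] conjI)
qed

text \<open>
  Second countability is what makes the Borel \<open>\<sigma>\<close>-algebra of the product no larger than the product
  of the Borel \<open>\<sigma>\<close>-algebras: every open set is a countable union of open rectangles.
\<close>

lemma measurable_Pair_borel_of: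
  assumes "second_countable X" "second_countable Y"
    and f: "f \<in> M \<rightarrow>\<^sub>M borel_of X" and g: "g \<in> M \<rightarrow>\<^sub>M borel_of Y"
  shows "(\<lambda>\<omega>. (f \<omega>, g \<omega>)) \<in> M \<rightarrow>\<^sub>M borel_of (prod_topology X Y)"
proof -
  obtain \<A> \<B> where AB: "countable_base X \<A>" "countable_base Y \<B>"
    using assms by (auto simp: second_countable_iff_base)
  show ?thesis
  proof (rule measurable_borel_of_base[OF countable_base_prod_topology[OF AB]])
    show "(\<lambda>\<omega>. (f \<omega>, g \<omega>)) \<in> space M \<rightarrow> topspace (prod_topology X Y)"
      using measurable_space[OF f] measurable_space[OF g] by auto
  next
    fix V assume "V \<in> (\<lambda>(V, W). V \<times> W) ` (\<A> \<times> \<B>)"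
    then obtain A B where V: "V = A \<times> B" and A: "A \<in> \<A>" and B: "B \<in> \<B>" by auto
    have "A \<in> sets (borel_of X)" "B \<in> sets (borel_of Y)"
      using AB A B by (auto simp: countable_base_def intro: openin_in_borel_of)
    then have "(f -` A \<inter> space M) \<inter> (g -` B \<inter> space M) \<in> sets M"
      using f g by (auto intro!: sets.Int measurable_sets)
    moreover have "(\<lambda>\<omega>. (f \<omega>, g \<omega>)) -` V \<inter> space M = (f -` A \<inter> space M) \<inter> (g -` B \<inter> space M)"
      by (auto simp: V)
    ultimately show "(\<lambda>\<omega>. (f \<omega>, g \<omega>)) -` V \<inter> space M \<in> sets M" by simp
  qed
qed

text \<open>
  The base consists of the finite intersections of cylinders over members of the given bases; a pair
  \<open>(i, V)\<close> in the finite set \<open>F\<close> stands for the cylinder \<open>x i \<in> V\<close>.  Countability of the index type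
  is used in counting the sets \<open>F\<close>.
\<close>

lemma countable_base_product_topology:
  fixes T :: "'i::countable \<Rightarrow> 'a topology"
  assumes B: "\<And>i. countable_base (T i) (\<B> i)"
  shows "countable_base (product_topology T UNIV)
    ((\<lambda>F. {x \<in> topspace (product_topology T UNIV). \<forall>(i, V)\<in>F. x i \<in> V}) `
      {F. finite F \<and> F \<subseteq> (SIGMA i:UNIV. \<B> i)})" (is "countable_base ?X ?\<C>")
  unfolding countable_base_def
proof (intro conjI ballI allI impI)
  show "countable ?\<C>"
  proof (intro countable_image countable_Collect_finite_subset countable_SIGMA)
    show "countable (\<B> i)" for i using B[of i] by (simp add: countable_base_def)
  qed simp
next
  fix W assume "W \<in> ?\<C>"
  then obtain F where F: "finite F" "F \<subseteq> (SIGMA i:UNIV. \<B> i)"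
    and W: "W = {x \<in> topspace ?X. \<forall>(i, V)\<in>F. x i \<in> V}" by auto
  have "openin ?X {x \<in> topspace ?X. \<forall>(i, V)\<in>F. x i \<in> V}"
    using F
  proof (induction F)
    case empty
    then show ?case using openin_topspace[of ?X] by simp
  next
    case (insert p F)
    obtain i V where p: "p = (i, V)" by (cases p)
    have "openin (T i) V" using insert.prems B by (auto simp: p countable_base_def)
    then have "openin ?X {x \<in> topspace ?X. x i \<in> V}"
      using openin_continuous_map_preimage[OF continuous_map_product_projection[of i UNIV T]] by simp
    moreover have "openin ?X {x \<in> topspace ?X. \<forall>(i, V)\<in>F. x i \<in> V}"
      using insert by simp
    moreover have "{x \<in> topspace ?X. \<forall>(i, V)\<in>insert p F. x i \<in> V} =
      {x \<in> topspace ?X. x i \<in> V} \<inter> {x \<in> topspace ?X. \<forall>(i, V)\<in>F. x i \<in> V}"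
      by (auto simp: p)
    ultimately show ?case by (simp only: openin_Int)
  qed
  then show "openin ?X W" by (simp add: W)
next
  fix U x assume Ux: "openin ?X U \<and> x \<in> U"
  then obtain V where V: "finite {i. V i \<noteq> topspace (T i)}" "\<And>i. openin (T i) (V i)"
      "x \<in> Pi\<^sub>E UNIV V" "Pi\<^sub>E UNIV V \<subseteq> U"
    unfolding openin_product_topology_alt by force
  have "\<exists>W. W \<in> \<B> i \<and> x i \<in> W \<and> W \<subseteq> V i" for i
  proof -
    have "x i \<in> V i" using V(3) by auto
    with B[of i] V(2)[of i] show ?thesis unfolding countable_base_def by blast
  qed
  then have "\<exists>W. \<forall>i. W i \<in> \<B> i \<and> x i \<in> W i \<and> W i \<subseteq> V i" by (intro choice allI)
  then obtain W where W: "\<And>i. W i \<in> \<B> i" "\<And>i. x i \<in> W i" "\<And>i. W i \<subseteq> V i"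
    by blast
  let ?F = "(\<lambda>i. (i, W i)) ` {i. V i \<noteq> topspace (T i)}"
  let ?W = "{x \<in> topspace ?X. \<forall>(i, V)\<in>?F. x i \<in> V}"
  have "x \<in> ?W" using Ux W openin_subset[of ?X U] by auto
  moreover have "?W \<subseteq> Pi\<^sub>E UNIV V"
  proof
    fix y assume y: "y \<in> ?W"
    have "y i \<in> V i" for i
      using y W(3)[of i] by (cases "V i = topspace (T i)") auto
    then show "y \<in> Pi\<^sub>E UNIV V" by auto
  qed
  moreover have "?F \<in> {F. finite F \<and> F \<subseteq> (SIGMA i:UNIV. \<B> i)}" using V(1) W(1) by auto
  then have "?W \<in> ?\<C>" by (rule imageI)
  ultimately show "\<exists>V\<in>?\<C>. x \<in> V \<and> V \<subseteq> U" using V(4) by (intro bexI[of _ ?W]) auto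
qed

lemma topspace_limit_topology:
  "x \<in> topspace (limit_topology T f) \<longleftrightarrow>
     (\<forall>I. x I \<in> topspace (T I)) \<and> (\<forall>I J. I \<le> J \<longrightarrow> x I = f J I (x J))"
  by (auto simp: limit_topology_def)

lemma continuous_map_limit_projection:
  "continuous_map (limit_topology T f) (T I) (\<lambda>x. x I)"
  unfolding limit_topology_def
  by (intro continuous_map_from_subtopology continuous_map_product_projection) simp

lemma measurable_limit_projection:
  "(\<lambda>x. x I) \<in> borel_of (limit_topology T f) \<rightarrow>\<^sub>M borel_of (T I)"
  by (intro measurable_continuous_map continuous_map_limit_projection)

text \<open>
  This is the form in which the Borel \<open>\<sigma>\<close>-algebra of a projective limit is used throughout: the
  coordinate maps generate it.
\<close>

lemma measurable_limit_topology:
  fixes T :: "'i::{order,countable} \<Rightarrow> 'a topology"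
  assumes T: "\<And>I. second_countable (T I)"
    and F: "\<And>\<omega>. \<omega> \<in> space M \<Longrightarrow> F \<omega> \<in> topspace (limit_topology T f)"
    and meas: "\<And>I. (\<lambda>\<omega>. F \<omega> I) \<in> M \<rightarrow>\<^sub>M borel_of (T I)"
  shows "F \<in> M \<rightarrow>\<^sub>M borel_of (limit_topology T f)"
proof (rule measurable_borel_ofI)
  show "F \<in> space M \<rightarrow> topspace (limit_topology T f)" using F by auto
next
  fix U assume "openin (limit_topology T f) U"
  then obtain W where W: "openin (product_topology T UNIV) W"
      "U = W \<inter> {x. \<forall>I J. I \<le> J \<longrightarrow> x I = f J I (x J)}"
    unfolding limit_topology_def openin_subtopology by auto
  obtain \<B> where B: "\<And>I. countable_base (T I) (\<B> I)"
    using T unfolding second_countable_iff_base by metis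
  have "F \<in> M \<rightarrow>\<^sub>M borel_of (product_topology T UNIV)"
  proof (rule measurable_borel_of_base[OF countable_base_product_topology[OF B]])
    show F': "F \<in> space M \<rightarrow> topspace (product_topology T UNIV)"
      using F by (auto simp: topspace_limit_topology)
    fix V assume "V \<in> (\<lambda>F. {x \<in> topspace (product_topology T UNIV). \<forall>(i, V)\<in>F. x i \<in> V}) `
      {F. finite F \<and> F \<subseteq> (SIGMA i:UNIV. \<B> i)}"
    then obtain G where G: "finite G" "G \<subseteq> (SIGMA i:UNIV. \<B> i)"
      and V: "V = {x \<in> topspace (product_topology T UNIV). \<forall>(i, V)\<in>G. x i \<in> V}" by auto
    have "{\<omega> \<in> space M. F \<omega> i \<in> W} \<in> sets M" if "(i, W) \<in> G" for i W
    proof -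
      have "W \<in> sets (borel_of (T i))"
        using that G(2) B[of i] by (auto simp: countable_base_def intro!: openin_in_borel_of)
      from measurable_sets[OF meas this] show ?thesis
        by (auto simp: vimage_def Int_def conj_commute)
    qed
    then have "{\<omega> \<in> space M. \<forall>p\<in>G. F \<omega> (fst p) \<in> snd p} \<in> sets M"
      using G(1) by (intro sets.sets_Collect_finite_All) auto
    moreover have "F -` V \<inter> space M = {\<omega> \<in> space M. \<forall>p\<in>G. F \<omega> (fst p) \<in> snd p}"
      using F' by (auto simp: V split_beta)
    ultimately show "F -` V \<inter> space M \<in> sets M" by simp
  qed
  from measurable_sets[OF this openin_in_borel_of[OF W(1)]]
  have "F -` W \<inter> space M \<in> sets M" .
  moreover have "F -` U \<inter> space M = F -` W \<inter> space M"
    using F by (auto simp: W(2) topspace_limit_topology)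
  ultimately show "F -` U \<inter> space M \<in> sets M" by simp
qed

text \<open>
  The limit is cut out of the product by the equations \<open>x I = f J I (x J)\<close>, hence closed in it
  because the factors are Hausdorff; a countable product of Polish spaces is Polish.
\<close>

lemma polish_limit_topology:
  fixes T :: "'i::{order,countable} \<Rightarrow> 'a topology"
  assumes "projective_system T f"
  shows "polish (limit_topology T f)"
proof -
  let ?X = "product_topology T UNIV"
  have T: "polish (T I)" for I
    using assms by (auto simp: projective_system_def)
  have haus: "Hausdorff_space (T I)" for I
    using T[of I] by (auto simp: polish_def
        intro: metrizable_imp_Hausdorff_space completely_metrizable_imp_metrizable_space)
  have "closedin ?X {x \<in> topspace ?X. x I = f J I (x J)}" if "I \<le> J" for I J
  proof (rule closedin_continuous_maps_eq[OF haus[of I]])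
    show "continuous_map ?X (T I) (\<lambda>x. x I)"
      by (rule continuous_map_product_projection) simp
    have "continuous_map (T J) (T I) (f J I)"
      using assms that by (auto simp: projective_system_def)
    with continuous_map_product_projection[of J UNIV T]
    show "continuous_map ?X (T I) (\<lambda>x. f J I (x J))"
      using continuous_map_compose[of ?X "T J" "\<lambda>x. x J" "T I" "f J I"] by (simp add: o_def)
  qed
  then have "closedin ?X (\<Inter>p\<in>{p. fst p \<le> snd p}.
      {x \<in> topspace ?X. x (fst p) = f (snd p) (fst p) (x (snd p))})"
    by (intro closedin_Inter) auto
  moreover have "(\<Inter>p\<in>{p. fst p \<le> snd p}.
      {x \<in> topspace ?X. x (fst p) = f (snd p) (fst p) (x (snd p))}) =
      topspace ?X \<inter> {x. \<forall>I J. I \<le> J \<longrightarrow> x I = f J I (x J)}"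
  proof (intro equalityI subsetI)
    fix x assume "x \<in> (\<Inter>p\<in>{p. fst p \<le> snd p}.
      {x \<in> topspace ?X. x (fst p) = f (snd p) (fst p) (x (snd p))})"
    then have *: "x \<in> topspace ?X \<and> x I = f J I (x J)" if "I \<le> J" for I J
      using that by (auto dest!: bspec[of _ _ "(I, J)"] simp del: topspace_product_topology)
    then show "x \<in> topspace ?X \<inter> {x. \<forall>I J. I \<le> J \<longrightarrow> x I = f J I (x J)}"
      by (intro IntI CollectI allI impI) (rule conjunct1[OF *[OF order_refl]], erule conjunct2[OF *])
  qed simp
  ultimately have closed: "closedin ?X (topspace ?X \<inter> {x. \<forall>I J. I \<le> J \<longrightarrow> x I = f J I (x J)})"
    by simp
  have "completely_metrizable_space ?X"
    unfolding completely_metrizable_space_product_topology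
    using T by (auto simp: polish_def)
  then have 1: "completely_metrizable_space (limit_topology T f)"
    using completely_metrizable_space_closedin[OF _ closed]
    unfolding limit_topology_def by (metis subtopology_restrict)
  have "\<exists>\<B>. countable_base (T I) \<B>" for I
    using polish_imp_second_countable[OF T] by (simp add: second_countable_iff_base)
  then obtain \<B> where "\<And>I. countable_base (T I) (\<B> I)" by metis
  from countable_base_product_topology[of T \<B>, OF this]
  have "second_countable ?X" unfolding second_countable_iff_base by (rule exI)
  then have "second_countable (limit_topology T f)"
    unfolding limit_topology_def by (rule second_countable_subtopology)
  with 1 show ?thesis by (simp add: polish_iff_second_countable)
qed

lemma second_countable_euclidean:
  "second_countable (euclidean :: 'a::second_countable_topology topology)"
proof -
  obtain \<B> :: "'a set set" where "countable \<B>" "topological_basis \<B>"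
    using ex_countable_basis by auto
  then have "countable_base euclidean \<B>"
    unfolding countable_base_def
    by (metis open_openin topological_basisE topological_basis_open)
  then show ?thesis by (auto simp: second_countable_iff_base)
qed

lemma polish_hyper_top:
  assumes "polish U"
  shows "polish (hyper_top U)"
proof -
  have "completely_metrizable_space (top_of_set {0::real..})"
    by (intro completely_metrizable_space_closedin completely_metrizable_space_euclidean) simp
  moreover have sc: "second_countable (top_of_set {0::real..})"
    by (intro second_countable_subtopology second_countable_euclidean)
  ultimately have "completely_metrizable_space (hyper_top U)"
    using assms unfolding hyper_top_def completely_metrizable_space_prod_topology
    by (simp add: polish_def)
  moreover obtain \<A> \<B> where "countable_base (top_of_set {0::real..}) \<A>" "countable_base U \<B>"
    using sc polish_imp_second_countable[OF assms] unfolding second_countable_iff_base by auto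
  from countable_base_prod_topology[OF this]
  have "second_countable (hyper_top U)"
    unfolding hyper_top_def second_countable_iff_base by (rule exI)
  ultimately show ?thesis by (simp add: polish_iff_second_countable)
qed

lemma measurable_fst_hyper_top: "fst \<in> borel_of (hyper_top U) \<rightarrow>\<^sub>M borel"
proof -
  have "continuous_map (hyper_top U) (top_of_set {0..}) fst"
    unfolding hyper_top_def by (rule continuous_map_fst)
  then have "continuous_map (hyper_top U) euclideanreal fst"
    by (rule continuous_map_into_fulltopology)
  from measurable_continuous_map[OF this] show ?thesis
    by (simp add: borel_of_def borel_def)
qed

lemma measurable_snd_hyper_top: "snd \<in> borel_of (hyper_top U) \<rightarrow>\<^sub>M borel_of U"
  unfolding hyper_top_def by (intro measurable_continuous_map continuous_map_snd)

lemma measurable_into_hyper_top: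
  assumes U: "second_countable U"
    and l: "l \<in> borel_measurable M" "\<And>\<omega>. \<omega> \<in> space M \<Longrightarrow> 0 \<le> l \<omega>"
    and \<gamma>: "\<gamma> \<in> M \<rightarrow>\<^sub>M borel_of U"
  shows "(\<lambda>\<omega>. (l \<omega>, \<gamma> \<omega>)) \<in> M \<rightarrow>\<^sub>M borel_of (hyper_top U)"
  unfolding hyper_top_def
proof (rule measurable_Pair_borel_of[OF _ U _ \<gamma>])
  show "second_countable (top_of_set {0::real..})"
    by (intro second_countable_subtopology second_countable_euclidean)
  show "l \<in> M \<rightarrow>\<^sub>M borel_of (top_of_set {0..})"
  proof (rule measurable_borel_ofI)
    show "l \<in> space M \<rightarrow> topspace (top_of_set {0..})" using l by auto
    fix V :: "real set" assume "openin (top_of_set {0..}) V"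
    then obtain W where "open W" "V = {0..} \<inter> W" by (auto simp: openin_open)
    then have "l -` V \<inter> space M = l -` W \<inter> space M" "W \<in> sets borel" using l by auto
    then show "l -` V \<inter> space M \<in> sets M" using l(1) by (auto intro: measurable_sets)
  qed
qed

section \<open>Measures determined by rectangles and by marginals, and Bayes' formula for densities\<close>

text \<open>
  The generators are assumed to contain the whole space, so that the rectangles cover the product by
  a set of finite measure.
\<close>

lemma measure_eqI_rectangles:
  assumes "finite_measure \<mu>"
    and sets: "sets \<mu> = sets (A \<Otimes>\<^sub>M B)" "sets \<nu> = sets (A \<Otimes>\<^sub>M B)"
    and \<A>: "Int_stable \<A>" "\<A> \<subseteq> Pow (space A)" "space A \<in> \<A>" "sets A = sigma_sets (space A) \<A>"
    and \<B>: "Int_stable \<B>" "\<B> \<subseteq> Pow (space B)" "space B \<in> \<B>" "sets B = sigma_sets (space B) \<B>"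
    and eq: "\<And>a b. a \<in> \<A> \<Longrightarrow> b \<in> \<B> \<Longrightarrow> emeasure \<mu> (a \<times> b) = emeasure \<nu> (a \<times> b)"
  shows "\<mu> = \<nu>"
proof -
  interpret finite_measure \<mu> by fact
  let ?E = "{a \<times> b | a b. a \<in> \<A> \<and> b \<in> \<B>}"
  have gen: "sets (A \<Otimes>\<^sub>M B) = sigma_sets (space A \<times> space B) ?E"
  proof -
    have "sets (A \<Otimes>\<^sub>M B) = sets (sigma (space A \<times> space B) ?E)"
      by (rule sets_pair_eq[where Ca="{space A}" and Cb="{space B}"]) (use \<A> \<B> in auto)
    also have "\<dots> = sigma_sets (space A \<times> space B) ?E"
      using \<A>(2) \<B>(2) by (intro sets_measure_of) blast
    finally show ?thesis .
  qed
  show ?thesis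
  proof (rule measure_eqI_generator_eq[where E="?E" and A="\<lambda>_. space A \<times> space B"
        and \<Omega>="space A \<times> space B"])
    show "Int_stable ?E"
      unfolding Int_stable_def
    proof safe
      fix a b a' b' assume "a \<in> \<A>" "b \<in> \<B>" "a' \<in> \<A>" "b' \<in> \<B>"
      then have "a \<inter> a' \<in> \<A>" "b \<inter> b' \<in> \<B>"
        using \<A>(1) \<B>(1) by (auto simp: Int_stable_def)
      then show "\<exists>aa ba. a \<times> b \<inter> a' \<times> b' = aa \<times> ba \<and> aa \<in> \<A> \<and> ba \<in> \<B>"
        by (auto simp: Times_Int_Times)
    qed
    show "?E \<subseteq> Pow (space A \<times> space B)" using \<A>(2) \<B>(2) by blast
    show "sets \<mu> = sigma_sets (space A \<times> space B) ?E" "sets \<nu> = sigma_sets (space A \<times> space B) ?E"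
      using sets gen by simp_all
    show "range (\<lambda>_. space A \<times> space B) \<subseteq> ?E" using \<A>(3) \<B>(3) by blast
    show "emeasure \<mu> X = emeasure \<nu> X" if "X \<in> ?E" for X using that eq by blast
  qed (simp_all add: emeasure_eq_measure)
qed

text \<open>
  The preimages under the maps \<open>p K\<close> generate the \<open>\<sigma>\<close>-algebra.  They are stable under intersection
  since, by directedness, two of them can be written as preimages under one and the same \<open>p K\<close>.
\<close>

lemma measure_eqI_directed_marginals:
  fixes p :: "'i::order \<Rightarrow> 'a \<Rightarrow> 'b"
  assumes "finite_measure \<mu>"
    and sets: "sets \<mu> = sets Z" "sets \<nu> = sets Z"
    and dir: "\<forall>I J :: 'i. \<exists>K. I \<le> K \<and> J \<le> K"
    and p: "\<And>K. p K \<in> Z \<rightarrow>\<^sub>M N K"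
    and q: "\<And>I K. I \<le> K \<Longrightarrow> q K I \<in> N K \<rightarrow>\<^sub>M N I"
      "\<And>I K z. I \<le> K \<Longrightarrow> z \<in> space Z \<Longrightarrow> p I z = q K I (p K z)"
    and gen: "sets Z \<subseteq> sigma_sets (space Z) (\<Union>K. {p K -` B \<inter> space Z | B. B \<in> sets (N K)})"
    and eq: "\<And>K B. B \<in> sets (N K) \<Longrightarrow>
      emeasure \<mu> (p K -` B \<inter> space Z) = emeasure \<nu> (p K -` B \<inter> space Z)"
  shows "\<mu> = \<nu>"
proof -
  interpret finite_measure \<mu> by fact
  let ?E = "\<Union>K. {p K -` B \<inter> space Z | B. B \<in> sets (N K)}"
  have E: "?E \<subseteq> sets Z" using p by (auto intro: measurable_sets)
  have lift: "\<exists>B'\<in>sets (N K). p I -` B \<inter> space Z = p K -` B' \<inter> space Z"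
    if "I \<le> K" "B \<in> sets (N I)" for I K B
  proof
    show "q K I -` B \<inter> space (N K) \<in> sets (N K)" using q(1) that by (auto intro: measurable_sets)
    show "p I -` B \<inter> space Z = p K -` (q K I -` B \<inter> space (N K)) \<inter> space Z"
      using q(2)[OF that(1)] measurable_space[OF p[of K]] by auto
  qed
  have gen': "sets Z = sigma_sets (space Z) ?E"
    by (rule equalityI[OF gen sets.sigma_sets_subset[OF E]])
  show ?thesis
  proof (rule measure_eqI_generator_eq[where E="?E" and A="\<lambda>_. space Z" and \<Omega>="space Z"])
    show "Int_stable ?E"
      unfolding Int_stable_def
    proof (intro ballI)
      fix a b assume "a \<in> ?E" "b \<in> ?E"
      then obtain I J A B where A: "A \<in> sets (N I)" "a = p I -` A \<inter> space Z"
        and B: "B \<in> sets (N J)" "b = p J -` B \<inter> space Z" by auto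
      obtain K where K: "I \<le> K" "J \<le> K" using dir by blast
      obtain A' where A': "A' \<in> sets (N K)" "a = p K -` A' \<inter> space Z"
        using lift[OF K(1) A(1)] A(2) by auto
      obtain B' where B': "B' \<in> sets (N K)" "b = p K -` B' \<inter> space Z"
        using lift[OF K(2) B(1)] B(2) by auto
      have "a \<inter> b = p K -` (A' \<inter> B') \<inter> space Z" using A' B' by auto
      then show "a \<inter> b \<in> ?E" using A' B' by blast
    qed
    show "?E \<subseteq> Pow (space Z)" by blast
    show "sets \<mu> = sigma_sets (space Z) ?E" "sets \<nu> = sigma_sets (space Z) ?E"
      by (rule trans[OF sets(1) gen'], rule trans[OF sets(2) gen'])
    have "space Z = p K -` space (N K) \<inter> space Z" for K
      using measurable_space[OF p[of K]] by auto
    then show "range (\<lambda>_. space Z) \<subseteq> ?E" using sets.top by blast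
    show "emeasure \<mu> X = emeasure \<nu> X" if "X \<in> ?E" for X using that eq by blast
  qed (simp_all add: emeasure_eq_measure)
qed

lemma ennreal_mult_divide_cancel: "c * (a / c) = a" if "c \<noteq> 0" "c \<noteq> \<infinity>" for a c :: ennreal
  using that by (simp add: ennreal_times_divide mult.commute[of c] mult_divide_eq_ennreal)

text \<open>
  The denominator \<open>m v\<close> is the density of the law of \<open>V\<close> with respect to \<open>\<kappa>\<close>.  It is finite
  \<open>\<kappa>\<close>-almost everywhere because its integral is \<open>1\<close>, and positive almost everywhere for the law it
  defines.  For exponential families the first claim says that posterior densities can be normalized.
\<close>

lemma bayes_density:
  fixes \<rho> :: "'t \<times> 'v \<Rightarrow> ennreal"
  assumes "prob_space M" "sigma_finite_measure \<nu>" "sigma_finite_measure \<kappa>"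
    and U[measurable]: "U \<in> M \<rightarrow>\<^sub>M \<nu>" and V[measurable]: "V \<in> M \<rightarrow>\<^sub>M \<kappa>"
    and \<rho>[measurable]: "\<rho> \<in> borel_measurable (\<nu> \<Otimes>\<^sub>M \<kappa>)"
    and joint: "distr M (\<nu> \<Otimes>\<^sub>M \<kappa>) (\<lambda>\<omega>. (U \<omega>, V \<omega>)) = density (\<nu> \<Otimes>\<^sub>M \<kappa>) \<rho>"
  defines "m \<equiv> \<lambda>v. \<integral>\<^sup>+t. \<rho> (t, v) \<partial>\<nu>"
  shows "AE \<omega> in M. 0 < m (V \<omega>) \<and> m (V \<omega>) < \<infinity>" (is ?AE)
    and "\<And>B C. B \<in> sets \<nu> \<Longrightarrow> C \<in> sets \<kappa> \<Longrightarrow>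
      emeasure M {\<omega>\<in>space M. U \<omega> \<in> B \<and> V \<omega> \<in> C} =
      (\<integral>\<^sup>+\<omega>. indicator C (V \<omega>) * ((\<integral>\<^sup>+t. \<rho> (t, V \<omega>) * indicator B t \<partial>\<nu>) / m (V \<omega>)) \<partial>M)"
proof -
  interpret prob_space M by fact
  interpret \<nu>: sigma_finite_measure \<nu> by fact
  interpret \<kappa>: sigma_finite_measure \<kappa> by fact
  interpret pair_sigma_finite \<nu> \<kappa> ..
  have m[measurable]: "m \<in> borel_measurable \<kappa>"
    unfolding m_def by measurable
  have rect: "emeasure M {\<omega>\<in>space M. U \<omega> \<in> B \<and> V \<omega> \<in> C} =
      (\<integral>\<^sup>+v. (\<integral>\<^sup>+t. \<rho> (t, v) * indicator B t \<partial>\<nu>) * indicator C v \<partial>\<kappa>)"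
    if [measurable]: "B \<in> sets \<nu>" "C \<in> sets \<kappa>" for B C
  proof -
    have "emeasure M {\<omega>\<in>space M. U \<omega> \<in> B \<and> V \<omega> \<in> C} =
        emeasure (distr M (\<nu> \<Otimes>\<^sub>M \<kappa>) (\<lambda>\<omega>. (U \<omega>, V \<omega>))) (B \<times> C)"
      by (subst emeasure_distr) (auto intro!: arg_cong[where f="emeasure M"])
    also have "\<dots> = (\<integral>\<^sup>+z. \<rho> z * indicator (B \<times> C) z \<partial>(\<nu> \<Otimes>\<^sub>M \<kappa>))"
      unfolding joint by (subst emeasure_density) auto
    also have "\<dots> = (\<integral>\<^sup>+v. \<integral>\<^sup>+t. \<rho> (t, v) * indicator (B \<times> C) (t, v) \<partial>\<nu> \<partial>\<kappa>)"
      by (subst nn_integral_snd[symmetric]) auto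
    also have "\<dots> = (\<integral>\<^sup>+v. (\<integral>\<^sup>+t. \<rho> (t, v) * indicator B t \<partial>\<nu>) * indicator C v \<partial>\<kappa>)"
      by (intro nn_integral_cong) (auto simp: indicator_times indicator_def)
    finally show ?thesis .
  qed
  have "emeasure (distr M \<kappa> V) C = emeasure (density \<kappa> m) C" if C[measurable]: "C \<in> sets \<kappa>" for C
  proof -
    have "emeasure (distr M \<kappa> V) C = emeasure M {\<omega>\<in>space M. U \<omega> \<in> space \<nu> \<and> V \<omega> \<in> C}"
      by (subst emeasure_distr)
        (auto intro!: arg_cong[where f="emeasure M"] simp: measurable_space[OF U])
    also have "\<dots> = (\<integral>\<^sup>+v. m v * indicator C v \<partial>\<kappa>)"
      unfolding rect[OF sets.top C] m_def
      by (intro nn_integral_cong arg_cong2[where f="(*)"] refl) simp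
    finally show ?thesis by (simp add: emeasure_density)
  qed
  then have law: "distr M \<kappa> V = density \<kappa> m" by (intro measure_eqI) auto
  have "(\<integral>\<^sup>+v. m v \<partial>\<kappa>) = emeasure (density \<kappa> m) (space \<kappa>)"
    by (subst emeasure_density) (auto intro!: nn_integral_cong)
  also have "\<dots> = 1"
    using prob_space.emeasure_space_1[OF prob_space_distr[OF V]] by (simp add: law)
  finally have fin: "AE v in \<kappa>. m v \<noteq> \<infinity>"
    by (intro nn_integral_noteq_infinite) auto
  then have "AE v in density \<kappa> m. 0 < m v \<and> m v < \<infinity>"
    by (subst AE_density) (auto simp: less_top)
  then have "AE v in distr M \<kappa> V. 0 < m v \<and> m v < \<infinity>" unfolding law .
  then show ?AE by (subst (asm) AE_distr_iff) auto
  fix B C assume [measurable]: "B \<in> sets \<nu>" "C \<in> sets \<kappa>"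
  let ?n = "\<lambda>v. \<integral>\<^sup>+t. \<rho> (t, v) * indicator B t \<partial>\<nu>"
  have "(\<integral>\<^sup>+\<omega>. indicator C (V \<omega>) * (?n (V \<omega>) / m (V \<omega>)) \<partial>M) =
      (\<integral>\<^sup>+v. indicator C v * (?n v / m v) \<partial>density \<kappa> m)"
    unfolding law[symmetric] by (subst nn_integral_distr) auto
  also have "\<dots> = (\<integral>\<^sup>+v. m v * (indicator C v * (?n v / m v)) \<partial>\<kappa>)"
    by (subst nn_integral_density) auto
  also have "\<dots> = (\<integral>\<^sup>+v. ?n v * indicator C v \<partial>\<kappa>)"
  proof (intro nn_integral_cong_AE, use fin in eventually_elim)
    fix v assume v: "m v \<noteq> \<infinity>"
    have le: "?n v \<le> m v"
      unfolding m_def by (intro nn_integral_mono) (auto simp: indicator_def)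
    show "m v * (indicator C v * (?n v / m v)) = ?n v * indicator C v"
    proof (cases "m v = 0")
      case True
      then have "?n v = 0" using le by simp
      then show ?thesis using True by simp
    next
      case False
      then have "m v * (?n v / m v) = ?n v"
        using v by (intro ennreal_mult_divide_cancel) auto
      then show ?thesis by (simp add: mult.left_commute mult.commute indicator_def)
    qed
  qed
  finally show "emeasure M {\<omega>\<in>space M. U \<omega> \<in> B \<and> V \<omega> \<in> C} =
      (\<integral>\<^sup>+\<omega>. indicator C (V \<omega>) * (?n (V \<omega>) / m (V \<omega>)) \<partial>M)"
    by (simp add: rect)
qed

section \<open>Conditional probabilities and conditional independence\<close>

lemma subalgebra_vimage:
  assumes "Z \<in> M \<rightarrow>\<^sub>M N" shows "subalgebra M (vimage_algebra (space M) Z N)"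
  using assms unfolding subalgebra_def measurable_iff_sets by simp

lemma measurable_comp_vimage_algebra:
  assumes "Z \<in> M \<rightarrow>\<^sub>M N" "w \<in> N \<rightarrow>\<^sub>M L"
  shows "(\<lambda>\<omega>. w (Z \<omega>)) \<in> vimage_algebra (space M) Z N \<rightarrow>\<^sub>M L"
  using measurable_compose[OF measurable_vimage_algebra1 assms(2)] assms(1)
  by (auto simp: measurable_def)

lemma sets_vimageE:
  assumes "Z \<in> M \<rightarrow>\<^sub>M N" "D \<in> sets (vimage_algebra (space M) Z N)"
  obtains C where "C \<in> sets N" "D = Z -` C \<inter> space M"
  using assms sets_vimage_algebra2[of Z "space M" N] by (auto simp: measurable_def)

context prob_space
begin

lemma given_prob_integral:
  assumes Z: "Z \<in> M \<rightarrow>\<^sub>M N" and A: "A \<in> sets M" and C: "C \<in> sets N"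
  shows "measure M (A \<inter> (Z -` C \<inter> space M)) = (\<integral>\<omega>. indicator C (Z \<omega>) * given_prob M Z N A \<omega> \<partial>M)"
proof -
  let ?F = "vimage_algebra (space M) Z N"
  interpret finite_measure_subalgebra M ?F
    by unfold_locales (rule subalgebra_vimage[OF Z])
  have "Z -` C \<inter> space M \<in> sets ?F" using C by (rule in_vimage_algebra)
  then have "set_lebesgue_integral M (Z -` C \<inter> space M) (indicator A :: _ \<Rightarrow> real)
      = set_lebesgue_integral M (Z -` C \<inter> space M) (real_cond_exp M ?F (indicator A))"
    by (rule real_cond_exp_intA[rotated]) (use A in \<open>simp add: integrable_real_indicator emeasure_eq_measure\<close>)
  moreover have "set_lebesgue_integral M (Z -` C \<inter> space M) (indicator A :: _ \<Rightarrow> real)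
      = (\<integral>\<omega>. indicator (A \<inter> (Z -` C \<inter> space M)) \<omega> \<partial>M)"
    unfolding set_lebesgue_integral_def by (intro Bochner_Integration.integral_cong) (auto simp: indicator_def)
  moreover have "\<dots> = measure M (A \<inter> (Z -` C \<inter> space M))"
    using sets.sets_into_space[OF A] by (simp add: Int_absorb2 Int_assoc inf.absorb1)
  moreover have "set_lebesgue_integral M (Z -` C \<inter> space M) (real_cond_exp M ?F (indicator A))
      = (\<integral>\<omega>. indicator C (Z \<omega>) * given_prob M Z N A \<omega> \<partial>M)"
    unfolding set_lebesgue_integral_def given_prob_def
    by (intro Bochner_Integration.integral_cong) (auto simp: indicator_def)
  ultimately show ?thesis by simp
qed

lemma given_prob_eqI:
  assumes Z: "Z \<in> M \<rightarrow>\<^sub>M N" and A: "A \<in> sets M"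
    and g: "g \<in> borel_measurable (vimage_algebra (space M) Z N)" "integrable M g"
    and eq: "\<And>C. C \<in> sets N \<Longrightarrow>
      measure M (A \<inter> (Z -` C \<inter> space M)) = (\<integral>\<omega>. indicator C (Z \<omega>) * g \<omega> \<partial>M)"
  shows "AE \<omega> in M. given_prob M Z N A \<omega> = g \<omega>"
proof -
  let ?F = "vimage_algebra (space M) Z N"
  interpret finite_measure_subalgebra M ?F
    by unfold_locales (rule subalgebra_vimage[OF Z])
  show ?thesis unfolding given_prob_def
  proof (rule real_cond_exp_charact)
    show "integrable M (indicator A :: _ \<Rightarrow> real)"
      using A by (simp add: integrable_real_indicator emeasure_eq_measure)
    show "integrable M g" "g \<in> borel_measurable ?F" by fact+
    fix D assume "D \<in> sets ?F"
    then obtain C where C: "C \<in> sets N" "D = Z -` C \<inter> space M" by (rule sets_vimageE[OF Z])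
    have "set_lebesgue_integral M D (indicator A :: _ \<Rightarrow> real) = (\<integral>\<omega>. indicator (A \<inter> D) \<omega> \<partial>M)"
      unfolding set_lebesgue_integral_def
      by (intro Bochner_Integration.integral_cong) (auto simp: indicator_def)
    also have "\<dots> = measure M (A \<inter> D)"
      using sets.sets_into_space[OF A] by (simp add: inf.absorb1 inf.coboundedI1)
    also have "\<dots> = (\<integral>\<omega>. indicator C (Z \<omega>) * g \<omega> \<partial>M)"
      unfolding C(2) by (rule eq[OF C(1)])
    also have "\<dots> = set_lebesgue_integral M D g"
      unfolding set_lebesgue_integral_def C(2)
      by (intro Bochner_Integration.integral_cong) (auto simp: indicator_def)
    finally show "set_lebesgue_integral M D (indicator A :: _ \<Rightarrow> real) = set_lebesgue_integral M D g" .
  qed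
qed

text \<open>
  This translates between conditional probabilities and joint laws; all computations below are done
  with the latter.  The bounds on \<open>w\<close> hold for probabilities of a kernel.
\<close>

lemma given_prob_eq_iff:
  fixes w :: "'z \<Rightarrow> real"
  assumes Z[measurable]: "Z \<in> M \<rightarrow>\<^sub>M N" and A: "A \<in> sets M"
    and w[measurable]: "w \<in> borel_measurable N"
    and bd: "\<And>z. z \<in> space N \<Longrightarrow> 0 \<le> w z \<and> w z \<le> 1"
  shows "(AE \<omega> in M. given_prob M Z N A \<omega> = w (Z \<omega>)) \<longleftrightarrow>
    (\<forall>C\<in>sets N. emeasure M (A \<inter> (Z -` C \<inter> space M)) =
       (\<integral>\<^sup>+\<omega>. indicator C (Z \<omega>) * ennreal (w (Z \<omega>)) \<partial>M))"
proof -
  have bd': "0 \<le> w (Z \<omega>)" "w (Z \<omega>) \<le> 1" if "\<omega> \<in> space M" for \<omega>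
    using bd[of "Z \<omega>"] measurable_space[OF Z that] by auto
  have int: "integrable M (\<lambda>\<omega>. indicator C (Z \<omega>) * w (Z \<omega>))" if [measurable]: "C \<in> sets N" for C
    by (rule integrable_const_bound[of _ 1]) (auto intro!: AE_I2 simp: bd' indicator_def)
  have conv: "(\<integral>\<^sup>+\<omega>. indicator C (Z \<omega>) * ennreal (w (Z \<omega>)) \<partial>M) =
      ennreal (\<integral>\<omega>. indicator C (Z \<omega>) * w (Z \<omega>) \<partial>M)" if "C \<in> sets N" for C
  proof -
    have "(\<integral>\<^sup>+\<omega>. indicator C (Z \<omega>) * ennreal (w (Z \<omega>)) \<partial>M) =
        (\<integral>\<^sup>+\<omega>. ennreal (indicator C (Z \<omega>) * w (Z \<omega>)) \<partial>M)"
      by (intro nn_integral_cong) (auto simp: indicator_def)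
    also have "\<dots> = ennreal (\<integral>\<omega>. indicator C (Z \<omega>) * w (Z \<omega>) \<partial>M)"
      using int[OF that] by (rule nn_integral_eq_integral) (auto intro!: AE_I2 simp: bd')
    finally show ?thesis .
  qed
  have iff: "emeasure M (A \<inter> (Z -` C \<inter> space M)) =
       (\<integral>\<^sup>+\<omega>. indicator C (Z \<omega>) * ennreal (w (Z \<omega>)) \<partial>M) \<longleftrightarrow>
      measure M (A \<inter> (Z -` C \<inter> space M)) = (\<integral>\<omega>. indicator C (Z \<omega>) * w (Z \<omega>) \<partial>M)"
    if "C \<in> sets N" for C
    unfolding conv[OF that] emeasure_eq_measure
    by (rule ennreal_inj) (auto intro!: integral_nonneg_AE AE_I2 simp: bd')
  show ?thesis
  proof
    assume AE: "AE \<omega> in M. given_prob M Z N A \<omega> = w (Z \<omega>)"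
    show "\<forall>C\<in>sets N. emeasure M (A \<inter> (Z -` C \<inter> space M)) =
       (\<integral>\<^sup>+\<omega>. indicator C (Z \<omega>) * ennreal (w (Z \<omega>)) \<partial>M)"
    proof
      fix C assume C[measurable]: "C \<in> sets N"
      have [measurable]: "given_prob M Z N A \<in> borel_measurable M"
        unfolding given_prob_def by simp
      have "(\<integral>\<omega>. indicator C (Z \<omega>) * given_prob M Z N A \<omega> \<partial>M) = (\<integral>\<omega>. indicator C (Z \<omega>) * w (Z \<omega>) \<partial>M)"
        by (rule integral_cong_AE) (use AE in auto)
      then show "emeasure M (A \<inter> (Z -` C \<inter> space M)) =
         (\<integral>\<^sup>+\<omega>. indicator C (Z \<omega>) * ennreal (w (Z \<omega>)) \<partial>M)"
        unfolding iff[OF C] given_prob_integral[OF Z A C] .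
    qed
  next
    assume *: "\<forall>C\<in>sets N. emeasure M (A \<inter> (Z -` C \<inter> space M)) =
       (\<integral>\<^sup>+\<omega>. indicator C (Z \<omega>) * ennreal (w (Z \<omega>)) \<partial>M)"
    show "AE \<omega> in M. given_prob M Z N A \<omega> = w (Z \<omega>)"
    proof (rule given_prob_eqI[OF Z A measurable_comp_vimage_algebra[OF Z w]])
      show "integrable M (\<lambda>x. w (Z x))"
        by (rule integrable_const_bound[of _ 1]) (auto intro!: AE_I2 simp: bd')
    qed (use * iff in blast)
  qed
qed

end

lemma (in sigma_finite_subalgebra) integral_abs_real_cond_exp_le:
  assumes f: "integrable M f"
  shows "(\<integral>x. \<bar>real_cond_exp M F f x\<bar> \<partial>M) \<le> (\<integral>x. \<bar>f x\<bar> \<partial>M)"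
proof -
  have abs: "integrable M (\<lambda>x. \<bar>f x\<bar>)" and minus: "integrable M (\<lambda>x. - \<bar>f x\<bar>)"
    using f by auto
  have "AE x in M. real_cond_exp M F f x \<le> real_cond_exp M F (\<lambda>x. \<bar>f x\<bar>) x"
    by (rule real_cond_exp_mono[OF _ f abs]) simp
  moreover have "AE x in M. real_cond_exp M F (\<lambda>x. - \<bar>f x\<bar>) x \<le> real_cond_exp M F f x"
    by (rule real_cond_exp_mono[OF _ minus f]) simp
  moreover have "AE x in M. real_cond_exp M F (\<lambda>x. (-1) * \<bar>f x\<bar>) x = (-1) * real_cond_exp M F (\<lambda>x. \<bar>f x\<bar>) x"
    by (rule real_cond_exp_cmult[OF abs])
  ultimately have "AE x in M. \<bar>real_cond_exp M F f x\<bar> \<le> real_cond_exp M F (\<lambda>x. \<bar>f x\<bar>) x"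
    by eventually_elim auto
  then have "(\<integral>x. \<bar>real_cond_exp M F f x\<bar> \<partial>M) \<le> (\<integral>x. real_cond_exp M F (\<lambda>x. \<bar>f x\<bar>) x \<partial>M)"
    using real_cond_exp_int(1)[OF f] real_cond_exp_int(1)[OF abs] by (intro integral_mono_AE) auto
  also have "\<dots> = (\<integral>x. \<bar>f x\<bar> \<partial>M)" by (rule real_cond_exp_int(2)[OF abs])
  finally show ?thesis .
qed

text \<open>
  The \<open>\<sigma>\<close>-algebras of the observation at the single indices form such a family.
\<close>

locale directed_subalgebras = prob_space M for M :: "'w measure" +
  fixes G :: "'k \<Rightarrow> 'w measure"
  assumes subalg: "subalgebra M (G K)"
    and directed: "\<exists>N. sets (G K) \<subseteq> sets (G N) \<and> sets (G L) \<subseteq> sets (G N)"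
begin

lemma space_G: "space (G K) = space M"
  using subalg[of K] by (simp add: subalgebra_def)

lemma sets_GD: "C \<in> sets (G K) \<Longrightarrow> C \<in> sets M"
  using subalg[of K] by (auto simp: subalgebra_def)

lemma directed_finite: "\<exists>N. \<forall>i<n::nat. sets (G (K i)) \<subseteq> sets (G N)"
proof (induction n)
  case (Suc n)
  then obtain N where N: "\<forall>i<n. sets (G (K i)) \<subseteq> sets (G N)" by blast
  obtain N' where "sets (G N) \<subseteq> sets (G N')" "sets (G (K n)) \<subseteq> sets (G N')"
    using directed by blast
  with N have "\<forall>i<Suc n. sets (G (K i)) \<subseteq> sets (G N')" by (auto simp: less_Suc_eq)
  then show ?case by blast
qed simp

text \<open>
  The sets that can be approximated in measure by sets of the family form a \<open>\<sigma>\<close>-algebra.  For a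
  countable union, all but finitely many of the sets are dropped and the rest are approximated within
  one common member of the family.
\<close>

lemma sets_approx:
  assumes "A \<in> sigma_sets (space M) (\<Union>K. sets (G K))" and "0 < \<epsilon>"
  shows "\<exists>K. \<exists>C\<in>sets (G K). measure M ((A - C) \<union> (C - A)) < \<epsilon>"
  using assms
proof (induction arbitrary: \<epsilon>)
  case (Basic A)
  then obtain K where "A \<in> sets (G K)" by blast
  then show ?case using Basic.prems by (intro exI[of _ K] bexI[of _ A]) auto
next
  case Empty
  then show ?case by (intro exI bexI[of _ "{}"]) auto
next
  case (Compl A)
  then obtain K C where C: "C \<in> sets (G K)" "measure M ((A - C) \<union> (C - A)) < \<epsilon>" by blast
  have "A \<subseteq> space M"
    using Compl.hyps sigma_sets_into_sp[of "\<Union>K. sets (G K)" "space M"] sets_GD sets.sets_into_space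
    by blast
  moreover have "C \<subseteq> space M" using C(1) sets_GD sets.sets_into_space by blast
  ultimately have "((space M - A) - (space M - C)) \<union> ((space M - C) - (space M - A)) = (A - C) \<union> (C - A)"
    by blast
  moreover have "space M - C \<in> sets (G K)"
    using sets.compl_sets[OF C(1)] by (simp add: space_G)
  ultimately show ?case using C(2) by (intro exI[of _ K] bexI[of _ "space M - C"]) auto
next
  case (Union A)
  have A: "A i \<in> sets M" for i
  proof -
    have "sigma_sets (space M) (\<Union>K. sets (G K)) \<subseteq> sets M"
      using sets_GD by (intro sets.sigma_sets_subset) blast
    then show ?thesis using Union.hyps[of i] by blast
  qed
  have "(\<lambda>n. measure M (\<Union>i<n. A i)) \<longlonglongrightarrow> measure M (\<Union>n. \<Union>i<n. A i)"
    using A by (intro finite_Lim_measure_incseq) (auto simp: incseq_def intro: less_le_trans)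
  moreover have "(\<Union>n. \<Union>i<n. A i) = (\<Union>i. A i)" by blast
  ultimately have "\<forall>\<^sub>F n in sequentially. \<bar>measure M (\<Union>i<n. A i) - measure M (\<Union>i. A i)\<bar> < \<epsilon> / 2"
    using Union.prems by (auto simp: tendsto_iff dist_real_def elim!: allE[of _ "\<epsilon> / 2"])
  then obtain n where n: "\<bar>measure M (\<Union>i<n. A i) - measure M (\<Union>i. A i)\<bar> < \<epsilon> / 2"
    by (auto simp: eventually_sequentially)
  have "measure M ((\<Union>i. A i) - (\<Union>i<n. A i)) = measure M (\<Union>i. A i) - measure M (\<Union>i<n. A i)"
    using A by (intro finite_measure_Diff) auto
  then have tail: "measure M ((\<Union>i. A i) - (\<Union>i<n. A i)) < \<epsilon> / 2" using n by linarith
  define \<delta> where "\<delta> = \<epsilon> / (2 * (real n + 1))"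
  have "0 < \<delta>" using Union.prems by (simp add: \<delta>_def)
  from Union.IH[OF this] obtain K C where C: "\<And>i. C i \<in> sets (G (K i))"
      "\<And>i. measure M ((A i - C i) \<union> (C i - A i)) < \<delta>" by metis
  obtain N where N: "\<forall>i<n. sets (G (K i)) \<subseteq> sets (G N)" using directed_finite by blast
  let ?C = "\<Union>i<n. C i"
  have CN: "?C \<in> sets (G N)" using C(1) N by (intro sets.finite_UN) auto
  have CM: "C i \<in> sets M" for i using C(1) sets_GD by blast
  let ?D = "\<lambda>i. (A i - C i) \<union> (C i - A i)"
  have D: "?D i \<in> sets M" for i using A CM by blast
  have "((\<Union>i. A i) - ?C) \<union> (?C - (\<Union>i. A i)) \<subseteq> ((\<Union>i. A i) - (\<Union>i<n. A i)) \<union> (\<Union>i<n. ?D i)"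
    by blast
  then have "measure M (((\<Union>i. A i) - ?C) \<union> (?C - (\<Union>i. A i))) \<le>
      measure M (((\<Union>i. A i) - (\<Union>i<n. A i)) \<union> (\<Union>i<n. ?D i))"
    using A D by (intro finite_measure_mono) auto
  also have "\<dots> \<le> measure M ((\<Union>i. A i) - (\<Union>i<n. A i)) + measure M (\<Union>i<n. ?D i)"
    using A D by (intro measure_Un_le) auto
  also have "measure M (\<Union>i<n. ?D i) \<le> (\<Sum>i<n. measure M (?D i))"
    using D by (intro finite_measure_subadditive_finite) auto
  also have "\<dots> \<le> (\<Sum>i<n. \<delta>)" using C(2) by (intro sum_mono) (simp add: less_imp_le)
  also have "(\<Sum>i<n. \<delta>) \<le> \<epsilon> / 2"
    using Union.prems by (simp add: \<delta>_def field_simps)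
  finally have "measure M (((\<Union>i. A i) - ?C) \<union> (?C - (\<Union>i. A i))) < \<epsilon>" using tail by simp
  then show ?case using CN by blast
qed

lemma measurable_G_mono:
  assumes "sets (G K) \<subseteq> sets (G N)" "w \<in> borel_measurable (G K)"
  shows "w \<in> borel_measurable (G N)"
  using assms by (auto simp: measurable_def space_G)

lemma integrable_approx:
  fixes w :: "'w \<Rightarrow> real"
  assumes F: "subalgebra M F" "sets F \<subseteq> sigma_sets (space M) (\<Union>K. sets (G K))"
    and "w \<in> borel_measurable F" "integrable M w" "0 < \<epsilon>"
  shows "\<exists>K w'. w' \<in> borel_measurable (G K) \<and> integrable M w' \<and> (\<integral>x. \<bar>w x - w' x\<bar> \<partial>M) < \<epsilon>"
proof -
  have "integrable (restr_to_subalg M F) w"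
    using integrable_in_subalg assms by blast
  then show ?thesis using \<open>0 < \<epsilon>\<close>
  proof (induction arbitrary: \<epsilon> rule: integrable_induct)
    case (base A c)
    then have A: "A \<in> sets F" by (simp add: sets_restr_to_subalg[OF F(1)])
    then have AM: "A \<in> sets M" using F(1) by (auto simp: subalgebra_def)
    have "0 < \<epsilon> / (\<bar>c\<bar> + 1)" using base by simp
    then obtain K C where C: "C \<in> sets (G K)" "measure M ((A - C) \<union> (C - A)) < \<epsilon> / (\<bar>c\<bar> + 1)"
      using sets_approx F(2) A by blast
    have CM: "C \<in> sets M" by (rule sets_GD[OF C(1)])
    have "(\<integral>x. \<bar>indicator A x *\<^sub>R c - indicator C x *\<^sub>R c\<bar> \<partial>M) =
        (\<integral>x. \<bar>c\<bar> * indicator ((A - C) \<union> (C - A)) x \<partial>M)"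
      by (intro Bochner_Integration.integral_cong) (auto simp: indicator_def)
    also have "\<dots> = \<bar>c\<bar> * measure M ((A - C) \<union> (C - A))"
      using AM CM by simp
    also have "\<dots> \<le> (\<bar>c\<bar> + 1) * measure M ((A - C) \<union> (C - A))"
      by (intro mult_right_mono) auto
    also have "\<dots> < \<epsilon>" using C(2) by (simp add: field_simps)
    finally have "(\<integral>x. \<bar>indicator A x *\<^sub>R c - indicator C x *\<^sub>R c\<bar> \<partial>M) < \<epsilon>" .
    moreover have "(\<lambda>x. indicator C x *\<^sub>R c) \<in> borel_measurable (G K)" using C(1) by measurable
    moreover have "integrable M (\<lambda>x. indicator C x *\<^sub>R c)"
      using CM by (simp add: emeasure_eq_measure)
    ultimately show ?case by blast
  next
    case (add f g)
    from add.IH(1)[of "\<epsilon> / 2"] add.prems obtain K f' where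
      f': "f' \<in> borel_measurable (G K)" "integrable M f'" "(\<integral>x. \<bar>f x - f' x\<bar> \<partial>M) < \<epsilon> / 2" by auto
    from add.IH(2)[of "\<epsilon> / 2"] add.prems obtain L g' where
      g': "g' \<in> borel_measurable (G L)" "integrable M g'" "(\<integral>x. \<bar>g x - g' x\<bar> \<partial>M) < \<epsilon> / 2" by auto
    obtain N where N: "sets (G K) \<subseteq> sets (G N)" "sets (G L) \<subseteq> sets (G N)" using directed by blast
    have fg: "integrable M f" "integrable M g"
      using add.hyps by (auto intro: integrable_from_subalg[OF F(1)])
    have "(\<integral>x. \<bar>f x + g x - (f' x + g' x)\<bar> \<partial>M) \<le> (\<integral>x. \<bar>f x - f' x\<bar> + \<bar>g x - g' x\<bar> \<partial>M)"
      using fg f' g' by (intro integral_mono) auto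
    also have "\<dots> = (\<integral>x. \<bar>f x - f' x\<bar> \<partial>M) + (\<integral>x. \<bar>g x - g' x\<bar> \<partial>M)"
      using fg f' g' by simp
    also have "\<dots> < \<epsilon>" using f' g' by simp
    finally have "(\<integral>x. \<bar>f x + g x - (f' x + g' x)\<bar> \<partial>M) < \<epsilon>" .
    moreover have "(\<lambda>x. f' x + g' x) \<in> borel_measurable (G N)"
      using measurable_G_mono[OF N(1) f'(1)] measurable_G_mono[OF N(2) g'(1)] by simp
    moreover have "integrable M (\<lambda>x. f' x + g' x)" using f' g' by simp
    ultimately show ?case by blast
  next
    case (lim f s)
    have f: "integrable M f" and s: "integrable M (s i)" for i
      using lim.hyps by (auto intro: integrable_from_subalg[OF F(1)])
    have sp: "space (restr_to_subalg M F) = space M" by (rule space_restr_to_subalg)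
    have "(\<lambda>i. \<integral>x. \<bar>s i x - f x\<bar> \<partial>M) \<longlonglongrightarrow> (\<integral>x. 0 \<partial>M)"
    proof (rule integral_dominated_convergence[where w="\<lambda>x. 3 * norm (f x)"])
      show "AE x in M. (\<lambda>i. \<bar>s i x - f x\<bar>) \<longlonglongrightarrow> 0"
      proof (intro AE_I2)
        fix x assume "x \<in> space M"
        then have "(\<lambda>i. s i x) \<longlonglongrightarrow> f x" using lim.hyps(2) sp by simp
        then show "(\<lambda>i. \<bar>s i x - f x\<bar>) \<longlonglongrightarrow> 0" by (rule tendsto_rabs_zero[OF LIM_zero])
      qed
      show "AE x in M. norm \<bar>s i x - f x\<bar> \<le> 3 * norm (f x)" for i
      proof (intro AE_I2)
        fix x assume "x \<in> space M"
        then have "norm (s i x) \<le> 2 * norm (f x)" using lim.hyps(3) sp by simp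
        then show "norm \<bar>s i x - f x\<bar> \<le> 3 * norm (f x)" by auto
      qed
    qed (use f s in auto)
    then have "\<forall>\<^sub>F i in sequentially. (\<integral>x. \<bar>s i x - f x\<bar> \<partial>M) < \<epsilon> / 2"
      using lim.prems by (intro order_tendstoD(2)) auto
    then obtain i where i: "(\<integral>x. \<bar>s i x - f x\<bar> \<partial>M) < \<epsilon> / 2"
      by (auto simp: eventually_sequentially)
    from lim.IH[of "\<epsilon> / 2" i] lim.prems obtain K w' where
      w': "w' \<in> borel_measurable (G K)" "integrable M w'" "(\<integral>x. \<bar>s i x - w' x\<bar> \<partial>M) < \<epsilon> / 2" by auto
    have "(\<integral>x. \<bar>f x - w' x\<bar> \<partial>M) \<le> (\<integral>x. \<bar>s i x - f x\<bar> + \<bar>s i x - w' x\<bar> \<partial>M)"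
      using f s w' by (intro integral_mono) auto
    also have "\<dots> = (\<integral>x. \<bar>s i x - f x\<bar> \<partial>M) + (\<integral>x. \<bar>s i x - w' x\<bar> \<partial>M)"
      using f s w' by simp
    also have "\<dots> < \<epsilon>" using i w' by simp
    finally show ?case using w' by blast
  qed
qed

text \<open>
  A function measurable at stage \<open>K\<close> that is \<open>L\<^sup>1\<close>-close to the conditional expectation given \<open>F\<close> is
  also close to the one given \<open>G K\<close>, because conditioning is an \<open>L\<^sup>1\<close>-contraction.  So the
  \<open>H\<close>-measurable functions \<open>v\<close> come arbitrarily close to the conditional expectation given \<open>F\<close>, which
  therefore agrees with its own conditional expectation given \<open>H\<close>.
\<close>

lemma real_cond_exp_directed:
  assumes F: "subalgebra M F" "sets F \<subseteq> sigma_sets (space M) (\<Union>K. sets (G K))"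
    and GF: "\<And>K. subalgebra F (G K)" and H: "subalgebra F H"
    and u: "integrable M u"
    and v: "\<And>K. \<exists>v\<in>borel_measurable H. AE x in M. real_cond_exp M (G K) u x = v x"
  shows "AE x in M. real_cond_exp M F u x = real_cond_exp M H u x"
proof -
  have HM: "subalgebra M H" using F(1) H by (auto simp: subalgebra_def)
  interpret F: finite_measure_subalgebra M F by unfold_locales (rule F(1))
  interpret H: finite_measure_subalgebra M H by unfold_locales (rule HM)
  define m where "m = real_cond_exp M F u"
  have m: "integrable M m" unfolding m_def by (rule F.real_cond_exp_int(1)[OF u])
  have int_H: "integrable M (real_cond_exp M H m)" by (rule H.real_cond_exp_int(1)[OF m])
  have "(\<integral>x. \<bar>m x - real_cond_exp M H m x\<bar> \<partial>M) \<le> 0 + \<epsilon>" if "0 < \<epsilon>" for \<epsilon>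
  proof -
    have "m \<in> borel_measurable F" unfolding m_def by simp
    moreover have "0 < \<epsilon> / 4" using that by simp
    ultimately obtain K w' where w': "w' \<in> borel_measurable (G K)" "integrable M w'"
        "(\<integral>x. \<bar>m x - w' x\<bar> \<partial>M) < \<epsilon> / 4"
      using integrable_approx[OF F _ m] by blast
    obtain v where vH: "v \<in> borel_measurable H" and v_eq: "AE x in M. real_cond_exp M (G K) u x = v x"
      using v by blast
    interpret G: finite_measure_subalgebra M "G K" by unfold_locales (rule subalg)
    have vm: "v \<in> borel_measurable M" by (rule measurable_from_subalg[OF HM vH])
    have nested: "AE x in M. real_cond_exp M (G K) m x = real_cond_exp M (G K) u x"
      unfolding m_def by (rule G.real_cond_exp_nested_subalg[OF F(1) GF u])
    have v_int: "integrable M v"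
      using G.real_cond_exp_int(1)[OF u] vm v_eq by (rule integrable_cong_AE_imp)
    have "AE x in M. v x - w' x = real_cond_exp M (G K) (\<lambda>x. m x - w' x) x"
      using G.real_cond_exp_diff[OF m w'(2)] G.real_cond_exp_F_meas[OF w'(2,1)] nested v_eq
      by eventually_elim simp
    then have "(\<integral>x. \<bar>v x - w' x\<bar> \<partial>M) = (\<integral>x. \<bar>real_cond_exp M (G K) (\<lambda>x. m x - w' x) x\<bar> \<partial>M)"
      using vm borel_measurable_integrable[OF w'(2)]
      by (intro integral_cong_AE) auto
    also have "\<dots> \<le> (\<integral>x. \<bar>m x - w' x\<bar> \<partial>M)"
      using m w'(2) by (intro G.integral_abs_real_cond_exp_le) auto
    finally have 1: "(\<integral>x. \<bar>v x - w' x\<bar> \<partial>M) < \<epsilon> / 4" using w'(3) by simp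
    have "(\<integral>x. \<bar>m x - v x\<bar> \<partial>M) \<le> (\<integral>x. \<bar>m x - w' x\<bar> + \<bar>v x - w' x\<bar> \<partial>M)"
      using m w'(2) v_int by (intro integral_mono) auto
    also have "\<dots> = (\<integral>x. \<bar>m x - w' x\<bar> \<partial>M) + (\<integral>x. \<bar>v x - w' x\<bar> \<partial>M)"
      using m w'(2) v_int by simp
    finally have 2: "(\<integral>x. \<bar>m x - v x\<bar> \<partial>M) < \<epsilon> / 2" using 1 w'(3) by simp
    have "AE x in M. real_cond_exp M H m x - v x = real_cond_exp M H (\<lambda>x. m x - v x) x"
      using H.real_cond_exp_diff[OF m v_int] H.real_cond_exp_F_meas[OF v_int vH]
      by eventually_elim simp
    then have "(\<integral>x. \<bar>real_cond_exp M H m x - v x\<bar> \<partial>M) = (\<integral>x. \<bar>real_cond_exp M H (\<lambda>x. m x - v x) x\<bar> \<partial>M)"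
      using vm by (intro integral_cong_AE) auto
    also have "\<dots> \<le> (\<integral>x. \<bar>m x - v x\<bar> \<partial>M)"
      using m v_int by (intro H.integral_abs_real_cond_exp_le) auto
    finally have 3: "(\<integral>x. \<bar>real_cond_exp M H m x - v x\<bar> \<partial>M) < \<epsilon> / 2" using 2 by simp
    have "(\<integral>x. \<bar>m x - real_cond_exp M H m x\<bar> \<partial>M) \<le>
        (\<integral>x. \<bar>m x - v x\<bar> + \<bar>real_cond_exp M H m x - v x\<bar> \<partial>M)"
      using m int_H v_int by (intro integral_mono) auto
    also have "\<dots> = (\<integral>x. \<bar>m x - v x\<bar> \<partial>M) + (\<integral>x. \<bar>real_cond_exp M H m x - v x\<bar> \<partial>M)"
      using m int_H v_int by simp
    finally show ?thesis using 2 3 by simp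
  qed
  then have "(\<integral>x. \<bar>m x - real_cond_exp M H m x\<bar> \<partial>M) \<le> 0" by (rule field_le_epsilon)
  then have "(\<integral>x. \<bar>m x - real_cond_exp M H m x\<bar> \<partial>M) = 0" by (intro antisym) auto
  then have "AE x in M. \<bar>m x - real_cond_exp M H m x\<bar> = 0"
    using m int_H by (subst (asm) integral_nonneg_eq_0_iff_AE) auto
  moreover have "AE x in M. real_cond_exp M H m x = real_cond_exp M H u x"
    unfolding m_def by (rule H.real_cond_exp_nested_subalg[OF F(1) H u])
  ultimately show ?thesis unfolding m_def by eventually_elim simp
qed

end

context prob_space
begin

lemma borel_measurable_given_prob [measurable]:
  "given_prob M Z N A \<in> borel_measurable M"
  unfolding given_prob_def by simp

lemma given_prob_bounds:
  assumes Z: "Z \<in> M \<rightarrow>\<^sub>M N" and A: "A \<in> sets M"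
  shows "AE \<omega> in M. 0 \<le> given_prob M Z N A \<omega> \<and> given_prob M Z N A \<omega> \<le> 1"
proof -
  interpret finite_measure_subalgebra M "vimage_algebra (space M) Z N"
    by unfold_locales (rule subalgebra_vimage[OF Z])
  have int: "integrable M (indicator A :: _ \<Rightarrow> real)"
    using A by (simp add: integrable_real_indicator emeasure_eq_measure)
  have "AE \<omega> in M. real_cond_exp M (vimage_algebra (space M) Z N) (indicator A) \<omega> \<ge> 0"
    by (rule real_cond_exp_ge_c[OF int]) (auto simp: indicator_def)
  moreover have "AE \<omega> in M. real_cond_exp M (vimage_algebra (space M) Z N) (indicator A) \<omega> \<le> 1"
    by (rule real_cond_exp_le_c[OF int]) (auto simp: indicator_def)
  ultimately show ?thesis unfolding given_prob_def by eventually_elim simp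
qed

text \<open>
  Both sides express conditional independence of \<open>U\<close> and \<open>V\<close> given \<open>s U\<close>.  With \<open>q\<close>, \<open>p\<close> the
  conditional probabilities of \<open>V \<in> B\<close>, \<open>U \<in> C\<close> given \<open>s U\<close>, each of the two masses compared on a
  rectangle equals the integral of \<open>q \<cdot> p\<close> over \<open>s U \<in> A\<close>.
\<close>

lemma cond_indep_swap:
  assumes U[measurable]: "U \<in> M \<rightarrow>\<^sub>M N" and V[measurable]: "V \<in> M \<rightarrow>\<^sub>M L"
    and s[measurable]: "s \<in> N \<rightarrow>\<^sub>M S"
    and indep: "\<And>B. B \<in> sets L \<Longrightarrow> AE \<omega> in M.
      given_prob M U N (V -` B \<inter> space M) \<omega> = given_prob M (\<lambda>\<omega>. s (U \<omega>)) S (V -` B \<inter> space M) \<omega>"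
    and C[measurable]: "C \<in> sets N"
  shows "AE \<omega> in M. given_prob M (\<lambda>\<omega>. (s (U \<omega>), V \<omega>)) (S \<Otimes>\<^sub>M L) (U -` C \<inter> space M) \<omega>
     = given_prob M (\<lambda>\<omega>. s (U \<omega>)) S (U -` C \<inter> space M) \<omega>"
proof -
  let ?F = "vimage_algebra (space M) (\<lambda>\<omega>. s (U \<omega>)) S"
  let ?Z = "\<lambda>\<omega>. (s (U \<omega>), V \<omega>)"
  have sU: "(\<lambda>\<omega>. s (U \<omega>)) \<in> M \<rightarrow>\<^sub>M S" by measurable
  have Z: "?Z \<in> M \<rightarrow>\<^sub>M S \<Otimes>\<^sub>M L" by measurable
  interpret F: finite_measure_subalgebra M ?F
    by unfold_locales (rule subalgebra_vimage[OF sU])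
  define UC where "UC = U -` C \<inter> space M"
  have UC[measurable]: "UC \<in> sets M" unfolding UC_def by measurable
  define p where "p = given_prob M (\<lambda>\<omega>. s (U \<omega>)) S UC"
  have p[measurable]: "p \<in> borel_measurable M" unfolding p_def by measurable
  have pF: "p \<in> borel_measurable ?F" unfolding p_def given_prob_def by simp
  have p_bd: "AE \<omega> in M. 0 \<le> p \<omega> \<and> p \<omega> \<le> 1" unfolding p_def by (rule given_prob_bounds[OF sU UC])
  have bd_int: "integrable M f" if [measurable]: "f \<in> borel_measurable M" and "AE \<omega> in M. 0 \<le> f \<omega> \<and> f \<omega> \<le> 1"
    for f :: "'a \<Rightarrow> real"
    by (rule integrable_const_bound[of _ 1]) (use that(2) in auto)
  have rect: "measure M (UC \<inter> (?Z -` (A \<times> B) \<inter> space M)) = (\<integral>\<omega>. indicator (A \<times> B) (?Z \<omega>) * p \<omega> \<partial>M)"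
    if A[measurable]: "A \<in> sets S" and B[measurable]: "B \<in> sets L" for A B
  proof -
    define VB where "VB = V -` B \<inter> space M"
    have VB[measurable]: "VB \<in> sets M" unfolding VB_def by measurable
    define q where "q = given_prob M (\<lambda>\<omega>. s (U \<omega>)) S VB"
    have q[measurable]: "q \<in> borel_measurable M" unfolding q_def by measurable
    have qF: "q \<in> borel_measurable ?F" unfolding q_def given_prob_def by simp
    have q_bd: "AE \<omega> in M. 0 \<le> q \<omega> \<and> q \<omega> \<le> 1" unfolding q_def by (rule given_prob_bounds[OF sU VB])
    have AF: "(\<lambda>\<omega>. indicator A (s (U \<omega>)) :: real) \<in> borel_measurable ?F"
      by (rule measurable_comp_vimage_algebra[OF sU]) measurable
    have "UC \<inter> (?Z -` (A \<times> B) \<inter> space M) = VB \<inter> (U -` (C \<inter> (s -` A \<inter> space N)) \<inter> space M)"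
      using measurable_space[OF U] by (auto simp: UC_def VB_def)
    then have "measure M (UC \<inter> (?Z -` (A \<times> B) \<inter> space M)) =
        (\<integral>\<omega>. indicator (C \<inter> (s -` A \<inter> space N)) (U \<omega>) * given_prob M U N VB \<omega> \<partial>M)"
      using given_prob_integral[OF U VB, of "C \<inter> (s -` A \<inter> space N)"] by simp
    also have "\<dots> = (\<integral>\<omega>. (indicator A (s (U \<omega>)) * q \<omega>) * indicator UC \<omega> \<partial>M)"
    proof (intro integral_cong_AE)
      show "AE \<omega> in M. indicator (C \<inter> (s -` A \<inter> space N)) (U \<omega>) * given_prob M U N VB \<omega> =
        (indicator A (s (U \<omega>)) * q \<omega>) * indicator UC \<omega>"
        using indep[OF B] AE_space
        unfolding VB_def[symmetric] q_def[symmetric]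
        by eventually_elim (use measurable_space[OF U] in \<open>auto simp: indicator_def UC_def\<close>)
    qed measurable
    also have "\<dots> = (\<integral>\<omega>. (indicator A (s (U \<omega>)) * q \<omega>) * p \<omega> \<partial>M)"
      unfolding p_def given_prob_def
    proof (rule F.real_cond_exp_intg(2)[symmetric])
      show "integrable M (\<lambda>\<omega>. (indicator A (s (U \<omega>)) * q \<omega>) * indicator UC \<omega>)"
        by (rule bd_int) (use q_bd in \<open>auto simp: indicator_def\<close>)
    qed (use AF qF in measurable)
    also have "\<dots> = (\<integral>\<omega>. (indicator A (s (U \<omega>)) * p \<omega>) * q \<omega> \<partial>M)"
      by (simp add: mult_ac)
    also have "\<dots> = (\<integral>\<omega>. (indicator A (s (U \<omega>)) * p \<omega>) * indicator VB \<omega> \<partial>M)"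
      unfolding q_def given_prob_def
    proof (rule F.real_cond_exp_intg(2))
      show "integrable M (\<lambda>\<omega>. (indicator A (s (U \<omega>)) * p \<omega>) * indicator VB \<omega>)"
        by (rule bd_int) (use p_bd in \<open>auto simp: indicator_def\<close>)
    qed (use AF pF in measurable)
    also have "\<dots> = (\<integral>\<omega>. indicator (A \<times> B) (?Z \<omega>) * p \<omega> \<partial>M)"
      by (intro Bochner_Integration.integral_cong) (auto simp: indicator_def VB_def)
    finally show ?thesis .
  qed
  let ?\<mu> = "distr (density M (indicator UC)) (S \<Otimes>\<^sub>M L) ?Z"
  let ?\<nu> = "distr (density M (\<lambda>\<omega>. ennreal (p \<omega>))) (S \<Otimes>\<^sub>M L) ?Z"
  have \<mu>: "emeasure ?\<mu> D = ennreal (measure M (UC \<inter> (?Z -` D \<inter> space M)))"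
    if D[measurable]: "D \<in> sets (S \<Otimes>\<^sub>M L)" for D
  proof -
    have "emeasure ?\<mu> D = (\<integral>\<^sup>+\<omega>. indicator UC \<omega> * indicator (?Z -` D \<inter> space M) \<omega> \<partial>M)"
      by (simp add: emeasure_distr emeasure_density)
    also have "\<dots> = (\<integral>\<^sup>+\<omega>. indicator (UC \<inter> (?Z -` D \<inter> space M)) \<omega> \<partial>M)"
      by (intro nn_integral_cong) (auto simp: indicator_def)
    also have "\<dots> = emeasure M (UC \<inter> (?Z -` D \<inter> space M))"
      by (intro nn_integral_indicator) measurable
    finally show ?thesis by (simp add: emeasure_eq_measure)
  qed
  have \<nu>: "emeasure ?\<nu> D = ennreal (\<integral>\<omega>. indicator D (?Z \<omega>) * p \<omega> \<partial>M)"
    if D[measurable]: "D \<in> sets (S \<Otimes>\<^sub>M L)" for D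
  proof -
    have "emeasure ?\<nu> D = (\<integral>\<^sup>+\<omega>. ennreal (p \<omega>) * indicator (?Z -` D \<inter> space M) \<omega> \<partial>M)"
      by (simp add: emeasure_distr emeasure_density)
    also have "\<dots> = (\<integral>\<^sup>+\<omega>. ennreal (indicator D (?Z \<omega>) * p \<omega>) \<partial>M)"
      by (intro nn_integral_cong) (auto simp: indicator_def)
    also have "\<dots> = ennreal (\<integral>\<omega>. indicator D (?Z \<omega>) * p \<omega> \<partial>M)"
    proof (rule nn_integral_eq_integral)
      show "integrable M (\<lambda>\<omega>. indicator D (?Z \<omega>) * p \<omega>)"
        by (rule bd_int) (use p_bd in \<open>auto simp: indicator_def\<close>)
    qed (use p_bd in \<open>auto simp: indicator_def\<close>)
    finally show ?thesis .
  qed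
  have "?\<mu> = ?\<nu>"
  proof (rule measure_eqI_rectangles[where \<A>="sets S" and \<B>="sets L"])
    show "finite_measure ?\<mu>"
      by (rule finite_measureI) (use \<mu>[OF sets.top] in simp)
    show "emeasure ?\<mu> (A \<times> B) = emeasure ?\<nu> (A \<times> B)" if "A \<in> sets S" "B \<in> sets L" for A B
      using \<mu>[of "A \<times> B"] \<nu>[of "A \<times> B"] rect[OF that] that by simp
  qed (rule sets_distr sets.Int_stable sets.space_closed sets.top sets.sigma_sets_eq[symmetric])+
  then have eq: "measure M (UC \<inter> (?Z -` D \<inter> space M)) = (\<integral>\<omega>. indicator D (?Z \<omega>) * p \<omega> \<partial>M)"
    if D: "D \<in> sets (S \<Otimes>\<^sub>M L)" for D
  proof -
    have "0 \<le> (\<integral>\<omega>. indicator D (?Z \<omega>) * p \<omega> \<partial>M)"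
      by (rule integral_nonneg_AE) (use p_bd in \<open>auto simp: indicator_def\<close>)
    then show ?thesis
      using \<mu>[OF D] \<nu>[OF D] \<open>?\<mu> = ?\<nu>\<close> by (simp add: ennreal_inj)
  qed
  have "AE \<omega> in M. given_prob M ?Z (S \<Otimes>\<^sub>M L) UC \<omega> = p \<omega>"
  proof (rule given_prob_eqI[OF Z UC _ bd_int[OF p p_bd] eq])
    have "sets ?F \<subseteq> sets (vimage_algebra (space M) ?Z (S \<Otimes>\<^sub>M L))"
    proof
      fix D assume "D \<in> sets ?F"
      then obtain A where A: "A \<in> sets S" "D = (\<lambda>\<omega>. s (U \<omega>)) -` A \<inter> space M" by (rule sets_vimageE[OF sU])
      have "D = ?Z -` (A \<times> space L) \<inter> space M" using measurable_space[OF V] by (auto simp: A(2))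
      moreover have "?Z -` (A \<times> space L) \<inter> space M \<in> sets (vimage_algebra (space M) ?Z (S \<Otimes>\<^sub>M L))"
        using A(1) by (intro in_vimage_algebra) auto
      ultimately show "D \<in> sets (vimage_algebra (space M) ?Z (S \<Otimes>\<^sub>M L))" by simp
    qed
    then show "p \<in> borel_measurable (vimage_algebra (space M) ?Z (S \<Otimes>\<^sub>M L))"
      using pF by (auto simp: measurable_def)
  qed
  then show ?thesis unfolding p_def UC_def .
qed

end

section \<open>A single exponential family with its conjugate prior\<close>

locale conjugate_exp_family =
  fixes E :: "('x, 'u::real_vector) exp_data"
  assumes family: "exp_family_model E" and conj_prior: "canonical_conjugate_prior E"
begin

abbreviation "MX \<equiv> borel_of (obs_top E)"
abbreviation "MU \<equiv> borel_of (stat_top E)"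
abbreviation "MT \<equiv> borel_of (par_top E)"
abbreviation "MY \<equiv> borel_of (hyper_top (stat_top E))"

definition lik :: "'x \<Rightarrow> 'u \<Rightarrow> ennreal" where
  "lik x \<theta> = ennreal (base E x / model_normalizer E \<theta> * exp (ip E (stat E x) \<theta>))"

definition prior_dens :: "'u \<Rightarrow> real \<times> 'u \<Rightarrow> ennreal" where
  "prior_dens \<theta> = (\<lambda>(l, \<gamma>). ennreal (exp (ip E \<theta> \<gamma> - l * ln (model_normalizer E \<theta>))
      / enn2real (prior_normalizer E l \<gamma>)))"

definition update :: "nat \<Rightarrow> (nat \<Rightarrow> 'x) \<Rightarrow> real \<times> 'u \<Rightarrow> real \<times> 'u" where
  "update n x = (\<lambda>(l, \<gamma>). (l + real n, \<gamma> + (\<Sum>k<n. stat E (x k))))"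

lemma topspace_par_top: "topspace (par_top E) = par_set E"
  using family by (auto simp: par_top_def exp_family_model_def)

lemma par_subset: "par_set E \<subseteq> topspace (stat_top E)"
  using family by (simp add: exp_family_model_def)

lemma sets_obs_carrier [measurable_cong]: "sets (obs_carrier E) = sets MX"
  using family by (simp add: exp_family_model_def)

lemma sets_par_carrier [measurable_cong]: "sets (par_carrier E) = sets MT"
  using conj_prior by (simp add: canonical_conjugate_prior_def)

lemma space_obs_carrier: "space (obs_carrier E) = topspace (obs_top E)"
  using sets_eq_imp_space_eq[OF sets_obs_carrier] by simp

lemma space_par_carrier: "space (par_carrier E) = par_set E"
  using sets_eq_imp_space_eq[OF sets_par_carrier] by (simp add: topspace_par_top)

sublocale obs: sigma_finite_measure "obs_carrier E"
  using family by (simp add: exp_family_model_def)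

sublocale par: sigma_finite_measure "par_carrier E"
  using conj_prior by (simp add: canonical_conjugate_prior_def)

lemma stat_measurable [measurable]: "stat E \<in> MX \<rightarrow>\<^sub>M MU"
  using family by (simp add: exp_family_model_def)

lemma base_measurable [measurable]: "base E \<in> borel_measurable MX"
  using family by (simp add: exp_family_model_def)

lemma base_nonneg: "x \<in> topspace (obs_top E) \<Longrightarrow> 0 \<le> base E x"
  using family by (simp add: exp_family_model_def)

lemma model_measurable [measurable]: "model E \<in> MT \<rightarrow>\<^sub>M prob_algebra MX"
  using family by (simp add: exp_family_model_def)

lemma subspace_stat_top: "subspace (topspace (stat_top E))"
  using family by (simp add: exp_family_model_def tvs_def)

lemma stat_in: "x \<in> topspace (obs_top E) \<Longrightarrow> stat E x \<in> topspace (stat_top E)"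
  using measurable_space[OF stat_measurable] by simp

lemma par_inclusion_measurable [measurable (raw)]:
  assumes "f \<in> M \<rightarrow>\<^sub>M MT" shows "f \<in> M \<rightarrow>\<^sub>M MU"
proof -
  have "(\<lambda>x. x) \<in> MT \<rightarrow>\<^sub>M MU"
    unfolding par_top_def by (intro measurable_continuous_map) (simp add: continuous_map_from_subtopology)
  from measurable_compose[OF assms this] show ?thesis .
qed

lemma ip_measurable [measurable (raw)]:
  assumes "f \<in> M \<rightarrow>\<^sub>M MU" "g \<in> M \<rightarrow>\<^sub>M MU"
  shows "(\<lambda>w. ip E (f w) (g w)) \<in> borel_measurable M"
proof -
  have "(\<lambda>(u, v). ip E u v) \<in> borel_measurable (MU \<Otimes>\<^sub>M MU)"
    using family by (simp add: exp_family_model_def inner_product_on_def)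
  from measurable_compose[OF measurable_Pair[OF assms] this] show ?thesis by simp
qed

lemma ip_sym:
  "u \<in> topspace (stat_top E) \<Longrightarrow> v \<in> topspace (stat_top E) \<Longrightarrow> ip E u v = ip E v u"
  using family by (simp add: exp_family_model_def inner_product_on_def)

lemma ip_add_right:
  assumes "u \<in> topspace (stat_top E)" "v \<in> topspace (stat_top E)" "w \<in> topspace (stat_top E)"
  shows "ip E u (v + w) = ip E u v + ip E u w"
proof -
  have "v + w \<in> topspace (stat_top E)" using assms subspace_stat_top by (simp add: subspace_add)
  then have "ip E u (v + w) = ip E (v + w) u" using assms by (intro ip_sym)
  also have "\<dots> = ip E v u + ip E w u"
    using family assms by (simp add: exp_family_model_def inner_product_on_def)
  finally show ?thesis using assms by (simp add: ip_sym)
qed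

lemma ip_sum_right:
  assumes "u \<in> topspace (stat_top E)" "\<gamma> \<in> topspace (stat_top E)"
    and "\<And>k. k < (n::nat) \<Longrightarrow> s k \<in> topspace (stat_top E)"
  shows "ip E u (\<gamma> + (\<Sum>k<n. s k)) = ip E u \<gamma> + (\<Sum>k<n. ip E u (s k))"
  using assms(3)
proof (induction n)
  case (Suc n)
  have "(\<Sum>k<n. s k) \<in> topspace (stat_top E)"
    using Suc.prems subspace_stat_top by (intro subspace_sum) auto
  then have "\<gamma> + (\<Sum>k<n. s k) \<in> topspace (stat_top E)"
    using assms subspace_stat_top by (simp add: subspace_add)
  then show ?case
    using Suc assms ip_add_right[OF assms(1), of "\<gamma> + (\<Sum>k<n. s k)" "s n"] by (simp add: add.assoc)
qed simp

lemma model_normalizer_measurable [measurable]: "model_normalizer E \<in> borel_measurable MT"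
  unfolding model_normalizer_def by measurable

lemma lik_measurable [measurable (raw)]:
  assumes [measurable]: "f \<in> M \<rightarrow>\<^sub>M MX" "g \<in> M \<rightarrow>\<^sub>M MT"
  shows "(\<lambda>w. lik (f w) (g w)) \<in> borel_measurable M"
  unfolding lik_def by measurable

lemma prior_normalizer_measurable [measurable]:
  "(\<lambda>y. prior_normalizer E (fst y) (snd y)) \<in> borel_measurable MY"
proof -
  note [measurable] = measurable_fst_hyper_top measurable_snd_hyper_top
  show ?thesis unfolding prior_normalizer_def by measurable
qed

lemma prior_dens_measurable [measurable (raw)]:
  assumes [measurable]: "f \<in> M \<rightarrow>\<^sub>M MT" "g \<in> M \<rightarrow>\<^sub>M MY"
  shows "(\<lambda>w. prior_dens (f w) (g w)) \<in> borel_measurable M"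
proof -
  note [measurable] = measurable_compose[OF assms(2) measurable_fst_hyper_top]
    measurable_compose[OF assms(2) measurable_snd_hyper_top]
    measurable_compose[OF assms(2) prior_normalizer_measurable]
  show ?thesis unfolding prior_dens_def case_prod_beta by measurable
qed

lemma model_density:
  assumes "\<theta> \<in> par_set E"
  shows "model E \<theta> = density (obs_carrier E) (\<lambda>x. lik x \<theta>)"
  using family assms by (simp add: exp_family_model_def lik_def)

lemma measurable_par: "\<theta> \<in> par_set E \<Longrightarrow> (\<lambda>x. \<theta>) \<in> M \<rightarrow>\<^sub>M MT"
  by (simp add: topspace_par_top)

lemma prob_space_model: "\<theta> \<in> par_set E \<Longrightarrow> prob_space (model E \<theta>)"
  using measurable_space[OF model_measurable, of \<theta>] by (simp add: topspace_par_top space_prob_algebra)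

lemma emeasure_model:
  assumes \<theta>: "\<theta> \<in> par_set E" and [measurable]: "C \<in> sets MX"
  shows "emeasure (model E \<theta>) C = (\<integral>\<^sup>+x. lik x \<theta> * indicator C x \<partial>obs_carrier E)"
proof -
  note [measurable] = measurable_par[OF \<theta>]
  show ?thesis unfolding model_density[OF \<theta>] by (subst emeasure_density) measurable
qed

text \<open>
  The normalizer is a real number that is \<open>0\<close> if the defining integral is \<open>0\<close> or infinite; in either
  case the density would vanish, and the model would not be a probability measure.
\<close>

lemma model_normalizer_pos:
  assumes \<theta>: "\<theta> \<in> par_set E"
  shows "0 < model_normalizer E \<theta>"
proof (rule ccontr)
  assume "\<not> 0 < model_normalizer E \<theta>"
  moreover have "0 \<le> model_normalizer E \<theta>" by (simp add: model_normalizer_def)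
  ultimately have "model_normalizer E \<theta> = 0" by simp
  then have "emeasure (model E \<theta>) (space MX) = 0"
    using emeasure_model[OF \<theta> sets.top] by (simp add: lik_def)
  moreover have "space (model E \<theta>) = space MX"
    unfolding model_density[OF \<theta>] by (simp add: space_obs_carrier)
  ultimately show False
    using prob_space.emeasure_space_1[OF prob_space_model[OF \<theta>]] by simp
qed

lemma lik_prod:
  assumes "\<theta> \<in> par_set E" and "\<And>k. k < n \<Longrightarrow> x k \<in> topspace (obs_top E)"
  shows "(\<Prod>k<n. lik (x k) \<theta>) =
    ennreal ((\<Prod>k<n. base E (x k)) *
      exp ((\<Sum>k<n. ip E \<theta> (stat E (x k))) - real n * ln (model_normalizer E \<theta>)))"
  using assms(2)
proof (induction n)
  case (Suc n)
  have Z: "0 < model_normalizer E \<theta>" by (rule model_normalizer_pos[OF assms(1)])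
  have b: "0 \<le> base E (x k)" if "k < Suc n" for k using base_nonneg Suc.prems that by blast
  have "lik (x n) \<theta> = ennreal (base E (x n) * exp (ip E \<theta> (stat E (x n)) - ln (model_normalizer E \<theta>)))"
    using Z Suc.prems[of n] par_subset assms(1) stat_in
    by (subst ip_sym) (auto simp: lik_def exp_diff)
  then show ?case
    using Suc b by (simp add: ennreal_mult'[symmetric] prod_nonneg exp_add[symmetric] algebra_simps
        flip: ennreal_mult)
qed simp

lemma canonical_hyperD:
  assumes "(l, \<gamma>) \<in> canonical_hyper E"
  shows "0 \<le> l" "\<gamma> \<in> topspace (stat_top E)"
    "0 < prior_normalizer E l \<gamma>" "prior_normalizer E l \<gamma> < \<infinity>"
proof -
  from assms obtain l0 \<gamma>0 n x where *: "l = l0 + real n" "\<gamma> = \<gamma>0 + (\<Sum>k<n. stat E (x k))" "0 \<le> l0"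
      "\<gamma>0 \<in> convex hull (stat E ` topspace (obs_top E))" "\<forall>k<n. x k \<in> topspace (obs_top E)"
    by (auto simp: canonical_hyper_def)
  have "convex hull (stat E ` topspace (obs_top E)) \<subseteq> topspace (stat_top E)"
    using stat_in subspace_imp_convex[OF subspace_stat_top] by (intro hull_minimal) auto
  then show "\<gamma> \<in> topspace (stat_top E)"
    unfolding *(2) using *(4,5) stat_in subspace_stat_top by (intro subspace_add subspace_sum) auto
  show "0 \<le> l" using * by simp
  show "0 < prior_normalizer E l \<gamma>" "prior_normalizer E l \<gamma> < \<infinity>"
    using assms by (auto simp: canonical_hyper_def)
qed

lemma emeasure_prior:
  assumes y: "y \<in> canonical_hyper E" and [measurable]: "B \<in> sets MT"
  shows "emeasure (prior E y) B = (\<integral>\<^sup>+\<theta>. prior_dens \<theta> y * indicator B \<theta> \<partial>par_carrier E)"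
proof -
  obtain l \<gamma> where yl: "y = (l, \<gamma>)" by (cases y)
  have "(\<lambda>x. y) \<in> par_carrier E \<rightarrow>\<^sub>M MY"
    using canonical_hyperD[of l \<gamma>] y by (simp add: yl hyper_top_def)
  note [measurable] = this
  have "prior E y = density (par_carrier E) (\<lambda>\<theta>. prior_dens \<theta> y)"
    using conj_prior y unfolding canonical_conjugate_prior_def prior_dens_def by (auto simp: yl)
  then show ?thesis by (simp add: emeasure_density)
qed

text \<open>
  The hyperparameters that can be reached from the convex hull are closed under further updates: the
  two samples are concatenated.
\<close>

lemma update_form:
  assumes "(l, \<gamma>) \<in> canonical_hyper E" "\<And>k. k < n \<Longrightarrow> x k \<in> topspace (obs_top E)"
    and "0 < prior_normalizer E (l + real n) (\<gamma> + (\<Sum>k<n. stat E (x k)))"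
    and "prior_normalizer E (l + real n) (\<gamma> + (\<Sum>k<n. stat E (x k))) < \<infinity>"
  shows "update n x (l, \<gamma>) \<in> canonical_hyper E"
proof -
  from assms(1) obtain l0 \<gamma>0 m x0 where *: "l = l0 + real m" "\<gamma> = \<gamma>0 + (\<Sum>k<m. stat E (x0 k))" "0 \<le> l0"
      "\<gamma>0 \<in> convex hull (stat E ` topspace (obs_top E))" "\<forall>k<m. x0 k \<in> topspace (obs_top E)"
    by (auto simp: canonical_hyper_def)
  define x' where "x' k = (if k < m then x0 k else x (k - m))" for k
  have "(\<Sum>k<m + j. stat E (x' k)) = (\<Sum>k<m. stat E (x0 k)) + (\<Sum>k<j. stat E (x k))" for j
    by (induction j) (simp_all add: x'_def add.assoc)
  then have "update n x (l, \<gamma>) = (l0 + real (m + n), \<gamma>0 + (\<Sum>k<m + n. stat E (x' k)))"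
    by (simp add: update_def * add.assoc)
  moreover have "\<forall>k<m + n. x' k \<in> topspace (obs_top E)"
    using *(5) assms(2) by (auto simp: x'_def)
  moreover have "update n x (l, \<gamma>) \<in> {(l, \<gamma>). 0 < prior_normalizer E l \<gamma> \<and> prior_normalizer E l \<gamma> < \<infinity>}"
    using assms(3,4) by (simp add: update_def)
  ultimately show ?thesis
    unfolding canonical_hyper_def using *(3,4) by blast
qed

text \<open>
  The marginal density of the data \<open>x\<close> at the hyperparameter \<open>y\<close>.
\<close>

definition evidence :: "nat \<Rightarrow> (nat \<Rightarrow> 'x) \<Rightarrow> real \<times> 'u \<Rightarrow> ennreal" where
  "evidence n x y = (\<integral>\<^sup>+\<theta>. prior_dens \<theta> y * (\<Prod>k<n. lik (x k) \<theta>) \<partial>par_carrier E)"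

text \<open>
  Prior density times likelihood is \<open>?c\<close> times the unnormalized prior density \<open>?e\<close> at the updated
  hyperparameter, so the evidence is \<open>?c\<close> times the normalizer there.  Positive and finite evidence
  thus makes the update canonical, and \<open>?c\<close> cancels in the quotient.
\<close>

lemma bayes_canonical:
  assumes y: "y \<in> canonical_hyper E" and x: "\<And>k. k < n \<Longrightarrow> x k \<in> topspace (obs_top E)"
    and ev: "0 < evidence n x y" "evidence n x y < \<infinity>"
  shows "update n x y \<in> canonical_hyper E"
    and "\<And>B. B \<in> sets MT \<Longrightarrow>
      (\<integral>\<^sup>+\<theta>. prior_dens \<theta> y * (\<Prod>k<n. lik (x k) \<theta>) * indicator B \<theta> \<partial>par_carrier E) / evidence n x y
        = emeasure (prior E (update n x y)) B"
proof -
  obtain l \<gamma> where yl: "y = (l, \<gamma>)" by (cases y)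
  note y' = canonical_hyperD[OF y[unfolded yl]]
  let ?l = "l + real n" and ?\<gamma> = "\<gamma> + (\<Sum>k<n. stat E (x k))"
  let ?c = "(\<Prod>k<n. base E (x k)) / enn2real (prior_normalizer E l \<gamma>)"
  let ?e = "\<lambda>\<theta>. exp (ip E \<theta> ?\<gamma> - ?l * ln (model_normalizer E \<theta>))"
  have c: "0 \<le> ?c" using x base_nonneg by (auto intro!: divide_nonneg_nonneg prod_nonneg)
  have \<gamma>': "?\<gamma> \<in> topspace (stat_top E)"
    using y'(2) x stat_in subspace_stat_top by (intro subspace_add subspace_sum) auto
  have "(\<lambda>\<theta>. ip E \<theta> ?\<gamma>) \<in> borel_measurable MT"
    using \<gamma>' by (intro ip_measurable par_inclusion_measurable measurable_ident_sets measurable_const) simp_all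
  then have [measurable]: "(\<lambda>\<theta>. ennreal (?e \<theta>)) \<in> borel_measurable (par_carrier E)"
    by measurable
  have prod: "prior_dens \<theta> y * (\<Prod>k<n. lik (x k) \<theta>) = ennreal ?c * ennreal (?e \<theta>)"
    if \<theta>: "\<theta> \<in> par_set E" for \<theta>
  proof -
    have "\<theta> \<in> topspace (stat_top E)" using \<theta> par_subset by auto
    then have "ip E \<theta> ?\<gamma> = ip E \<theta> \<gamma> + (\<Sum>k<n. ip E \<theta> (stat E (x k)))"
      using y'(2) x stat_in by (intro ip_sum_right) auto
    then have "?e \<theta> = exp (ip E \<theta> \<gamma> - l * ln (model_normalizer E \<theta>)) *
        exp ((\<Sum>k<n. ip E \<theta> (stat E (x k))) - real n * ln (model_normalizer E \<theta>))"
      by (simp add: exp_add[symmetric] algebra_simps)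
    moreover have "(\<Prod>k<n. lik (x k) \<theta>) = ennreal ((\<Prod>k<n. base E (x k)) *
        exp ((\<Sum>k<n. ip E \<theta> (stat E (x k))) - real n * ln (model_normalizer E \<theta>)))"
      by (rule lik_prod[OF \<theta>]) (rule x)
    moreover have "0 \<le> (\<Prod>k<n. base E (x k))" using x base_nonneg by (intro prod_nonneg) auto
    ultimately show ?thesis
      using c by (simp add: prior_dens_def yl ac_simps flip: ennreal_mult)
  qed
  have int: "(\<integral>\<^sup>+\<theta>. prior_dens \<theta> y * (\<Prod>k<n. lik (x k) \<theta>) * indicator B \<theta> \<partial>par_carrier E) =
      ennreal ?c * (\<integral>\<^sup>+\<theta>. ennreal (?e \<theta>) * indicator B \<theta> \<partial>par_carrier E)" if [measurable]: "B \<in> sets MT" for B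
  proof -
    have "(\<integral>\<^sup>+\<theta>. prior_dens \<theta> y * (\<Prod>k<n. lik (x k) \<theta>) * indicator B \<theta> \<partial>par_carrier E) =
        (\<integral>\<^sup>+\<theta>. ennreal ?c * (ennreal (?e \<theta>) * indicator B \<theta>) \<partial>par_carrier E)"
      by (intro nn_integral_cong) (simp add: prod space_par_carrier mult.assoc)
    also have "\<dots> = ennreal ?c * (\<integral>\<^sup>+\<theta>. ennreal (?e \<theta>) * indicator B \<theta> \<partial>par_carrier E)"
      by (rule nn_integral_cmult) measurable
    finally show ?thesis .
  qed
  have "evidence n x y = ennreal ?c * prior_normalizer E ?l ?\<gamma>"
  proof -
    have "evidence n x y = (\<integral>\<^sup>+\<theta>. prior_dens \<theta> y * (\<Prod>k<n. lik (x k) \<theta>) * indicator (space MT) \<theta> \<partial>par_carrier E)"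
      unfolding evidence_def by (intro nn_integral_cong) (simp add: space_par_carrier topspace_par_top)
    also have "\<dots> = ennreal ?c * (\<integral>\<^sup>+\<theta>. ennreal (?e \<theta>) * indicator (space MT) \<theta> \<partial>par_carrier E)"
      by (rule int[OF sets.top])
    also have "(\<integral>\<^sup>+\<theta>. ennreal (?e \<theta>) * indicator (space MT) \<theta> \<partial>par_carrier E) = prior_normalizer E ?l ?\<gamma>"
      unfolding prior_normalizer_def by (intro nn_integral_cong) (simp add: space_par_carrier topspace_par_top)
    finally show ?thesis .
  qed
  note evid = this
  have c0: "0 < ?c"
  proof (rule ccontr)
    assume "\<not> 0 < ?c"
    then have "?c = 0" using c by linarith
    then have "evidence n x y = 0" unfolding evid by (simp only: ennreal_0 mult_zero_left)
    then show False using ev(1) by simp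
  qed
  have c0': "ennreal ?c \<noteq> 0" using c0 by (simp only: ennreal_eq_0_iff not_le)
  have K: "0 < prior_normalizer E ?l ?\<gamma>" "prior_normalizer E ?l ?\<gamma> < \<infinity>"
  proof -
    show pos: "0 < prior_normalizer E ?l ?\<gamma>" using ev(1) unfolding evid by (auto simp: zero_less_iff_neq_zero)
    show "prior_normalizer E ?l ?\<gamma> < \<infinity>"
      using ev(2) pos c0' unfolding evid
      by (simp only: ennreal_mult_less_top infinity_ennreal_def zero_less_iff_neq_zero) blast
  qed
  show up: "update n x y \<in> canonical_hyper E"
    unfolding yl by (rule update_form) (use y x K in \<open>auto simp: yl\<close>)
  fix B assume B[measurable]: "B \<in> sets MT"
  define k where "k = enn2real (prior_normalizer E ?l ?\<gamma>)"
  have k: "0 < k" "prior_normalizer E ?l ?\<gamma> = ennreal k"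
    using K by (simp_all add: k_def enn2real_positive_iff)
  let ?J = "\<integral>\<^sup>+\<theta>. ennreal (?e \<theta>) * indicator B \<theta> \<partial>par_carrier E"
  have "emeasure (prior E (update n x y)) B =
      (\<integral>\<^sup>+\<theta>. ennreal (1 / k) * (ennreal (?e \<theta>) * indicator B \<theta>) \<partial>par_carrier E)"
    unfolding emeasure_prior[OF up B]
  proof (intro nn_integral_cong)
    fix \<theta>
    have "prior_dens \<theta> (update n x y) = ennreal (1 / k) * ennreal (?e \<theta>)"
      using k(1) by (simp add: prior_dens_def update_def yl k_def[symmetric] flip: ennreal_mult)
    then show "prior_dens \<theta> (update n x y) * indicator B \<theta> = ennreal (1 / k) * (ennreal (?e \<theta>) * indicator B \<theta>)"
      by (simp add: mult.assoc)
  qed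
  also have "\<dots> = ennreal (1 / k) * ?J" by (rule nn_integral_cmult) measurable
  also have "\<dots> = (ennreal ?c * ?J) / (ennreal ?c * ennreal k)"
  proof -
    have "(ennreal ?c * ?J) / (ennreal ?c * ennreal k) = ?J / ennreal k"
      
      unfolding mult.commute[of "ennreal ?c"] by (rule divide_mult_eq[OF c0']) simp
    also have "\<dots> = ennreal (1 / k) * ?J"
      using k(1) by (simp add: divide_ennreal_def inverse_ennreal mult.commute inverse_eq_divide)
    finally show ?thesis by simp
  qed
  finally show "(\<integral>\<^sup>+\<theta>. prior_dens \<theta> y * (\<Prod>k<n. lik (x k) \<theta>) * indicator B \<theta> \<partial>par_carrier E) / evidence n x y
        = emeasure (prior E (update n x y)) B"
    unfolding int[OF B] evid k(2) by simp
qed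

end

section \<open>Projective families of exponential families\<close>

lemma (in conjugate_exp_family) stat_second_countable: "second_countable (stat_top E)"
  using family by (intro polish_imp_second_countable) (simp add: exp_family_model_def)

lemma (in conjugate_exp_family) plus_measurable:
  assumes "a \<in> M \<rightarrow>\<^sub>M MU" "b \<in> M \<rightarrow>\<^sub>M MU"
  shows "(\<lambda>w. a w + b w) \<in> M \<rightarrow>\<^sub>M MU"
proof -
  have "(\<lambda>(u, v). u + v) \<in> borel_of (prod_topology (stat_top E) (stat_top E)) \<rightarrow>\<^sub>M MU"
    using family by (intro measurable_continuous_map) (simp add: exp_family_model_def tvs_def)
  from measurable_compose[OF measurable_Pair_borel_of[OF stat_second_countable stat_second_countable assms] this]
  show ?thesis by simp
qed

lemma (in conjugate_exp_family) sum_measurable: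
  assumes "\<And>k. k < n \<Longrightarrow> s k \<in> M \<rightarrow>\<^sub>M MU"
  shows "(\<lambda>w. \<Sum>k<(n::nat). s k w) \<in> M \<rightarrow>\<^sub>M MU"
  using assms
proof (induction n)
  case 0
  then show ?case using subspace_0[OF subspace_stat_top] by simp
next
  case (Suc n)
  then show ?case using plus_measurable[of "\<lambda>w. \<Sum>k<n. s k w" M "s n"] by simp
qed

locale projective_exp_family =
  fixes E :: "'i::{order,countable} \<Rightarrow> ('x, 'u::real_vector) exp_data"
    and f :: "'i \<Rightarrow> 'i \<Rightarrow> 'x \<Rightarrow> 'x" and g h :: "'i \<Rightarrow> 'i \<Rightarrow> 'u \<Rightarrow> 'u"
  assumes directed: "\<forall>I J :: 'i. \<exists>K. I \<le> K \<and> J \<le> K"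
    and obs_system: "projective_system (\<lambda>I. obs_top (E I)) f"
    and par_system: "projective_system (\<lambda>I. par_top (E I)) g"
    and stat_system: "projective_system (\<lambda>I. stat_top (E I)) h"
    and stat_linear: "\<forall>I J. I \<le> J \<longrightarrow> linear_between (stat_top (E J)) (stat_top (E I)) (h J I)"
    and models: "\<forall>I. exp_family_model (E I)"
    and priors: "\<forall>I. canonical_conjugate_prior (E I)"
    and proj_stats: "projective_statistics E f h"
begin

sublocale E: conjugate_exp_family "E I" for I
  using models priors by unfold_locales auto

abbreviation "BX \<equiv> borel_of (obs_limit E f)"
abbreviation "BT \<equiv> borel_of (par_limit E g)"
abbreviation "BU \<equiv> borel_of (stat_limit E h)"
abbreviation "BY \<equiv> borel_of (hyper_limit E h)"

abbreviation MX where "MX I \<equiv> borel_of (obs_top (E I))"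
abbreviation MT where "MT I \<equiv> borel_of (par_top (E I))"
abbreviation MY where "MY I \<equiv> borel_of (hyper_top (stat_top (E I)))"

abbreviation hyper_at :: "'i \<Rightarrow> real \<times> ('i \<Rightarrow> 'u) \<Rightarrow> real \<times> 'u" where
  "hyper_at I y \<equiv> (fst y, snd y I)"

lemma second_countable:
  "second_countable (obs_top (E I))" "second_countable (par_top (E I))" "second_countable (stat_top (E I))"
  using obs_system par_system stat_system
  by (auto simp: projective_system_def intro: polish_imp_second_countable)

lemma polish_hyper_limit: "polish (hyper_limit E h)"
  unfolding hyper_limit_def stat_limit_def
  by (intro polish_hyper_top polish_limit_topology stat_system)

lemma obs_at_measurable: "(\<lambda>x. x I) \<in> BX \<rightarrow>\<^sub>M MX I"
  unfolding obs_limit_def by (rule measurable_limit_projection)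

lemma par_at_measurable: "(\<lambda>\<theta>. \<theta> I) \<in> BT \<rightarrow>\<^sub>M MT I"
  unfolding par_limit_def by (rule measurable_limit_projection)

lemma stat_at_measurable: "(\<lambda>\<gamma>. \<gamma> I) \<in> BU \<rightarrow>\<^sub>M borel_of (stat_top (E I))"
  unfolding stat_limit_def by (rule measurable_limit_projection)

lemma fst_hyper_measurable: "fst \<in> BY \<rightarrow>\<^sub>M borel"
  unfolding hyper_limit_def by (rule measurable_fst_hyper_top)

lemma snd_hyper_measurable: "snd \<in> BY \<rightarrow>\<^sub>M BU"
  unfolding hyper_limit_def by (rule measurable_snd_hyper_top)

lemma topspace_hyper_limit:
  "y \<in> topspace (hyper_limit E h) \<longleftrightarrow> 0 \<le> fst y \<and> snd y \<in> topspace (stat_limit E h)"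
  by (cases y) (simp add: hyper_limit_def hyper_top_def)

lemma hyper_at_measurable: "hyper_at I \<in> BY \<rightarrow>\<^sub>M MY I"
proof (rule measurable_into_hyper_top[OF second_countable(3) fst_hyper_measurable])
  show "0 \<le> fst y" if "y \<in> space BY" for y using that by (simp add: topspace_hyper_limit)
  show "(\<lambda>y. snd y I) \<in> BY \<rightarrow>\<^sub>M borel_of (stat_top (E I))"
    using measurable_compose[OF snd_hyper_measurable stat_at_measurable] .
qed

lemma obs_connect_measurable: "I \<le> J \<Longrightarrow> f J I \<in> MX J \<rightarrow>\<^sub>M MX I"
  using obs_system by (intro measurable_continuous_map) (simp add: projective_system_def)

lemma par_connect_measurable: "I \<le> J \<Longrightarrow> g J I \<in> MT J \<rightarrow>\<^sub>M MT I"
  using par_system by (intro measurable_continuous_map) (simp add: projective_system_def)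

lemma obs_limitD: "x \<in> space BX \<Longrightarrow> x I \<in> topspace (obs_top (E I))"
  "x \<in> space BX \<Longrightarrow> I \<le> J \<Longrightarrow> x I = f J I (x J)"
  unfolding space_borel_of obs_limit_def topspace_limit_topology by blast+

lemma par_limitD: "\<theta> \<in> space BT \<Longrightarrow> \<theta> I \<in> par_set (E I)"
  "\<theta> \<in> space BT \<Longrightarrow> I \<le> J \<Longrightarrow> \<theta> I = g J I (\<theta> J)"
  unfolding space_borel_of par_limit_def topspace_limit_topology E.topspace_par_top by blast+

lemma stat_limitD: "\<gamma> \<in> space BU \<Longrightarrow> \<gamma> I \<in> topspace (stat_top (E I))"
  "\<gamma> \<in> space BU \<Longrightarrow> I \<le> J \<Longrightarrow> \<gamma> I = h J I (\<gamma> J)"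
  unfolding space_borel_of stat_limit_def topspace_limit_topology by blast+

lemma measurable_into_BX:
  assumes "\<And>\<omega>. \<omega> \<in> space M \<Longrightarrow> F \<omega> \<in> space BX" "\<And>I. (\<lambda>\<omega>. F \<omega> I) \<in> M \<rightarrow>\<^sub>M MX I"
  shows "F \<in> M \<rightarrow>\<^sub>M BX"
  using assms unfolding obs_limit_def space_borel_of
  by (intro measurable_limit_topology second_countable) auto

lemma measurable_into_BT:
  assumes "\<And>\<omega>. \<omega> \<in> space M \<Longrightarrow> F \<omega> \<in> space BT" "\<And>I. (\<lambda>\<omega>. F \<omega> I) \<in> M \<rightarrow>\<^sub>M MT I"
  shows "F \<in> M \<rightarrow>\<^sub>M BT"
  using assms unfolding par_limit_def space_borel_of
  by (intro measurable_limit_topology second_countable) auto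

lemma measurable_into_BU:
  assumes "\<And>\<omega>. \<omega> \<in> space M \<Longrightarrow> F \<omega> \<in> space BU" "\<And>I. (\<lambda>\<omega>. F \<omega> I) \<in> M \<rightarrow>\<^sub>M borel_of (stat_top (E I))"
  shows "F \<in> M \<rightarrow>\<^sub>M BU"
  using assms unfolding stat_limit_def space_borel_of
  by (intro measurable_limit_topology second_countable) auto

lemma limit_stat_space: "x \<in> space BX \<Longrightarrow> limit_stat E x \<in> space BU"
  using proj_stats obs_limitD[of x] E.stat_in
  unfolding space_borel_of stat_limit_def topspace_limit_topology limit_stat_def projective_statistics_def
  by metis

lemma limit_stat_measurable: "limit_stat E \<in> BX \<rightarrow>\<^sub>M BU"
proof (rule measurable_into_BU)
  show "(\<lambda>x. limit_stat E x I) \<in> BX \<rightarrow>\<^sub>M borel_of (stat_top (E I))" for I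
    unfolding limit_stat_def using measurable_compose[OF obs_at_measurable E.stat_measurable] .
qed (rule limit_stat_space)

lemma space_BU_plus:
  assumes "\<beta> \<in> space BU" "\<gamma> \<in> space BU"
  shows "(\<lambda>I. \<beta> I + \<gamma> I) \<in> space BU"
proof -
  have "\<beta> I + \<gamma> I = h J I (\<beta> J + \<gamma> J)" if "I \<le> J" for I J
    using stat_linear that stat_limitD[OF assms(1)] stat_limitD[OF assms(2)]
    unfolding linear_between_def by metis
  moreover have "\<beta> I + \<gamma> I \<in> topspace (stat_top (E I))" for I
    using stat_limitD(1)[OF assms(1)] stat_limitD(1)[OF assms(2)] E.subspace_stat_top
    by (intro subspace_add)
  ultimately show ?thesis
    unfolding space_borel_of stat_limit_def topspace_limit_topology by blast
qed

text \<open>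
  Linearity of the connecting maps keeps the sum of statistics compatible.
\<close>

lemma update_index_space:
  assumes "y \<in> space BY" "\<And>k. k < n \<Longrightarrow> x k \<in> space BX"
  shows "update_index (limit_stat E) n x y \<in> space BY"
proof -
  have "(\<lambda>I. snd y I + (\<Sum>k<n. limit_stat E (x k) I)) \<in> space BU"
    using assms(2)
  proof (induction n)
    case 0
    then show ?case using assms(1) by (simp add: topspace_hyper_limit)
  next
    case (Suc n)
    have "(\<lambda>I. snd y I + (\<Sum>k<n. limit_stat E (x k) I)) \<in> space BU"
      using Suc by (metis less_SucI)
    moreover have "limit_stat E (x n) \<in> space BU" using Suc.prems by (intro limit_stat_space) simp
    ultimately have "(\<lambda>I. snd y I + (\<Sum>k<n. limit_stat E (x k) I) + limit_stat E (x n) I) \<in> space BU"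
      by (rule space_BU_plus)
    then show ?case by (simp add: add.assoc)
  qed
  then show ?thesis using assms(1) by (simp add: update_index_def topspace_hyper_limit split_beta)
qed

lemma hyper_at_update_index:
  "hyper_at I (update_index (limit_stat E) n x y) = E.update I n (\<lambda>k. x k I) (hyper_at I y)"
  by (simp add: update_index_def E.update_def split_beta limit_stat_def)

lemma update_index_measurable:
  assumes x: "\<And>k. k < n \<Longrightarrow> (\<lambda>\<omega>. x \<omega> k) \<in> M \<rightarrow>\<^sub>M BX" and y: "y \<in> M \<rightarrow>\<^sub>M BY"
  shows "(\<lambda>\<omega>. update_index (limit_stat E) n (x \<omega>) (y \<omega>)) \<in> M \<rightarrow>\<^sub>M BY"
proof -
  have sp: "update_index (limit_stat E) n (x \<omega>) (y \<omega>) \<in> space BY" if "\<omega> \<in> space M" for \<omega>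
    using measurable_space[OF x that] measurable_space[OF y that] by (rule update_index_space[rotated])
  have BY: "second_countable (stat_limit E h)"
    unfolding stat_limit_def by (intro polish_imp_second_countable polish_limit_topology stat_system)
  let ?l = "\<lambda>\<omega>. fst (update_index (limit_stat E) n (x \<omega>) (y \<omega>))"
  let ?\<gamma> = "\<lambda>\<omega>. snd (update_index (limit_stat E) n (x \<omega>) (y \<omega>))"
  have "(\<lambda>\<omega>. (?l \<omega>, ?\<gamma> \<omega>)) \<in> M \<rightarrow>\<^sub>M borel_of (hyper_top (stat_limit E h))"
  proof (rule measurable_into_hyper_top[OF BY])
    have "(\<lambda>\<omega>. fst (y \<omega>) + real n) \<in> borel_measurable M"
      using measurable_compose[OF y fst_hyper_measurable] by simp
    then show "?l \<in> borel_measurable M" by (simp add: update_index_def split_beta)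
    show "0 \<le> ?l \<omega>" if "\<omega> \<in> space M" for \<omega> using sp[OF that] by (simp add: topspace_hyper_limit)
    show "?\<gamma> \<in> M \<rightarrow>\<^sub>M BU"
    proof (rule measurable_into_BU)
      show "?\<gamma> \<omega> \<in> space BU" if "\<omega> \<in> space M" for \<omega>
        using sp[OF that] by (simp add: topspace_hyper_limit)
      fix I
      have "(\<lambda>\<omega>. snd (y \<omega>) I + (\<Sum>k<n. limit_stat E (x \<omega> k) I)) \<in> M \<rightarrow>\<^sub>M borel_of (stat_top (E I))"
        by (intro E.plus_measurable E.sum_measurable
            measurable_compose[OF y measurable_compose[OF snd_hyper_measurable stat_at_measurable]]
            measurable_compose[OF x measurable_compose[OF limit_stat_measurable stat_at_measurable]])
      then show "(\<lambda>\<omega>. ?\<gamma> \<omega> I) \<in> M \<rightarrow>\<^sub>M borel_of (stat_top (E I))"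
        by (simp add: update_index_def split_beta)
    qed
  qed
  then show ?thesis by (simp add: hyper_limit_def)
qed

lemma limit_canonical_hyperD:
  "y \<in> limit_canonical_hyper E h \<Longrightarrow> hyper_at I y \<in> canonical_hyper (E I)"
  by (auto simp: limit_canonical_hyper_def)

lemma limit_canonical_hyperI:
  "y \<in> space BY \<Longrightarrow> (\<And>I. hyper_at I y \<in> canonical_hyper (E I)) \<Longrightarrow> y \<in> limit_canonical_hyper E h"
  by (auto simp: limit_canonical_hyper_def split_beta)

end

section \<open>Laws of parameter, data and hyperparameter at one index\<close>

lemma emeasure_prob_kernel_measurable:
  assumes "K \<in> A \<rightarrow>\<^sub>M prob_algebra B" "S \<in> sets B"
  shows "(\<lambda>x. emeasure (K x) S) \<in> borel_measurable A"
  using measurable_compose[OF measurable_prob_algebraD[OF assms(1)] measurable_emeasure_subprob_algebra[OF assms(2)]] .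

locale projective_limit_kernels = projective_exp_family E f g h
  for E :: "'i::{order,countable} \<Rightarrow> ('x, 'u::real_vector) exp_data" and f g h +
  fixes P :: "('i \<Rightarrow> 'u) \<Rightarrow> ('i \<Rightarrow> 'x) measure"
    and Q :: "real \<times> ('i \<Rightarrow> 'u) \<Rightarrow> ('i \<Rightarrow> 'u) measure"
  assumes limit: "projective_limit_model E f g h P Q"
begin

lemma P_measurable [measurable]: "P \<in> BT \<rightarrow>\<^sub>M prob_algebra BX"
  and Q_measurable [measurable]: "Q \<in> BY \<rightarrow>\<^sub>M prob_algebra BT"
  using limit by (simp_all add: projective_limit_model_def)

lemma P_prob: "\<theta> \<in> space BT \<Longrightarrow> prob_space (P \<theta>)" "\<theta> \<in> space BT \<Longrightarrow> sets (P \<theta>) = sets BX"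
  using measurable_space[OF P_measurable] by (simp_all add: space_prob_algebra)

lemma Q_prob: "y \<in> space BY \<Longrightarrow> prob_space (Q y)" "y \<in> space BY \<Longrightarrow> sets (Q y) = sets BT"
  using measurable_space[OF Q_measurable] by (simp_all add: space_prob_algebra)

lemma emeasure_P: "\<theta> \<in> space BT \<Longrightarrow> emeasure (P \<theta>) A = ennreal (measure (P \<theta>) A)"
  using P_prob(1) by (simp add: prob_space_def finite_measure.emeasure_eq_measure)

lemma emeasure_Q: "y \<in> space BY \<Longrightarrow> emeasure (Q y) A = ennreal (measure (Q y) A)"
  using Q_prob(1) by (simp add: prob_space_def finite_measure.emeasure_eq_measure)

end

locale projective_limit_bayes = projective_limit_kernels E f g h P Q
  for E :: "'i::{order,countable} \<Rightarrow> ('x, 'u::real_vector) exp_data" and f g h P Q +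
  fixes M :: "'w measure"
    and X :: "nat \<Rightarrow> 'w \<Rightarrow> ('i \<Rightarrow> 'x)" and \<Theta> :: "'w \<Rightarrow> ('i \<Rightarrow> 'u)"
    and Y :: "'w \<Rightarrow> real \<times> ('i \<Rightarrow> 'u)"
  assumes bayes: "bayesian_model M (borel_of (obs_limit E f)) (borel_of (par_limit E g))
      (borel_of (hyper_limit E h)) P Q X \<Theta> Y"
    and canonical: "AE \<omega> in M. Y \<omega> \<in> limit_canonical_hyper E h"
begin

sublocale prob_space M
  using bayes by (simp add: bayesian_model_def)

lemma X_measurable [measurable]: "X k \<in> M \<rightarrow>\<^sub>M BX"
  and \<Theta>_measurable [measurable]: "\<Theta> \<in> M \<rightarrow>\<^sub>M BT"
  and Y_measurable [measurable]: "Y \<in> M \<rightarrow>\<^sub>M BY"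
  using bayes by (simp_all add: bayesian_model_def)

lemma law_par:
  assumes A: "A \<in> sets BT" and D: "D \<in> sets BY"
  shows "emeasure M {\<omega>\<in>space M. \<Theta> \<omega> \<in> A \<and> Y \<omega> \<in> D} =
    (\<integral>\<^sup>+\<omega>. indicator D (Y \<omega>) * emeasure (Q (Y \<omega>)) A \<partial>M)"
proof -
  have w: "(\<lambda>y. measure (Q y) A) \<in> borel_measurable BY"
    using measurable_compose[OF Q_measurable measurable_measure_prob_algebra[OF A]] .
  have AE: "AE \<omega> in M. given_prob M Y BY (\<Theta> -` A \<inter> space M) \<omega> = measure (Q (Y \<omega>)) A"
    using bayes A by (simp add: bayesian_model_def)
  have set: "\<Theta> -` A \<inter> space M \<in> sets M" using A by measurable
  have bd: "0 \<le> measure (Q y) A \<and> measure (Q y) A \<le> 1" if "y \<in> space BY" for y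
    using prob_space.prob_le_1[OF Q_prob(1)[OF that]] by simp
  have "{\<omega>\<in>space M. \<Theta> \<omega> \<in> A \<and> Y \<omega> \<in> D} = (\<Theta> -` A \<inter> space M) \<inter> (Y -` D \<inter> space M)" by auto
  then have "emeasure M {\<omega>\<in>space M. \<Theta> \<omega> \<in> A \<and> Y \<omega> \<in> D} =
      (\<integral>\<^sup>+\<omega>. indicator D (Y \<omega>) * ennreal (measure (Q (Y \<omega>)) A) \<partial>M)"
    using given_prob_eq_iff[OF Y_measurable set w bd] AE D by simp
  also have "\<dots> = (\<integral>\<^sup>+\<omega>. indicator D (Y \<omega>) * emeasure (Q (Y \<omega>)) A \<partial>M)"
    by (intro nn_integral_cong) (simp only: emeasure_Q[OF measurable_space[OF Y_measurable]])
  finally show ?thesis .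
qed

lemma law_obs:
  assumes A: "\<And>k. k < n \<Longrightarrow> A k \<in> sets BX" and G: "G \<in> sets (BT \<Otimes>\<^sub>M BY)"
  shows "emeasure M {\<omega>\<in>space M. (\<forall>k<n. X k \<omega> \<in> A k) \<and> (\<Theta> \<omega>, Y \<omega>) \<in> G} =
    (\<integral>\<^sup>+\<omega>. indicator G (\<Theta> \<omega>, Y \<omega>) * (\<Prod>k<n. emeasure (P (\<Theta> \<omega>)) (A k)) \<partial>M)"
proof -
  let ?w = "\<lambda>z. \<Prod>k<n. measure (P (fst z)) (A k)"
  let ?Z = "\<lambda>\<omega>. (\<Theta> \<omega>, Y \<omega>)"
  let ?S = "{\<omega>\<in>space M. \<forall>k<n. X k \<omega> \<in> A k}"
  have w: "?w \<in> borel_measurable (BT \<Otimes>\<^sub>M BY)"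
  proof (rule borel_measurable_prod)
    fix k assume "k \<in> {..<n}"
    then have "A k \<in> sets BX" using A by simp
    from measurable_compose[OF P_measurable measurable_measure_prob_algebra[OF this]]
    show "(\<lambda>z. measure (P (fst z)) (A k)) \<in> borel_measurable (BT \<Otimes>\<^sub>M BY)"
      by (rule measurable_compose[OF measurable_fst])
  qed
  have Z: "?Z \<in> M \<rightarrow>\<^sub>M BT \<Otimes>\<^sub>M BY" by measurable
  have set: "?S \<in> sets M"
  proof -
    have "{\<omega>\<in>space M. X k \<omega> \<in> A k} \<in> sets M" if "k < n" for k
      using A[OF that] by measurable
    then have "{\<omega>\<in>space M. \<forall>k\<in>{..<n}. X k \<omega> \<in> A k} \<in> sets M"
      by (intro sets.sets_Collect_finite_All) auto
    then show ?thesis unfolding Ball_def lessThan_iff .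
  qed
  have AE: "AE \<omega> in M. given_prob M ?Z (BT \<Otimes>\<^sub>M BY) ?S \<omega> = ?w (?Z \<omega>)"
    using bayes A by (simp add: bayesian_model_def)
  have bd: "0 \<le> ?w z \<and> ?w z \<le> 1" if z: "z \<in> space (BT \<Otimes>\<^sub>M BY)" for z
  proof -
    have "fst z \<in> space BT" using z by (auto simp: space_pair_measure)
    then show ?thesis using prob_space.prob_le_1[OF P_prob(1)] by (intro conjI prod_nonneg prod_le_1) auto
  qed
  have "{\<omega>\<in>space M. (\<forall>k<n. X k \<omega> \<in> A k) \<and> (\<Theta> \<omega>, Y \<omega>) \<in> G} = ?S \<inter> (?Z -` G \<inter> space M)" by auto
  then have "emeasure M {\<omega>\<in>space M. (\<forall>k<n. X k \<omega> \<in> A k) \<and> (\<Theta> \<omega>, Y \<omega>) \<in> G} =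
      (\<integral>\<^sup>+\<omega>. indicator G (?Z \<omega>) * ennreal (?w (?Z \<omega>)) \<partial>M)"
    using given_prob_eq_iff[OF Z set w bd] AE G by simp
  also have "\<dots> = (\<integral>\<^sup>+\<omega>. indicator G (\<Theta> \<omega>, Y \<omega>) * (\<Prod>k<n. emeasure (P (\<Theta> \<omega>)) (A k)) \<partial>M)"
  proof (intro nn_integral_cong)
    fix \<omega> assume "\<omega> \<in> space M"
    then have "\<Theta> \<omega> \<in> space BT" by (rule measurable_space[OF \<Theta>_measurable])
    then show "indicator G (?Z \<omega>) * ennreal (?w (?Z \<omega>)) =
        indicator G (\<Theta> \<omega>, Y \<omega>) * (\<Prod>k<n. emeasure (P (\<Theta> \<omega>)) (A k))"
      by (simp add: emeasure_P prod_ennreal)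
  qed
  finally show ?thesis .
qed

text \<open>
  A property that holds almost surely under every canonical prior holds almost surely for the random
  parameter, whose conditional law given the hyperparameter is such a prior.
\<close>

lemma AE_par:
  assumes R: "{\<theta>\<in>space BT. R \<theta>} \<in> sets BT"
    and AE: "\<And>y. y \<in> limit_canonical_hyper E h \<Longrightarrow> AE \<theta> in Q y. R \<theta>"
  shows "AE \<omega> in M. R (\<Theta> \<omega>)"
proof -
  let ?N = "{\<theta>\<in>space BT. \<not> R \<theta>}"
  have N: "?N \<in> sets BT" using R by (rule sets.sets_Collect_neg)
  have "AE \<omega> in M. emeasure (Q (Y \<omega>)) ?N = 0"
    using canonical AE_space
  proof eventually_elim
    fix \<omega> assume "Y \<omega> \<in> limit_canonical_hyper E h" "\<omega> \<in> space M"
    then have "AE \<theta> in Q (Y \<omega>). R \<theta>" and Y: "Y \<omega> \<in> space BY"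
      using AE measurable_space[OF Y_measurable] by auto
    moreover have "space (Q (Y \<omega>)) = space BT" using Q_prob(2)[OF Y] by (rule sets_eq_imp_space_eq)
    ultimately show "emeasure (Q (Y \<omega>)) ?N = 0"
      using N Q_prob(2)[OF Y] by (subst (asm) AE_iff_measurable[OF _ refl]) auto
  qed
  then have "(\<integral>\<^sup>+\<omega>. indicator (space BY) (Y \<omega>) * emeasure (Q (Y \<omega>)) ?N \<partial>M) = 0"
    by (subst nn_integral_cong_AE[where v="\<lambda>_. 0"]) auto
  then have "emeasure M {\<omega>\<in>space M. \<Theta> \<omega> \<in> ?N \<and> Y \<omega> \<in> space BY} = 0"
    using law_par[OF N sets.top] by simp
  moreover have "{\<omega>\<in>space M. \<Theta> \<omega> \<in> ?N \<and> Y \<omega> \<in> space BY} = {\<omega>\<in>space M. \<not> R (\<Theta> \<omega>)}"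
    using measurable_space[OF \<Theta>_measurable] measurable_space[OF Y_measurable] by auto
  moreover have "{\<omega>\<in>space M. \<Theta> \<omega> \<in> ?N} \<in> sets M" using N by measurable
  moreover have "{\<omega>\<in>space M. \<Theta> \<omega> \<in> ?N} = {\<omega>\<in>space M. \<not> R (\<Theta> \<omega>)}"
    using measurable_space[OF \<Theta>_measurable] by auto
  ultimately show ?thesis
    by (intro AE_I'[of "{\<omega>\<in>space M. \<not> R (\<Theta> \<omega>)}"]) (auto simp: null_sets_def)
qed

lemma model_at:
  assumes C: "C \<in> sets (MX I)"
  shows "AE \<omega> in M. emeasure (P (\<Theta> \<omega>)) ((\<lambda>x. x I) -` C \<inter> space BX) = emeasure (model (E I) (\<Theta> \<omega> I)) C"
proof (rule AE_par)
  have C': "(\<lambda>x. x I) -` C \<inter> space BX \<in> sets BX" using obs_at_measurable C by (rule measurable_sets)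
  have 2: "(\<lambda>\<theta>. emeasure (model (E I) (\<theta> I)) C) \<in> borel_measurable BT"
    by (rule emeasure_prob_kernel_measurable[OF measurable_compose[OF par_at_measurable E.model_measurable] C])
  show "{\<theta>\<in>space BT. emeasure (P \<theta>) ((\<lambda>x. x I) -` C \<inter> space BX) = emeasure (model (E I) (\<theta> I)) C} \<in> sets BT"
    using emeasure_prob_kernel_measurable[OF P_measurable C'] 2 by measurable
  fix y assume y: "y \<in> limit_canonical_hyper E h"
  then have "y \<in> space BY" by (auto simp: limit_canonical_hyper_def)
  then have sp: "space (Q y) = space BT" using Q_prob(2) by (intro sets_eq_imp_space_eq)
  have "AE \<theta> in Q y. distr (P \<theta>) (MX I) (\<lambda>x. x I) = model (E I) (\<theta> I)"
    using limit y unfolding projective_limit_model_def by auto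
  then show "AE \<theta> in Q y. emeasure (P \<theta>) ((\<lambda>x. x I) -` C \<inter> space BX) = emeasure (model (E I) (\<theta> I)) C"
    using AE_space
  proof eventually_elim
    fix \<theta> assume eq: "distr (P \<theta>) (MX I) (\<lambda>x. x I) = model (E I) (\<theta> I)" and "\<theta> \<in> space (Q y)"
    then have s: "sets (P \<theta>) = sets BX" using sp P_prob(2) by simp
    then have "(\<lambda>x. x I) \<in> P \<theta> \<rightarrow>\<^sub>M MX I"
      using obs_at_measurable measurable_cong_sets[OF s refl] by blast
    from emeasure_distr[OF this C] show "emeasure (P \<theta>) ((\<lambda>x. x I) -` C \<inter> space BX) = emeasure (model (E I) (\<theta> I)) C"
      unfolding eq sets_eq_imp_space_eq[OF s] by simp
  qed
qed

lemma law_obs_at: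
  assumes C: "\<And>k. k < n \<Longrightarrow> C k \<in> sets (MX I)" and G: "G \<in> sets (BT \<Otimes>\<^sub>M BY)"
  shows "emeasure M {\<omega>\<in>space M. (\<forall>k<n. X k \<omega> I \<in> C k) \<and> (\<Theta> \<omega>, Y \<omega>) \<in> G} =
    (\<integral>\<^sup>+\<omega>. indicator G (\<Theta> \<omega>, Y \<omega>) * (\<Prod>k<n. emeasure (model (E I) (\<Theta> \<omega> I)) (C k)) \<partial>M)"
proof -
  have C': "(\<lambda>x. x I) -` C k \<inter> space BX \<in> sets BX" if "k < n" for k
    using obs_at_measurable C[OF that] by (rule measurable_sets)
  have "{\<omega>\<in>space M. (\<forall>k<n. X k \<omega> I \<in> C k) \<and> (\<Theta> \<omega>, Y \<omega>) \<in> G} =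
      {\<omega>\<in>space M. (\<forall>k<n. X k \<omega> \<in> (\<lambda>x. x I) -` C k \<inter> space BX) \<and> (\<Theta> \<omega>, Y \<omega>) \<in> G}"
    using measurable_space[OF X_measurable] by auto
  also have "emeasure M \<dots> =
      (\<integral>\<^sup>+\<omega>. indicator G (\<Theta> \<omega>, Y \<omega>) * (\<Prod>k<n. emeasure (P (\<Theta> \<omega>)) ((\<lambda>x. x I) -` C k \<inter> space BX)) \<partial>M)"
    by (rule law_obs[OF C' G])
  also have "\<dots> = (\<integral>\<^sup>+\<omega>. indicator G (\<Theta> \<omega>, Y \<omega>) * (\<Prod>k<n. emeasure (model (E I) (\<Theta> \<omega> I)) (C k)) \<partial>M)"
  proof (rule nn_integral_cong_AE)
    have "AE \<omega> in M. \<forall>k\<in>{..<n}. emeasure (P (\<Theta> \<omega>)) ((\<lambda>x. x I) -` C k \<inter> space BX) = emeasure (model (E I) (\<Theta> \<omega> I)) (C k)"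
      using model_at C by (intro AE_finite_allI) auto
    then show "AE \<omega> in M. indicator G (\<Theta> \<omega>, Y \<omega>) * (\<Prod>k<n. emeasure (P (\<Theta> \<omega>)) ((\<lambda>x. x I) -` C k \<inter> space BX)) =
        indicator G (\<Theta> \<omega>, Y \<omega>) * (\<Prod>k<n. emeasure (model (E I) (\<Theta> \<omega> I)) (C k))"
      by eventually_elim simp
  qed
  finally show ?thesis .
qed

lemma prior_at:
  assumes y: "y \<in> limit_canonical_hyper E h" and B: "B \<in> sets (MT I)"
  shows "emeasure (Q y) ((\<lambda>\<theta>. \<theta> I) -` B \<inter> space BT) = emeasure (prior (E I) (hyper_at I y)) B"
proof -
  have Y: "y \<in> space BY" using y by (auto simp: limit_canonical_hyper_def)
  have m: "(\<lambda>\<theta>. \<theta> I) \<in> Q y \<rightarrow>\<^sub>M MT I"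
    using par_at_measurable measurable_cong_sets[OF Q_prob(2)[OF Y] refl] by blast
  have "distr (Q y) (MT I) (\<lambda>\<theta>. \<theta> I) = prior (E I) (hyper_at I y)"
    using limit y unfolding projective_limit_model_def by (cases y) auto
  then show ?thesis
    using emeasure_distr[OF m B] sets_eq_imp_space_eq[OF Q_prob(2)[OF Y]] by simp
qed

lemma prior_dens_measurable_at:
  "(\<lambda>z. E.prior_dens I (fst z) (hyper_at I (Y (snd z)))) \<in> borel_measurable (MT I \<Otimes>\<^sub>M M)"
  by (rule E.prior_dens_measurable[OF measurable_fst
        measurable_compose[OF measurable_snd measurable_compose[OF Y_measurable hyper_at_measurable]]])

text \<open>
  At one index the joint law of parameter and hyperparameter has the canonical prior density with
  respect to the product of the carrier measure and the law of the hyperparameter.  The carrier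
  measure is common to all hyperparameters; this permits the interchange of integrals.
\<close>

lemma law_par_at:
  assumes F[measurable]: "F \<in> borel_measurable (MT I)" and D[measurable]: "D \<in> sets BY"
  shows "(\<integral>\<^sup>+\<omega>. F (\<Theta> \<omega> I) * indicator D (Y \<omega>) \<partial>M) =
    (\<integral>\<^sup>+t. F t * (\<integral>\<^sup>+\<omega>. indicator D (Y \<omega>) * E.prior_dens I t (hyper_at I (Y \<omega>)) \<partial>M) \<partial>par_carrier (E I))"
proof -
  have \<Theta>I[measurable]: "(\<lambda>\<omega>. \<Theta> \<omega> I) \<in> M \<rightarrow>\<^sub>M MT I"
    by (rule measurable_compose[OF \<Theta>_measurable par_at_measurable])
  note [measurable] = prior_dens_measurable_at[of I] E.sets_par_carrier[of I, measurable_cong]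
  have pd[measurable]: "(\<lambda>z. E.prior_dens I (fst z) (hyper_at I (Y (snd z)))) \<in> borel_measurable (par_carrier (E I) \<Otimes>\<^sub>M M)"
    using prior_dens_measurable_at[of I] by measurable
  let ?r = "\<lambda>t. \<integral>\<^sup>+\<omega>. indicator D (Y \<omega>) * E.prior_dens I t (hyper_at I (Y \<omega>)) \<partial>M"
  let ?d = "\<lambda>z. indicator D (Y (snd z)) * E.prior_dens I (fst z) (hyper_at I (Y (snd z)))"
  have r[measurable]: "?r \<in> borel_measurable (par_carrier (E I))"
  proof -
    have "?d \<in> borel_measurable (par_carrier (E I) \<Otimes>\<^sub>M M)" by measurable
    from borel_measurable_nn_integral_fst[OF this] show ?thesis by simp
  qed
  interpret pair: pair_sigma_finite "par_carrier (E I)" M ..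
  have "distr (density M (\<lambda>\<omega>. indicator D (Y \<omega>))) (MT I) (\<lambda>\<omega>. \<Theta> \<omega> I) = density (par_carrier (E I)) ?r"
  proof (rule measure_eqI)
    show "sets (distr (density M (\<lambda>\<omega>. indicator D (Y \<omega>))) (MT I) (\<lambda>\<omega>. \<Theta> \<omega> I)) = sets (density (par_carrier (E I)) ?r)"
      by (simp add: E.sets_par_carrier)
    fix B assume "B \<in> sets (distr (density M (\<lambda>\<omega>. indicator D (Y \<omega>))) (MT I) (\<lambda>\<omega>. \<Theta> \<omega> I))"
    then have B[measurable]: "B \<in> sets (MT I)" by simp
    then have B'[measurable]: "B \<in> sets (par_carrier (E I))" by (simp add: E.sets_par_carrier)
    have B'': "(\<lambda>\<theta>. \<theta> I) -` B \<inter> space BT \<in> sets BT" using par_at_measurable B by (rule measurable_sets)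
    have "emeasure (distr (density M (\<lambda>\<omega>. indicator D (Y \<omega>))) (MT I) (\<lambda>\<omega>. \<Theta> \<omega> I)) B =
        (\<integral>\<^sup>+\<omega>. indicator D (Y \<omega>) * indicator ((\<lambda>\<omega>. \<Theta> \<omega> I) -` B \<inter> space M) \<omega> \<partial>M)"
      by (simp add: emeasure_distr emeasure_density)
    also have "\<dots> = (\<integral>\<^sup>+\<omega>. indicator {\<omega>\<in>space M. \<Theta> \<omega> \<in> (\<lambda>\<theta>. \<theta> I) -` B \<inter> space BT \<and> Y \<omega> \<in> D} \<omega> \<partial>M)"
      by (intro nn_integral_cong) (use measurable_space[OF \<Theta>_measurable] in \<open>auto simp: indicator_def\<close>)
    also have "\<dots> = emeasure M {\<omega>\<in>space M. \<Theta> \<omega> \<in> (\<lambda>\<theta>. \<theta> I) -` B \<inter> space BT \<and> Y \<omega> \<in> D}"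
      using B'' by (intro nn_integral_indicator) measurable
    also have "\<dots> = (\<integral>\<^sup>+\<omega>. indicator D (Y \<omega>) * emeasure (Q (Y \<omega>)) ((\<lambda>\<theta>. \<theta> I) -` B \<inter> space BT) \<partial>M)"
      by (rule law_par[OF B'' D])
    also have "\<dots> = (\<integral>\<^sup>+\<omega>. (\<integral>\<^sup>+t. ?d (t, \<omega>) * indicator B t \<partial>par_carrier (E I)) \<partial>M)"
    proof (rule nn_integral_cong_AE, use canonical AE_space in eventually_elim)
      fix \<omega> assume y: "Y \<omega> \<in> limit_canonical_hyper E h" and \<omega>: "\<omega> \<in> space M"
      have [measurable]: "(\<lambda>t. E.prior_dens I t (hyper_at I (Y \<omega>))) \<in> borel_measurable (par_carrier (E I))"
        using measurable_compose[OF measurable_Pair2'[OF \<omega>] pd] by simp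
      show "indicator D (Y \<omega>) * emeasure (Q (Y \<omega>)) ((\<lambda>\<theta>. \<theta> I) -` B \<inter> space BT) =
          (\<integral>\<^sup>+t. ?d (t, \<omega>) * indicator B t \<partial>par_carrier (E I))"
        unfolding prior_at[OF y B] E.emeasure_prior[OF limit_canonical_hyperD[OF y] B]
        by (subst nn_integral_cmult[symmetric]) (simp_all add: mult.assoc)
    qed
    also have "\<dots> = (\<integral>\<^sup>+t. (\<integral>\<^sup>+\<omega>. ?d (t, \<omega>) * indicator B t \<partial>M) \<partial>par_carrier (E I))"
      by (rule pair.Fubini') measurable
    also have "\<dots> = (\<integral>\<^sup>+t. ?r t * indicator B t \<partial>par_carrier (E I))"
    proof (rule nn_integral_cong)
      fix t assume t: "t \<in> space (par_carrier (E I))"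
      have [measurable]: "(\<lambda>\<omega>. E.prior_dens I t (hyper_at I (Y \<omega>))) \<in> borel_measurable M"
        using measurable_compose[OF measurable_Pair1'[OF t] pd] by simp
      show "(\<integral>\<^sup>+\<omega>. ?d (t, \<omega>) * indicator B t \<partial>M) = ?r t * indicator B t"
        by (subst nn_integral_multc[symmetric]) simp_all
    qed
    also have "\<dots> = emeasure (density (par_carrier (E I)) ?r) B"
      by (simp add: emeasure_density)
    finally show "emeasure (distr (density M (\<lambda>\<omega>. indicator D (Y \<omega>))) (MT I) (\<lambda>\<omega>. \<Theta> \<omega> I)) B =
        emeasure (density (par_carrier (E I)) ?r) B" .
  qed
  note law = this
  have F': "F \<in> borel_measurable (par_carrier (E I))" by measurable
  have "(\<integral>\<^sup>+\<omega>. F (\<Theta> \<omega> I) * indicator D (Y \<omega>) \<partial>M) =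
      (\<integral>\<^sup>+t. F t \<partial>distr (density M (\<lambda>\<omega>. indicator D (Y \<omega>))) (MT I) (\<lambda>\<omega>. \<Theta> \<omega> I))"
    by (simp add: nn_integral_distr nn_integral_density mult.commute)
  also have "\<dots> = (\<integral>\<^sup>+t. ?r t * F t \<partial>par_carrier (E I))"
    unfolding law using F' by (intro nn_integral_density) simp_all
  finally show ?thesis by (simp add: mult.commute)
qed

end

text \<open>
  These are the conditions on a generator in \<open>measure_eqI_rectangles\<close>.
\<close>

lemma rectangles_PiM_pair:
  fixes N :: "'k \<Rightarrow> 'a measure" and L :: "'b measure"
  assumes J: "finite J"
  defines "\<B> \<equiv> {Pi\<^sub>E J C \<times> D | C D. (\<forall>k\<in>J. C k \<in> sets (N k)) \<and> D \<in> sets L}"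
  shows "Int_stable \<B>" "\<B> \<subseteq> Pow (space (Pi\<^sub>M J N \<Otimes>\<^sub>M L))" "space (Pi\<^sub>M J N \<Otimes>\<^sub>M L) \<in> \<B>"
    "sets (Pi\<^sub>M J N \<Otimes>\<^sub>M L) = sigma_sets (space (Pi\<^sub>M J N \<Otimes>\<^sub>M L)) \<B>"
proof -
  let ?A = "{Pi\<^sub>E J C | C. \<forall>k\<in>J. C k \<in> sets (N k)}"
  have \<B>: "\<B> = {a \<times> b | a b. a \<in> ?A \<and> b \<in> sets L}" unfolding \<B>_def by blast
  have sp: "space (Pi\<^sub>M J N \<Otimes>\<^sub>M L) = Pi\<^sub>E J (\<lambda>k. space (N k)) \<times> space L"
    by (simp add: space_pair_measure space_PiM)
  have top: "Pi\<^sub>E J (\<lambda>k. space (N k)) \<in> ?A" by blast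
  have A: "?A \<subseteq> Pow (space (Pi\<^sub>M J N))"
  proof
    fix a assume "a \<in> ?A"
    then obtain C where "a = Pi\<^sub>E J C" "\<forall>k\<in>J. C k \<in> sets (N k)" by blast
    moreover from this have "Pi\<^sub>E J C \<subseteq> (\<Pi>\<^sub>E i\<in>J. space (N i))"
      by (intro PiE_mono sets.sets_into_space) blast
    ultimately show "a \<in> Pow (space (Pi\<^sub>M J N))" by (simp add: space_PiM)
  qed
  show "Int_stable \<B>"
    unfolding Int_stable_def
  proof (intro ballI)
    fix a b assume "a \<in> \<B>" "b \<in> \<B>"
    then obtain C D C' D' where *: "a = Pi\<^sub>E J C \<times> D" "b = Pi\<^sub>E J C' \<times> D'"
      "\<forall>k\<in>J. C k \<in> sets (N k)" "\<forall>k\<in>J. C' k \<in> sets (N k)" "D \<in> sets L" "D' \<in> sets L"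
      unfolding \<B>_def by blast
    have "a \<inter> b = Pi\<^sub>E J (\<lambda>k. C k \<inter> C' k) \<times> (D \<inter> D')"
      unfolding *(1,2) by (simp add: Times_Int_Times PiE_Int)
    moreover have "\<forall>k\<in>J. C k \<inter> C' k \<in> sets (N k)" "D \<inter> D' \<in> sets L" using *(3-6) by auto
    ultimately show "a \<inter> b \<in> \<B>"
      unfolding \<B>_def by (intro CollectI exI[of _ "\<lambda>k. C k \<inter> C' k"] exI[of _ "D \<inter> D'"] conjI)
  qed
  show sub: "\<B> \<subseteq> Pow (space (Pi\<^sub>M J N \<Otimes>\<^sub>M L))"
    unfolding \<B> space_pair_measure using A sets.sets_into_space by blast
  show "space (Pi\<^sub>M J N \<Otimes>\<^sub>M L) \<in> \<B>" 
    unfolding sp \<B>_def by (intro CollectI exI[of _ "\<lambda>k. space (N k)"] exI[of _ "space L"]) simp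
  have "sets (Pi\<^sub>M J N) = sigma_sets (space (Pi\<^sub>M J N)) ?A"
    unfolding sets_PiM prod_algebra_eq_finite[OF J] space_PiM Pi_iff ..
  note gen = this
  have "sets (Pi\<^sub>M J N \<Otimes>\<^sub>M L) = sets (sigma (space (Pi\<^sub>M J N) \<times> space L) \<B>)"
    unfolding \<B>
    by (rule sets_pair_eq[where Ca="{space (Pi\<^sub>M J N)}" and Cb="{space L}"])
      (use A top gen in \<open>simp_all add: sets.space_closed sets.sigma_sets_eq space_PiM\<close>)
  also have "\<dots> = sigma_sets (space (Pi\<^sub>M J N) \<times> space L) \<B>"
    using sub by (intro sets_measure_of) (simp only: space_pair_measure)
  finally show "sets (Pi\<^sub>M J N \<Otimes>\<^sub>M L) = sigma_sets (space (Pi\<^sub>M J N \<Otimes>\<^sub>M L)) \<B>"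
    by (simp add: space_pair_measure)
qed

context conjugate_exp_family
begin

sublocale obs_prod: product_sigma_finite "\<lambda>_::nat. obs_carrier E" ..

lemma model_prod:
  fixes n :: nat
  assumes \<theta>: "\<theta> \<in> par_set E" and C: "\<And>k. k < n \<Longrightarrow> C k \<in> sets MX"
  shows "(\<Prod>k<n. emeasure (model E \<theta>) (C k)) =
    (\<integral>\<^sup>+x. (\<Prod>k<n. lik (x k) \<theta>) * indicator (Pi\<^sub>E {..<n} C) x \<partial>Pi\<^sub>M {..<n} (\<lambda>_. obs_carrier E))"
proof -
  have lik: "(\<lambda>x. lik x \<theta>) \<in> borel_measurable (obs_carrier E)"
    by (rule lik_measurable[OF measurable_ident_sets[OF sets_obs_carrier] measurable_par[OF \<theta>]])
  have "(\<Prod>k<n. emeasure (model E \<theta>) (C k)) =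
      (\<Prod>k<n. \<integral>\<^sup>+x. lik x \<theta> * indicator (C k) x \<partial>obs_carrier E)"
    using emeasure_model[OF \<theta>] C by simp
  also have "\<dots> = (\<integral>\<^sup>+x. (\<Prod>k<n. lik (x k) \<theta> * indicator (C k) (x k)) \<partial>Pi\<^sub>M {..<n} (\<lambda>_. obs_carrier E))"
  proof (rule obs_prod.product_nn_integral_prod[where f="\<lambda>k x. lik x \<theta> * indicator (C k) x", symmetric])
    fix k assume "k \<in> {..<n}"
    then have "C k \<in> sets (obs_carrier E)" using C by (simp add: sets_obs_carrier)
    then show "(\<lambda>x. lik x \<theta> * indicator (C k) x) \<in> borel_measurable (obs_carrier E)"
      using lik by simp
  qed simp
  also have "\<dots> = (\<integral>\<^sup>+x. (\<Prod>k<n. lik (x k) \<theta>) * indicator (Pi\<^sub>E {..<n} C) x \<partial>Pi\<^sub>M {..<n} (\<lambda>_. obs_carrier E))"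
  proof (rule nn_integral_cong)
    fix x assume "x \<in> space (Pi\<^sub>M {..<n} (\<lambda>_::nat. obs_carrier E))"
    then have "x \<in> extensional {..<n}" by (simp add: space_PiM PiE_def)
    then have "(\<Prod>k<n. indicator (C k) (x k) :: ennreal) = indicator (Pi\<^sub>E {..<n} C) x"
      by (auto simp: indicator_def PiE_iff prod_zero_iff)
    then show "(\<Prod>k<n. lik (x k) \<theta> * indicator (C k) (x k)) = (\<Prod>k<n. lik (x k) \<theta>) * indicator (Pi\<^sub>E {..<n} C) x"
      by (simp add: prod.distrib)
  qed
  finally show ?thesis .
qed

lemma update_cong: "(\<And>k. k < n \<Longrightarrow> x k = x' k) \<Longrightarrow> update n x y = update n x' y"
  by (simp add: update_def split_beta)

end

context projective_limit_bayes
begin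

abbreviation "LY \<equiv> distr M BY Y"

abbreviation carrier_prod :: "nat \<Rightarrow> 'i \<Rightarrow> (nat \<Rightarrow> 'x) measure" where
  "carrier_prod n I \<equiv> Pi\<^sub>M {..<n} (\<lambda>_. obs_carrier (E I))"

definition obs_at :: "nat \<Rightarrow> 'i \<Rightarrow> 'w \<Rightarrow> nat \<Rightarrow> 'x" where
  "obs_at n I \<omega> = (\<lambda>k\<in>{..<n}. X k \<omega> I)"

definition joint_dens :: "nat \<Rightarrow> 'i \<Rightarrow> 'u \<times> ((nat \<Rightarrow> 'x) \<times> (real \<times> ('i \<Rightarrow> 'u))) \<Rightarrow> ennreal" where
  "joint_dens n I z = E.prior_dens I (fst z) (hyper_at I (snd (snd z))) *
     (\<Prod>k<n. E.lik I (fst (snd z) k) (fst z))"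

lemma \<Theta>_at_measurable: "(\<lambda>\<omega>. \<Theta> \<omega> I) \<in> M \<rightarrow>\<^sub>M MT I"
  by (rule measurable_compose[OF \<Theta>_measurable par_at_measurable])

lemma X_at_measurable: "(\<lambda>\<omega>. X k \<omega> I) \<in> M \<rightarrow>\<^sub>M MX I"
  by (rule measurable_compose[OF X_measurable obs_at_measurable])

lemma sets_carrier_prod: "sets (carrier_prod n I) = sets (\<Pi>\<^sub>M k\<in>{..<n}. MX I)"
  by (intro sets_PiM_cong refl E.sets_obs_carrier)

lemma obs_at_in_PiM: "obs_at n I \<in> M \<rightarrow>\<^sub>M (\<Pi>\<^sub>M k\<in>{..<n}. MX I)"
  unfolding obs_at_def by (intro measurable_restrict X_at_measurable)

lemma sets_joint:
  "sets (par_carrier (E I) \<Otimes>\<^sub>M (carrier_prod n I \<Otimes>\<^sub>M LY)) =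
   sets (MT I \<Otimes>\<^sub>M ((\<Pi>\<^sub>M k\<in>{..<n}. MX I) \<Otimes>\<^sub>M BY))"
  by (intro sets_pair_measure_cong sets_carrier_prod E.sets_par_carrier sets_distr)

lemma joint_dens_measurable:
  "joint_dens n I \<in> borel_measurable (par_carrier (E I) \<Otimes>\<^sub>M (carrier_prod n I \<Otimes>\<^sub>M LY))"
proof -
  let ?Z = "MT I \<Otimes>\<^sub>M ((\<Pi>\<^sub>M k\<in>{..<n}. MX I) \<Otimes>\<^sub>M BY)"
  have y: "(\<lambda>z. hyper_at I (snd (snd z))) \<in> ?Z \<rightarrow>\<^sub>M MY I"
    by (rule measurable_compose[OF _ hyper_at_measurable]) measurable
  have "(\<lambda>z. E.lik I (fst (snd z) k) (fst z)) \<in> borel_measurable ?Z" if k: "k \<in> {..<n}" for k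
  proof (rule E.lik_measurable)
    have "(\<lambda>x. x k) \<in> (\<Pi>\<^sub>M k\<in>{..<n}. MX I) \<rightarrow>\<^sub>M MX I" using k by measurable
    from measurable_compose[OF measurable_fst this]
    have "(\<lambda>z. fst z k) \<in> (\<Pi>\<^sub>M k\<in>{..<n}. MX I) \<Otimes>\<^sub>M BY \<rightarrow>\<^sub>M MX I" .
    from measurable_compose[OF measurable_snd this]
    show "(\<lambda>z. fst (snd z) k) \<in> ?Z \<rightarrow>\<^sub>M MX I" .
  qed measurable
  then have "joint_dens n I \<in> borel_measurable ?Z"
    unfolding joint_dens_def
    by (intro borel_measurable_times_ennreal borel_measurable_prod_ennreal E.prior_dens_measurable[OF measurable_fst y])
  then show ?thesis using measurable_cong_sets[OF sets_joint refl] by blast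
qed

text \<open>
  All of parameter, data and hyperparameter are taken at once, so that Bayes' formula applies to the
  parameter as one component and to the pair of data and hyperparameter as the other.
\<close>

lemma joint_law:
  "distr M (par_carrier (E I) \<Otimes>\<^sub>M (carrier_prod n I \<Otimes>\<^sub>M LY)) (\<lambda>\<omega>. (\<Theta> \<omega> I, (obs_at n I \<omega>, Y \<omega>))) =
   density (par_carrier (E I) \<Otimes>\<^sub>M (carrier_prod n I \<Otimes>\<^sub>M LY)) (joint_dens n I)"
proof -
  let ?V = "carrier_prod n I \<Otimes>\<^sub>M LY"
  let ?N = "par_carrier (E I) \<Otimes>\<^sub>M ?V"
  let ?W = "\<lambda>\<omega>. (\<Theta> \<omega> I, (obs_at n I \<omega>, Y \<omega>))"
  let ?B = "{Pi\<^sub>E {..<n} C \<times> D | C D. (\<forall>k\<in>{..<n}. C k \<in> sets (obs_carrier (E I))) \<and> D \<in> sets LY}"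
  interpret LY: prob_space LY by (rule prob_space_distr[OF Y_measurable])
  interpret cp: sigma_finite_measure "carrier_prod n I" by (rule E.obs_prod.sigma_finite) simp
  interpret VP: pair_sigma_finite "carrier_prod n I" LY ..
  note dens[measurable] = joint_dens_measurable[of n I]
  have W: "?W \<in> M \<rightarrow>\<^sub>M ?N"
    unfolding measurable_cong_sets[OF refl sets_joint]
    by (intro measurable_Pair \<Theta>_at_measurable obs_at_in_PiM Y_measurable)
  show ?thesis
  proof (rule measure_eqI_rectangles[where \<A>="sets (par_carrier (E I))" and \<B>="?B"])
    show "finite_measure (distr M ?N ?W)"
      using prob_space_distr[OF W] by (simp add: prob_space_def)
    fix B b assume B: "B \<in> sets (par_carrier (E I))" and "b \<in> ?B"
    then obtain C D where b: "b = Pi\<^sub>E {..<n} C \<times> D" and C: "\<And>k. k < n \<Longrightarrow> C k \<in> sets (MX I)"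
      and D[measurable]: "D \<in> sets BY" by (auto simp: E.sets_obs_carrier)
    have B'[measurable]: "B \<in> sets (MT I)" using B by (simp add: E.sets_par_carrier)
    have C': "Pi\<^sub>E {..<n} C \<in> sets (carrier_prod n I)"
      unfolding sets_carrier_prod using C by (intro sets_PiM_I_finite) auto
    then have b'[measurable]: "b \<in> sets ?V" unfolding b using D by (intro pair_measureI) auto
    let ?G = "{z\<in>space (BT \<Otimes>\<^sub>M BY). fst z I \<in> B \<and> snd z \<in> D}"
    have G: "?G \<in> sets (BT \<Otimes>\<^sub>M BY)"
    proof -
      have "(\<lambda>z. fst z I) \<in> BT \<Otimes>\<^sub>M BY \<rightarrow>\<^sub>M MT I"
        by (rule measurable_compose[OF measurable_fst par_at_measurable])
      then show ?thesis by measurable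
    qed
    let ?F = "\<lambda>t. indicator B t * (\<Prod>k<n. emeasure (model (E I) t) (C k)) :: ennreal"
    have F: "?F \<in> borel_measurable (MT I)"
      using emeasure_prob_kernel_measurable[OF E.model_measurable C]
      by (intro borel_measurable_times_ennreal borel_measurable_prod_ennreal) auto
    have "emeasure (distr M ?N ?W) (B \<times> b) =
        emeasure M {\<omega>\<in>space M. (\<forall>k<n. X k \<omega> I \<in> C k) \<and> (\<Theta> \<omega>, Y \<omega>) \<in> ?G}"
      using B b' W measurable_space[OF \<Theta>_measurable] measurable_space[OF Y_measurable]
      by (subst emeasure_distr)
        (auto intro!: arg_cong[where f="emeasure M"] simp: b obs_at_def PiE_iff space_pair_measure)
    also have "\<dots> = (\<integral>\<^sup>+\<omega>. indicator ?G (\<Theta> \<omega>, Y \<omega>) * (\<Prod>k<n. emeasure (model (E I) (\<Theta> \<omega> I)) (C k)) \<partial>M)"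
      by (rule law_obs_at[OF C G])
    also have "\<dots> = (\<integral>\<^sup>+\<omega>. ?F (\<Theta> \<omega> I) * indicator D (Y \<omega>) \<partial>M)"
      using measurable_space[OF \<Theta>_measurable] measurable_space[OF Y_measurable]
      by (intro nn_integral_cong) (auto simp: indicator_def space_pair_measure)
    also have "\<dots> = (\<integral>\<^sup>+t. ?F t * (\<integral>\<^sup>+\<omega>. indicator D (Y \<omega>) * E.prior_dens I t (hyper_at I (Y \<omega>)) \<partial>M) \<partial>par_carrier (E I))"
      by (rule law_par_at[OF F D])
    also have "\<dots> = (\<integral>\<^sup>+t. (\<integral>\<^sup>+v. joint_dens n I (t, v) * indicator (B \<times> b) (t, v) \<partial>?V) \<partial>par_carrier (E I))"
    proof (rule nn_integral_cong)
      fix t assume t: "t \<in> space (par_carrier (E I))"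
      then have t': "t \<in> par_set (E I)" by (simp add: E.space_par_carrier)
      let ?r = "\<lambda>y. indicator D y * E.prior_dens I t (hyper_at I y)"
      have r: "?r \<in> borel_measurable BY"
        by (intro borel_measurable_times_ennreal borel_measurable_indicator D
            E.prior_dens_measurable[OF E.measurable_par[OF t'] hyper_at_measurable])
      have "(\<lambda>v. (t, v)) \<in> ?V \<rightarrow>\<^sub>M ?N" using t by (rule measurable_Pair1')
      from measurable_compose[OF this dens]
      have dt: "(\<lambda>v. joint_dens n I (t, v)) \<in> borel_measurable ?V" .
      let ?l = "\<lambda>x. (\<Prod>k<n. E.lik I (x k) t) * indicator (Pi\<^sub>E {..<n} C) x"
      have l: "?l \<in> borel_measurable (carrier_prod n I)"
      proof -
        have "(\<lambda>x. E.lik I (x k) t) \<in> borel_measurable (\<Pi>\<^sub>M k\<in>{..<n}. MX I)" if "k \<in> {..<n}" for k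
          using that by (intro E.lik_measurable E.measurable_par[OF t'] measurable_component_singleton)
        then have "(\<lambda>x. E.lik I (x k) t) \<in> borel_measurable (carrier_prod n I)" if "k \<in> {..<n}" for k
          using that measurable_cong_sets[OF sets_carrier_prod refl] by blast
        then show ?thesis
          using C' by (intro borel_measurable_times_ennreal borel_measurable_prod_ennreal borel_measurable_indicator)
      qed
      have "(\<integral>\<^sup>+v. joint_dens n I (t, v) * indicator (B \<times> b) (t, v) \<partial>?V) =
          (\<integral>\<^sup>+x. (\<integral>\<^sup>+y. joint_dens n I (t, (x, y)) * indicator (B \<times> b) (t, (x, y)) \<partial>LY) \<partial>carrier_prod n I)"
      proof (rule LY.nn_integral_fst[symmetric])
        have "(\<lambda>v. indicator (B \<times> b) (t, v) :: ennreal) = (\<lambda>v. indicator B t * indicator b v)"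
          by (auto simp: indicator_def)
        then show "(\<lambda>v. joint_dens n I (t, v) * indicator (B \<times> b) (t, v)) \<in> borel_measurable ?V"
          using dt b' by simp
      qed
      also have "\<dots> = (\<integral>\<^sup>+x. (\<integral>\<^sup>+y. (indicator B t * ?l x) * ?r y \<partial>LY) \<partial>carrier_prod n I)"
        by (intro nn_integral_cong) (auto simp: joint_dens_def b indicator_def mult_ac)
      also have "\<dots> = (\<integral>\<^sup>+x. (indicator B t * ?l x) * (\<integral>\<^sup>+\<omega>. ?r (Y \<omega>) \<partial>M) \<partial>carrier_prod n I)"
        using r by (intro nn_integral_cong) (simp add: nn_integral_cmult nn_integral_distr)
      also have "\<dots> = indicator B t * (\<integral>\<^sup>+x. ?l x \<partial>carrier_prod n I) * (\<integral>\<^sup>+\<omega>. ?r (Y \<omega>) \<partial>M)"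
        using l by (simp add: nn_integral_multc nn_integral_cmult)
      also have "(\<integral>\<^sup>+x. ?l x \<partial>carrier_prod n I) = (\<Prod>k<n. emeasure (model (E I) t) (C k))"
        by (rule E.model_prod[OF t' C, symmetric])
      finally show "?F t * (\<integral>\<^sup>+\<omega>. ?r (Y \<omega>) \<partial>M) =
          (\<integral>\<^sup>+v. joint_dens n I (t, v) * indicator (B \<times> b) (t, v) \<partial>?V)" by simp
    qed
    also have "\<dots> = (\<integral>\<^sup>+z. joint_dens n I z * indicator (B \<times> b) z \<partial>?N)"
      using B b' by (intro VP.P.nn_integral_fst) measurable
    also have "\<dots> = emeasure (density ?N (joint_dens n I)) (B \<times> b)"
      using B b' by (subst emeasure_density) auto
    finally show "emeasure (distr M ?N ?W) (B \<times> b) = emeasure (density ?N (joint_dens n I)) (B \<times> b)" .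
  qed (rule sets_distr sets_density sets.Int_stable sets.space_closed sets.top sets.sigma_sets_eq[symmetric]
      rectangles_PiM_pair[OF finite_lessThan])+
qed

end

section \<open>The posterior in the projective limit\<close>

context projective_limit_bayes
begin

definition obs :: "nat \<Rightarrow> 'w \<Rightarrow> nat \<Rightarrow> ('i \<Rightarrow> 'x)" where
  "obs n \<omega> = (\<lambda>k\<in>{..<n}. X k \<omega>)"

definition index :: "nat \<Rightarrow> 'w \<Rightarrow> real \<times> ('i \<Rightarrow> 'u)" where
  "index n \<omega> = update_index (limit_stat E) n (obs n \<omega>) (Y \<omega>)"

abbreviation "obs_prod n \<equiv> (\<Pi>\<^sub>M k\<in>{..<n}. BX)"

abbreviation "obs_prod_at n I \<equiv> (\<Pi>\<^sub>M k\<in>{..<n}. MX I)"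

lemma obs_measurable [measurable]: "obs n \<in> M \<rightarrow>\<^sub>M obs_prod n"
  unfolding obs_def by measurable

lemma update_index_joint_measurable:
  "(\<lambda>(x, y). update_index (limit_stat E) n x y) \<in> obs_prod n \<Otimes>\<^sub>M BY \<rightarrow>\<^sub>M BY"
proof -
  have "(\<lambda>z. update_index (limit_stat E) n (fst z) (snd z)) \<in> obs_prod n \<Otimes>\<^sub>M BY \<rightarrow>\<^sub>M BY"
  proof (rule update_index_measurable)
    fix k assume "k < n"
    then have "(\<lambda>x. x k) \<in> obs_prod n \<rightarrow>\<^sub>M BX" by (intro measurable_component_singleton) simp
    from measurable_compose[OF measurable_fst this]
    show "(\<lambda>z. fst z k) \<in> obs_prod n \<Otimes>\<^sub>M BY \<rightarrow>\<^sub>M BX" .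
  qed measurable
  then show ?thesis by (simp add: case_prod_beta')
qed

lemma index_measurable [measurable]: "index n \<in> M \<rightarrow>\<^sub>M BY"
  unfolding index_def using measurable_compose[OF measurable_Pair[OF obs_measurable Y_measurable] update_index_joint_measurable]
  by simp

lemma hyper_at_index: "hyper_at I (index n \<omega>) = E.update I n (obs_at n I \<omega>) (hyper_at I (Y \<omega>))"
  unfolding index_def hyper_at_update_index
  by (rule E.update_cong) (simp add: obs_def obs_at_def)

lemma sigma_finite_carrier_pair: "sigma_finite_measure (carrier_prod n I \<Otimes>\<^sub>M LY)"
proof -
  interpret LY: prob_space LY by (rule prob_space_distr[OF Y_measurable])
  interpret cp: sigma_finite_measure "carrier_prod n I" by (rule E.obs_prod.sigma_finite) simp
  interpret VP: pair_sigma_finite "carrier_prod n I" LY ..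
  show ?thesis by (rule VP.P.sigma_finite_measure_axioms)
qed

lemma sets_carrier_pair: "sets (carrier_prod n I \<Otimes>\<^sub>M LY) = sets (obs_prod_at n I \<Otimes>\<^sub>M BY)"
  by (intro sets_pair_measure_cong sets_carrier_prod sets_distr)

lemma evidence_eq:
  "(\<integral>\<^sup>+t. joint_dens n I (t, (x, y)) \<partial>par_carrier (E I)) = E.evidence I n x (hyper_at I y)"
  by (simp add: joint_dens_def E.evidence_def)

lemma \<Theta>_at_carrier: "(\<lambda>\<omega>. \<Theta> \<omega> I) \<in> M \<rightarrow>\<^sub>M par_carrier (E I)"
  using \<Theta>_at_measurable measurable_cong_sets[OF refl E.sets_par_carrier] by blast

lemma obs_at_carrier: "(\<lambda>\<omega>. (obs_at n I \<omega>, Y \<omega>)) \<in> M \<rightarrow>\<^sub>M carrier_prod n I \<Otimes>\<^sub>M LY"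
  using measurable_Pair[OF obs_at_in_PiM Y_measurable] measurable_cong_sets[OF refl sets_carrier_pair] by blast

lemma evidence_bounds:
  "AE \<omega> in M. 0 < E.evidence I n (obs_at n I \<omega>) (hyper_at I (Y \<omega>)) \<and>
     E.evidence I n (obs_at n I \<omega>) (hyper_at I (Y \<omega>)) < \<infinity>"
  using bayes_density(1)[OF prob_space_axioms E.par.sigma_finite_measure_axioms sigma_finite_carrier_pair
      \<Theta>_at_carrier obs_at_carrier joint_dens_measurable joint_law]
  unfolding evidence_eq .

lemma obs_at_space: "\<omega> \<in> space M \<Longrightarrow> k < n \<Longrightarrow> obs_at n I \<omega> k \<in> topspace (obs_top (E I))"
  using measurable_space[OF X_at_measurable] by (simp add: obs_at_def)

text \<open>
  The index type is countable, so the exceptional null sets of the single indices have a null union.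
\<close>

lemma index_canonical: "AE \<omega> in M. index n \<omega> \<in> limit_canonical_hyper E h"
proof -
  have "AE \<omega> in M. \<forall>I. 0 < E.evidence I n (obs_at n I \<omega>) (hyper_at I (Y \<omega>)) \<and>
     E.evidence I n (obs_at n I \<omega>) (hyper_at I (Y \<omega>)) < \<infinity>"
    unfolding AE_all_countable using evidence_bounds by blast
  then show ?thesis
    using canonical AE_space
  proof eventually_elim
    fix \<omega> assume ev: "\<forall>I. 0 < E.evidence I n (obs_at n I \<omega>) (hyper_at I (Y \<omega>)) \<and>
       E.evidence I n (obs_at n I \<omega>) (hyper_at I (Y \<omega>)) < \<infinity>"
      and y: "Y \<omega> \<in> limit_canonical_hyper E h" and \<omega>: "\<omega> \<in> space M"
    show "index n \<omega> \<in> limit_canonical_hyper E h"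
    proof (rule limit_canonical_hyperI)
      show "index n \<omega> \<in> space BY" by (rule measurable_space[OF index_measurable \<omega>])
      show "hyper_at I (index n \<omega>) \<in> canonical_hyper (E I)" for I
        unfolding hyper_at_index
        using ev obs_at_space[OF \<omega>] by (intro E.bayes_canonical(1)[OF limit_canonical_hyperD[OF y]]) auto
    qed
  qed
qed

lemma posterior_at:
  assumes B: "B \<in> sets (MT I)" and C: "C \<in> sets (obs_prod_at n I \<Otimes>\<^sub>M BY)"
  shows "emeasure M {\<omega>\<in>space M. \<Theta> \<omega> I \<in> B \<and> (obs_at n I \<omega>, Y \<omega>) \<in> C} =
    (\<integral>\<^sup>+\<omega>. indicator C (obs_at n I \<omega>, Y \<omega>) *
       emeasure (Q (index n \<omega>)) ((\<lambda>\<theta>. \<theta> I) -` B \<inter> space BT) \<partial>M)"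
proof -
  have B': "B \<in> sets (par_carrier (E I))" and C': "C \<in> sets (carrier_prod n I \<Otimes>\<^sub>M LY)"
    using B C by (simp_all add: E.sets_par_carrier sets_carrier_pair)
  have "emeasure M {\<omega>\<in>space M. \<Theta> \<omega> I \<in> B \<and> (obs_at n I \<omega>, Y \<omega>) \<in> C} =
    (\<integral>\<^sup>+\<omega>. indicator C (obs_at n I \<omega>, Y \<omega>) *
      ((\<integral>\<^sup>+t. joint_dens n I (t, (obs_at n I \<omega>, Y \<omega>)) * indicator B t \<partial>par_carrier (E I))
        / E.evidence I n (obs_at n I \<omega>) (hyper_at I (Y \<omega>))) \<partial>M)"
    using bayes_density(2)[OF prob_space_axioms E.par.sigma_finite_measure_axioms sigma_finite_carrier_pair
      \<Theta>_at_carrier obs_at_carrier joint_dens_measurable joint_law B' C']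
    unfolding evidence_eq .
  also have "\<dots> = (\<integral>\<^sup>+\<omega>. indicator C (obs_at n I \<omega>, Y \<omega>) *
       emeasure (Q (index n \<omega>)) ((\<lambda>\<theta>. \<theta> I) -` B \<inter> space BT) \<partial>M)"
  proof (rule nn_integral_cong_AE)
    show "AE \<omega> in M. indicator C (obs_at n I \<omega>, Y \<omega>) *
      ((\<integral>\<^sup>+t. joint_dens n I (t, (obs_at n I \<omega>, Y \<omega>)) * indicator B t \<partial>par_carrier (E I))
        / E.evidence I n (obs_at n I \<omega>) (hyper_at I (Y \<omega>))) =
      indicator C (obs_at n I \<omega>, Y \<omega>) * emeasure (Q (index n \<omega>)) ((\<lambda>\<theta>. \<theta> I) -` B \<inter> space BT)"
      using evidence_bounds[of I n] canonical index_canonical[of n] AE_space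
    proof eventually_elim
      fix \<omega> assume ev: "0 < E.evidence I n (obs_at n I \<omega>) (hyper_at I (Y \<omega>)) \<and>
         E.evidence I n (obs_at n I \<omega>) (hyper_at I (Y \<omega>)) < \<infinity>"
        and y: "Y \<omega> \<in> limit_canonical_hyper E h" and i: "index n \<omega> \<in> limit_canonical_hyper E h"
        and \<omega>: "\<omega> \<in> space M"
      have "(\<integral>\<^sup>+t. joint_dens n I (t, (obs_at n I \<omega>, Y \<omega>)) * indicator B t \<partial>par_carrier (E I))
        / E.evidence I n (obs_at n I \<omega>) (hyper_at I (Y \<omega>)) =
        emeasure (prior (E I) (E.update I n (obs_at n I \<omega>) (hyper_at I (Y \<omega>)))) B"
        unfolding joint_dens_def fst_conv snd_conv
        using ev obs_at_space[OF \<omega>] B by (intro E.bayes_canonical(2)[OF limit_canonical_hyperD[OF y]]) auto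
      also have "\<dots> = emeasure (Q (index n \<omega>)) ((\<lambda>\<theta>. \<theta> I) -` B \<inter> space BT)"
        unfolding prior_at[OF i B] hyper_at_index ..
      finally show "indicator C (obs_at n I \<omega>, Y \<omega>) *
        ((\<integral>\<^sup>+t. joint_dens n I (t, (obs_at n I \<omega>, Y \<omega>)) * indicator B t \<partial>par_carrier (E I))
          / E.evidence I n (obs_at n I \<omega>) (hyper_at I (Y \<omega>))) =
        indicator C (obs_at n I \<omega>, Y \<omega>) * emeasure (Q (index n \<omega>)) ((\<lambda>\<theta>. \<theta> I) -` B \<inter> space BT)" by simp
    qed
  qed
  finally show ?thesis .
qed

definition proj_at :: "nat \<Rightarrow> 'i \<Rightarrow> ('i \<Rightarrow> 'u) \<times> ((nat \<Rightarrow> 'i \<Rightarrow> 'x) \<times> (real \<times> ('i \<Rightarrow> 'u))) \<Rightarrow>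
    'u \<times> ((nat \<Rightarrow> 'x) \<times> (real \<times> ('i \<Rightarrow> 'u)))" where
  "proj_at n K = (\<lambda>(\<theta>, (x, y)). (\<theta> K, (\<lambda>k\<in>{..<n}. x k K, y)))"

lemma obs_proj_measurable: "(\<lambda>x. \<lambda>k\<in>{..<n}. x k K) \<in> obs_prod n \<rightarrow>\<^sub>M obs_prod_at n K"
proof (rule measurable_restrict)
  fix k assume "k \<in> {..<n}"
  then have "(\<lambda>x. x k) \<in> obs_prod n \<rightarrow>\<^sub>M BX" by measurable
  from measurable_compose[OF this obs_at_measurable] show "(\<lambda>x. x k K) \<in> obs_prod n \<rightarrow>\<^sub>M MX K" .
qed

lemma proj_at_measurable:
  "proj_at n K \<in> BT \<Otimes>\<^sub>M (obs_prod n \<Otimes>\<^sub>M BY) \<rightarrow>\<^sub>M MT K \<Otimes>\<^sub>M (obs_prod_at n K \<Otimes>\<^sub>M BY)"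
  unfolding proj_at_def case_prod_beta
  by (intro measurable_Pair measurable_compose[OF measurable_fst par_at_measurable]
      measurable_compose[OF measurable_snd measurable_compose[OF measurable_fst obs_proj_measurable]]
      measurable_compose[OF measurable_snd measurable_snd])

text \<open>
  It suffices that the identity is measurable from the \<open>\<sigma>\<close>-algebra generated by the projections, and
  this can be checked coordinate by coordinate.
\<close>

lemma sets_joint_generated:
  "sets (BT \<Otimes>\<^sub>M (obs_prod n \<Otimes>\<^sub>M BY)) \<subseteq> sigma_sets (space (BT \<Otimes>\<^sub>M (obs_prod n \<Otimes>\<^sub>M BY)))
     (\<Union>K. {proj_at n K -` B \<inter> space (BT \<Otimes>\<^sub>M (obs_prod n \<Otimes>\<^sub>M BY)) | B.
        B \<in> sets (MT K \<Otimes>\<^sub>M (obs_prod_at n K \<Otimes>\<^sub>M BY))})"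
    (is "sets ?Z \<subseteq> sigma_sets _ ?G")
proof
  let ?S = "sigma (space ?Z) ?G"
  have G: "?G \<subseteq> Pow (space ?Z)" by blast
  have sp: "space ?S = space ?Z" using G by (rule space_measure_of)
  have p: "proj_at n K \<in> ?S \<rightarrow>\<^sub>M MT K \<Otimes>\<^sub>M (obs_prod_at n K \<Otimes>\<^sub>M BY)" for K
  proof (rule measurableI)
    show "proj_at n K z \<in> space (MT K \<Otimes>\<^sub>M (obs_prod_at n K \<Otimes>\<^sub>M BY))" if "z \<in> space ?S" for z
      using measurable_space[OF proj_at_measurable] that unfolding sp by blast
    show "proj_at n K -` B \<inter> space ?S \<in> sets ?S"
      if "B \<in> sets (MT K \<Otimes>\<^sub>M (obs_prod_at n K \<Otimes>\<^sub>M BY))" for B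
      unfolding sp sets_measure_of[OF G] using that by (intro sigma_sets.Basic) blast
  qed
  have inZ: "fst z \<in> space BT" "fst (snd z) \<in> space (obs_prod n)" "snd (snd z) \<in> space BY"
    if "z \<in> space ?S" for z using that unfolding sp by (auto simp: space_pair_measure)
  have "(\<lambda>z. (fst z, (fst (snd z), snd (snd z)))) \<in> ?S \<rightarrow>\<^sub>M ?Z"
  proof (intro measurable_Pair)
    show "fst \<in> ?S \<rightarrow>\<^sub>M BT"
    proof (rule measurable_into_BT)
      show "(\<lambda>z. fst z I) \<in> ?S \<rightarrow>\<^sub>M MT I" for I
        using measurable_compose[OF p measurable_fst, of I] by (simp add: proj_at_def case_prod_beta)
    qed (rule inZ)
    show "(\<lambda>z. snd (snd z)) \<in> ?S \<rightarrow>\<^sub>M BY"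
      using measurable_compose[OF p measurable_compose[OF measurable_snd measurable_snd]]
      by (simp add: proj_at_def case_prod_beta)
    show "(\<lambda>z. fst (snd z)) \<in> ?S \<rightarrow>\<^sub>M obs_prod n"
    proof (rule measurable_PiM_single')
      show "(\<lambda>z. fst (snd z)) \<in> space ?S \<rightarrow> (\<Pi>\<^sub>E i\<in>{..<n}. space BX)"
        using inZ(2) unfolding space_PiM by (rule Pi_I)
      fix k assume k: "k \<in> {..<n}"
      show "(\<lambda>z. fst (snd z) k) \<in> ?S \<rightarrow>\<^sub>M BX"
      proof (rule measurable_into_BX)
        show "fst (snd z) k \<in> space BX" if "z \<in> space ?S" for z
          using inZ(2)[OF that] k unfolding space_PiM by (rule PiE_mem)
        fix I
        have "(\<lambda>x. x k) \<in> obs_prod_at n I \<rightarrow>\<^sub>M MX I" using k by measurable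
        from measurable_compose[OF p measurable_compose[OF measurable_snd measurable_compose[OF measurable_fst this]]]
        show "(\<lambda>z. fst (snd z) k I) \<in> ?S \<rightarrow>\<^sub>M MX I"
          using k by (simp add: proj_at_def case_prod_beta)
      qed
    qed
  qed
  then have id: "(\<lambda>z. z) \<in> ?S \<rightarrow>\<^sub>M ?Z" by simp
  fix A assume A: "A \<in> sets ?Z"
  have "(\<lambda>z. z) -` A \<inter> space ?S = A" unfolding sp using sets.sets_into_space[OF A] by auto
  with measurable_sets[OF id A] show "A \<in> sigma_sets (space ?Z) ?G"
    unfolding sets_measure_of[OF G] by simp
qed

text \<open>
  The measure \<open>\<nu>\<close> is the joint law in which the parameter is redrawn from the prior at the updated
  hyperparameter.  By \<open>posterior_at\<close> it has the same image as the actual joint law \<open>\<mu>\<close> at each index.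
\<close>

lemma posterior:
  assumes A: "A \<in> sets BT" and C: "C \<in> sets (obs_prod n \<Otimes>\<^sub>M BY)"
  shows "emeasure M {\<omega>\<in>space M. \<Theta> \<omega> \<in> A \<and> (obs n \<omega>, Y \<omega>) \<in> C} =
    (\<integral>\<^sup>+\<omega>. indicator C (obs n \<omega>, Y \<omega>) * emeasure (Q (index n \<omega>)) A \<partial>M)"
proof -
  let ?V = "obs_prod n \<Otimes>\<^sub>M BY"
  let ?Z = "BT \<Otimes>\<^sub>M ?V"
  let ?N = "\<lambda>K. MT K \<Otimes>\<^sub>M (obs_prod_at n K \<Otimes>\<^sub>M BY)"
  have V[measurable]: "(\<lambda>\<omega>. (obs n \<omega>, Y \<omega>)) \<in> M \<rightarrow>\<^sub>M ?V" by measurable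
  define \<kappa> where "\<kappa> \<omega> = distr (Q (index n \<omega>)) ?Z (\<lambda>\<theta>. (\<theta>, (obs n \<omega>, Y \<omega>)))" for \<omega>
  define \<mu> where "\<mu> = distr M ?Z (\<lambda>\<omega>. (\<Theta> \<omega>, (obs n \<omega>, Y \<omega>)))"
  define \<nu> where "\<nu> = M \<bind> \<kappa>"
  have W: "(\<lambda>\<omega>. (\<Theta> \<omega>, (obs n \<omega>, Y \<omega>))) \<in> M \<rightarrow>\<^sub>M ?Z" by measurable
  have Qi: "(\<lambda>\<omega>. Q (index n \<omega>)) \<in> M \<rightarrow>\<^sub>M subprob_algebra BT"
    by (intro measurable_prob_algebraD measurable_compose[OF index_measurable Q_measurable])
  have \<kappa>: "\<kappa> \<in> M \<rightarrow>\<^sub>M subprob_algebra ?Z"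
    unfolding \<kappa>_def
  proof (rule measurable_distr2[OF _ Qi])
    have "(\<lambda>z. (snd z, (obs n (fst z), Y (fst z)))) \<in> M \<Otimes>\<^sub>M BT \<rightarrow>\<^sub>M ?Z" by measurable
    then show "(\<lambda>(\<omega>, \<theta>). (\<theta>, (obs n \<omega>, Y \<omega>))) \<in> M \<Otimes>\<^sub>M BT \<rightarrow>\<^sub>M ?Z" by (simp add: case_prod_beta')
  qed
  have \<kappa>_rect: "emeasure (\<kappa> \<omega>) (A \<times> C) = indicator C (obs n \<omega>, Y \<omega>) * emeasure (Q (index n \<omega>)) A"
    if \<omega>: "\<omega> \<in> space M" and A: "A \<in> sets BT" and C: "C \<in> sets ?V" for \<omega> A C
  proof -
    have s: "sets (Q (index n \<omega>)) = sets BT" by (rule Q_prob(2)[OF measurable_space[OF index_measurable \<omega>]])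
    have "(\<lambda>\<theta>. (\<theta>, (obs n \<omega>, Y \<omega>))) \<in> BT \<rightarrow>\<^sub>M ?Z"
      using measurable_space[OF V \<omega>] by (rule measurable_Pair2')
    then have m: "(\<lambda>\<theta>. (\<theta>, (obs n \<omega>, Y \<omega>))) \<in> Q (index n \<omega>) \<rightarrow>\<^sub>M ?Z"
      using measurable_cong_sets[OF s refl] by blast
    have "(\<lambda>\<theta>. (\<theta>, (obs n \<omega>, Y \<omega>))) -` (A \<times> C) \<inter> space (Q (index n \<omega>)) =
        (if (obs n \<omega>, Y \<omega>) \<in> C then A else {})"
      using sets.sets_into_space[OF A] sets_eq_imp_space_eq[OF s] by auto
    then show ?thesis
      unfolding \<kappa>_def using A C by (subst emeasure_distr[OF m]) auto
  qed
  have ne: "space M \<noteq> {}" by (rule not_empty)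
  have sets_\<nu>: "sets \<nu> = sets ?Z" unfolding \<nu>_def by (rule sets_bind[OF sets_kernel[OF \<kappa>] ne])
  have sets_\<mu>: "sets \<mu> = sets ?Z" by (simp add: \<mu>_def)
  have \<nu>_eq: "emeasure \<nu> (A \<times> C) = (\<integral>\<^sup>+\<omega>. indicator C (obs n \<omega>, Y \<omega>) * emeasure (Q (index n \<omega>)) A \<partial>M)"
    if "A \<in> sets BT" "C \<in> sets ?V" for A C
  proof -
    have "emeasure \<nu> (A \<times> C) = (\<integral>\<^sup>+\<omega>. emeasure (\<kappa> \<omega>) (A \<times> C) \<partial>M)"
      unfolding \<nu>_def using that by (intro emeasure_bind[OF ne \<kappa>]) simp
    also have "\<dots> = (\<integral>\<^sup>+\<omega>. indicator C (obs n \<omega>, Y \<omega>) * emeasure (Q (index n \<omega>)) A \<partial>M)"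
      using \<kappa>_rect that by (intro nn_integral_cong) simp
    finally show ?thesis .
  qed
  have \<mu>_eq: "emeasure \<mu> (A \<times> C) = emeasure M {\<omega>\<in>space M. \<Theta> \<omega> \<in> A \<and> (obs n \<omega>, Y \<omega>) \<in> C}"
    if "A \<in> sets BT" "C \<in> sets ?V" for A C
    unfolding \<mu>_def using that
    by (subst emeasure_distr[OF W]) (auto intro!: arg_cong[where f="emeasure M"])
  have fin: "finite_measure \<mu>"
    using prob_space_distr[OF W] by (simp add: prob_space_def \<mu>_def)
  have "\<mu> = \<nu>"
  proof (rule measure_eqI_directed_marginals[OF fin sets_\<mu> sets_\<nu> directed proj_at_measurable _ _ sets_joint_generated])
    fix I K :: 'i assume IK: "I \<le> K"
    let ?q = "\<lambda>z. (g K I (fst z), (\<lambda>k\<in>{..<n}. f K I (fst (snd z) k), snd (snd z)))"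
    have "(\<lambda>z. \<lambda>k\<in>{..<n}. f K I (fst (snd z) k)) \<in> ?N K \<rightarrow>\<^sub>M obs_prod_at n I"
    proof (rule measurable_restrict)
      fix k assume "k \<in> {..<n}"
      then have "(\<lambda>x. x k) \<in> obs_prod_at n K \<rightarrow>\<^sub>M MX K" by measurable
      from measurable_compose[OF measurable_snd measurable_compose[OF measurable_fst
            measurable_compose[OF this obs_connect_measurable[OF IK]]]]
      show "(\<lambda>z. f K I (fst (snd z) k)) \<in> ?N K \<rightarrow>\<^sub>M MX I" .
    qed
    then show "(\<lambda>K I z. (g K I (fst z), (\<lambda>k\<in>{..<n}. f K I (fst (snd z) k), snd (snd z)))) K I \<in> ?N K \<rightarrow>\<^sub>M ?N I"
      by (intro measurable_Pair measurable_compose[OF measurable_fst par_connect_measurable[OF IK]]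
          measurable_compose[OF measurable_snd measurable_snd])
    fix z assume z: "z \<in> space ?Z"
    then have z1: "fst z \<in> space BT" and z2: "fst (snd z) \<in> space (obs_prod n)"
      by (simp_all only: space_pair_measure mem_Times_iff)
    have zk: "fst (snd z) k \<in> space BX" if "k \<in> {..<n}" for k
      using z2 that unfolding space_PiM by (rule PiE_mem)
    have "(\<lambda>k\<in>{..<n}. fst (snd z) k I) = (\<lambda>k\<in>{..<n}. f K I ((\<lambda>k\<in>{..<n}. fst (snd z) k K) k))"
      by (rule restrict_ext) (subst obs_limitD(2)[OF zk IK], assumption, simp)
    then show "proj_at n I z = (\<lambda>K I z. (g K I (fst z), (\<lambda>k\<in>{..<n}. f K I (fst (snd z) k), snd (snd z)))) K I (proj_at n K z)"
      using par_limitD(2)[OF z1 IK] by (simp only: proj_at_def case_prod_beta fst_conv snd_conv)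
  next
    fix K B assume B: "B \<in> sets (?N K)"
    have p\<mu>: "proj_at n K \<in> \<mu> \<rightarrow>\<^sub>M ?N K" and p\<nu>: "proj_at n K \<in> \<nu> \<rightarrow>\<^sub>M ?N K"
      using proj_at_measurable measurable_cong_sets[OF sets_\<mu> refl] measurable_cong_sets[OF sets_\<nu> refl] by blast+
    have "distr \<mu> (?N K) (proj_at n K) = distr \<nu> (?N K) (proj_at n K)"
    proof (rule measure_eqI_rectangles[where \<A>="sets (MT K)" and \<B>="sets (obs_prod_at n K \<Otimes>\<^sub>M BY)"])
      show "finite_measure (distr \<mu> (?N K) (proj_at n K))"
        by (rule finite_measure.finite_measure_distr[OF fin p\<mu>])
      fix b c assume b: "b \<in> sets (MT K)" and c: "c \<in> sets (obs_prod_at n K \<Otimes>\<^sub>M BY)"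
      let ?A = "(\<lambda>\<theta>. \<theta> K) -` b \<inter> space BT"
      let ?pv = "\<lambda>v. (\<lambda>k\<in>{..<n}. fst v k K, snd v)"
      let ?C = "?pv -` c \<inter> space ?V"
      have A: "?A \<in> sets BT" by (rule measurable_sets[OF par_at_measurable b])
      have pv: "?pv \<in> ?V \<rightarrow>\<^sub>M obs_prod_at n K \<Otimes>\<^sub>M BY"
        by (intro measurable_Pair measurable_compose[OF measurable_fst obs_proj_measurable] measurable_snd)
      have C: "?C \<in> sets ?V" by (rule measurable_sets[OF pv c])
      have vim: "proj_at n K -` (b \<times> c) \<inter> space ?Z = ?A \<times> ?C"
        by (auto simp: proj_at_def space_pair_measure)
      have obs: "?pv (obs n \<omega>, Y \<omega>) = (obs_at n K \<omega>, Y \<omega>)" for \<omega>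
        by (auto simp: obs_def obs_at_def restrict_def)
      have inC: "(obs n \<omega>, Y \<omega>) \<in> ?C \<longleftrightarrow> (obs_at n K \<omega>, Y \<omega>) \<in> c" if "\<omega> \<in> space M" for \<omega>
        using measurable_space[OF V that] obs by auto
      have "emeasure \<mu> (?A \<times> ?C) = emeasure M {\<omega>\<in>space M. \<Theta> \<omega> K \<in> b \<and> (obs_at n K \<omega>, Y \<omega>) \<in> c}"
        unfolding \<mu>_eq[OF A C] using inC measurable_space[OF \<Theta>_measurable]
        by (intro arg_cong[where f="emeasure M"]) auto
      also have "\<dots> = (\<integral>\<^sup>+\<omega>. indicator c (obs_at n K \<omega>, Y \<omega>) * emeasure (Q (index n \<omega>)) ?A \<partial>M)"
        by (rule posterior_at[OF b c])
      also have "\<dots> = emeasure \<nu> (?A \<times> ?C)"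
        unfolding \<nu>_eq[OF A C] using inC by (intro nn_integral_cong) (simp add: indicator_def)
      finally have "emeasure \<mu> (?A \<times> ?C) = emeasure \<nu> (?A \<times> ?C)" .
      then show "emeasure (distr \<mu> (?N K) (proj_at n K)) (b \<times> c) = emeasure (distr \<nu> (?N K) (proj_at n K)) (b \<times> c)"
        using b c vim sets_eq_imp_space_eq[OF sets_\<mu>] sets_eq_imp_space_eq[OF sets_\<nu>]
        by (simp add: emeasure_distr[OF p\<mu>] emeasure_distr[OF p\<nu>])
    qed (rule sets_distr sets.Int_stable sets.space_closed sets.top sets.sigma_sets_eq[symmetric])+
    then have "emeasure (distr \<mu> (?N K) (proj_at n K)) B = emeasure (distr \<nu> (?N K) (proj_at n K)) B" by simp
    then show "emeasure \<mu> (proj_at n K -` B \<inter> space ?Z) = emeasure \<nu> (proj_at n K -` B \<inter> space ?Z)"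
      unfolding emeasure_distr[OF p\<mu> B] emeasure_distr[OF p\<nu> B]
        sets_eq_imp_space_eq[OF sets_\<mu>] sets_eq_imp_space_eq[OF sets_\<nu>] .
  qed
  then show ?thesis using \<mu>_eq[OF A C] \<nu>_eq[OF A C] by simp
qed

lemma posterior_given_prob:
  assumes A: "A \<in> sets BT"
  shows "AE \<omega> in M. given_prob M (\<lambda>\<omega>. (obs n \<omega>, Y \<omega>)) (obs_prod n \<Otimes>\<^sub>M BY) (\<Theta> -` A \<inter> space M) \<omega> =
    measure (Q (index n \<omega>)) A"
proof -
  let ?w = "\<lambda>z. measure (Q (update_index (limit_stat E) n (fst z) (snd z))) A"
  let ?Z = "\<lambda>\<omega>. (obs n \<omega>, Y \<omega>)"
  have ui: "(\<lambda>z. update_index (limit_stat E) n (fst z) (snd z)) \<in> obs_prod n \<Otimes>\<^sub>M BY \<rightarrow>\<^sub>M BY"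
    using update_index_joint_measurable by (simp add: case_prod_beta')
  have Z: "?Z \<in> M \<rightarrow>\<^sub>M obs_prod n \<Otimes>\<^sub>M BY" by measurable
  have set: "\<Theta> -` A \<inter> space M \<in> sets M" using A by measurable
  have w: "?w \<in> borel_measurable (obs_prod n \<Otimes>\<^sub>M BY)"
    using measurable_compose[OF measurable_compose[OF ui Q_measurable] measurable_measure_prob_algebra[OF A]] .
  have bd: "0 \<le> ?w z \<and> ?w z \<le> 1" if "z \<in> space (obs_prod n \<Otimes>\<^sub>M BY)" for z
    using prob_space.prob_le_1[OF Q_prob(1)[OF measurable_space[OF ui that]]] by simp
  have "AE \<omega> in M. given_prob M ?Z (obs_prod n \<Otimes>\<^sub>M BY) (\<Theta> -` A \<inter> space M) \<omega> = ?w (?Z \<omega>)"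
  proof (subst given_prob_eq_iff[OF Z set w bd], assumption, intro ballI)
    fix C assume C: "C \<in> sets (obs_prod n \<Otimes>\<^sub>M BY)"
    have "(\<Theta> -` A \<inter> space M) \<inter> (?Z -` C \<inter> space M) = {\<omega>\<in>space M. \<Theta> \<omega> \<in> A \<and> (obs n \<omega>, Y \<omega>) \<in> C}" by auto
    then have "emeasure M ((\<Theta> -` A \<inter> space M) \<inter> (?Z -` C \<inter> space M)) =
        (\<integral>\<^sup>+\<omega>. indicator C (?Z \<omega>) * emeasure (Q (index n \<omega>)) A \<partial>M)"
      using posterior[OF A C] by simp
    also have "\<dots> = (\<integral>\<^sup>+\<omega>. indicator C (?Z \<omega>) * ennreal (?w (?Z \<omega>)) \<partial>M)"
      by (intro nn_integral_cong)
        (simp add: index_def[symmetric] emeasure_Q[OF measurable_space[OF index_measurable]])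
    finally show "emeasure M ((\<Theta> -` A \<inter> space M) \<inter> (?Z -` C \<inter> space M)) =
        (\<integral>\<^sup>+\<omega>. indicator C (?Z \<omega>) * ennreal (?w (?Z \<omega>)) \<partial>M)" .
  qed
  then show ?thesis by (simp add: index_def)
qed

lemma conjugate_update:
  "conjugate_posterior_index M BX BT BY Q X \<Theta> Y (hyper_limit E h) (update_index (limit_stat E))"
  unfolding conjugate_posterior_index_def posterior_index_def
proof (intro exI conjI allI ballI impI)
  show "polish (hyper_limit E h)" by (rule polish_hyper_limit)
  have "(\<inter>) (space BY) ` sets BY = (\<lambda>A. A) ` sets BY"
    by (intro image_cong refl) (simp only: sets.Int_space_eq1)
  then have "sets (restrict_space BY (topspace (hyper_limit E h))) = sets BY"
    by (simp add: sets_restrict_space)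
  then show "Q \<in> restrict_space BY (topspace (hyper_limit E h)) \<rightarrow>\<^sub>M prob_algebra BT"
    using Q_measurable measurable_cong_sets[OF _ refl] by blast
  show "(\<lambda>(x, y). update_index (limit_stat E) n x y) \<in> obs_prod n \<Otimes>\<^sub>M BY \<rightarrow>\<^sub>M BY" for n
    by (rule update_index_joint_measurable)
  show "AE \<omega> in M. update_index (limit_stat E) n (\<lambda>i\<in>{..<n}. X i \<omega>) (Y \<omega>) \<in> topspace (hyper_limit E h)" for n
    using measurable_space[OF index_measurable[of n]] by (intro AE_I2) (simp add: index_def obs_def)
  show "AE \<omega> in M. given_prob M (\<lambda>\<omega>. (\<lambda>i\<in>{..<n}. X i \<omega>, Y \<omega>)) (obs_prod n \<Otimes>\<^sub>M BY) (\<Theta> -` A \<inter> space M) \<omega> =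
      measure (Q (update_index (limit_stat E) n (\<lambda>i\<in>{..<n}. X i \<omega>) (Y \<omega>))) A" if "A \<in> sets BT" for n A
    using posterior_given_prob[OF that, of n] by (simp add: obs_def index_def)
qed simp_all

end

section \<open>Sufficiency of the limit statistic\<close>

lemma sets_vimage_algebra_mono:
  assumes Z: "Z \<in> M \<rightarrow>\<^sub>M N" and q: "q \<in> N \<rightarrow>\<^sub>M L"
    and eq: "\<And>\<omega>. \<omega> \<in> space M \<Longrightarrow> W \<omega> = q (Z \<omega>)"
  shows "sets (vimage_algebra (space M) W L) \<subseteq> sets (vimage_algebra (space M) Z N)"
proof
  fix D assume D: "D \<in> sets (vimage_algebra (space M) W L)"
  have W: "W \<in> M \<rightarrow>\<^sub>M L"
    using measurable_compose[OF Z q] eq by (simp cong: measurable_cong)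
  obtain C where C: "C \<in> sets L" "D = W -` C \<inter> space M" using D by (rule sets_vimageE[OF W])
  have "D = Z -` (q -` C \<inter> space N) \<inter> space M"
    using measurable_space[OF Z] eq by (auto simp: C(2))
  also have "\<dots> \<in> sets (vimage_algebra (space M) Z N)"
    using q C(1) by (intro in_vimage_algebra measurable_sets)
  finally show "D \<in> sets (vimage_algebra (space M) Z N)" .
qed

context conjugate_exp_family
begin

text \<open>
  The likelihood without the factor \<open>H\<close>; it depends on the observation through the statistic only.
\<close>

definition stat_lik :: "'u \<Rightarrow> 'u \<Rightarrow> ennreal" where
  "stat_lik s \<theta> = ennreal (exp (ip E s \<theta>) / model_normalizer E \<theta>)"

lemma stat_lik_measurable:
  assumes "a \<in> M \<rightarrow>\<^sub>M MU" "b \<in> M \<rightarrow>\<^sub>M MT"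
  shows "(\<lambda>w. stat_lik (a w) (b w)) \<in> borel_measurable M"
  unfolding stat_lik_def
  using ip_measurable[OF assms(1) par_inclusion_measurable[OF assms(2)]]
    measurable_compose[OF assms(2) model_normalizer_measurable] by measurable

lemma lik_factor:
  assumes "x \<in> topspace (obs_top E)" "\<theta> \<in> par_set E"
  shows "lik x \<theta> = ennreal (base E x) * stat_lik (stat E x) \<theta>"
  using base_nonneg[OF assms(1)] model_normalizer_pos[OF assms(2)]
  by (simp add: lik_def stat_lik_def flip: ennreal_mult)

end

context projective_limit_bayes
begin

abbreviation "LTh \<equiv> distr M BT \<Theta>"

lemma lik_at_measurable:
  "(\<lambda>z. E.lik J (snd z) (fst z J)) \<in> borel_measurable (LTh \<Otimes>\<^sub>M obs_carrier (E J))"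
proof -
  have s: "sets (LTh \<Otimes>\<^sub>M obs_carrier (E J)) = sets (BT \<Otimes>\<^sub>M MX J)"
    by (intro sets_pair_measure_cong sets_distr E.sets_obs_carrier)
  have "(\<lambda>z. E.lik J (snd z) (fst z J)) \<in> borel_measurable (BT \<Otimes>\<^sub>M MX J)"
    by (intro E.lik_measurable measurable_snd measurable_compose[OF measurable_fst par_at_measurable])
  then show ?thesis using measurable_cong_sets[OF s refl] by blast
qed

text \<open>
  The model describes the first observations jointly; the ones before the \<open>k\<close>-th are left
  unrestricted.
\<close>

lemma law_obs_single:
  assumes C: "C \<in> sets (MX J)" and A: "A \<in> sets BT"
  shows "emeasure M {\<omega>\<in>space M. \<Theta> \<omega> \<in> A \<and> X k \<omega> J \<in> C} =
    (\<integral>\<^sup>+\<omega>. indicator A (\<Theta> \<omega>) * emeasure (model (E J) (\<Theta> \<omega> J)) C \<partial>M)"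
proof -
  let ?C = "\<lambda>i. if i = k then C else space (MX J)"
  have "{\<omega>\<in>space M. \<Theta> \<omega> \<in> A \<and> X k \<omega> J \<in> C} =
      {\<omega>\<in>space M. (\<forall>i<Suc k. X i \<omega> J \<in> ?C i) \<and> (\<Theta> \<omega>, Y \<omega>) \<in> A \<times> space BY}"
    using measurable_space[OF X_at_measurable] measurable_space[OF Y_measurable] by (auto split: if_splits)
  also have "emeasure M \<dots> =
      (\<integral>\<^sup>+\<omega>. indicator (A \<times> space BY) (\<Theta> \<omega>, Y \<omega>) * (\<Prod>i<Suc k. emeasure (model (E J) (\<Theta> \<omega> J)) (?C i)) \<partial>M)"
    by (rule law_obs_at) (use C A in \<open>auto simp del: space_borel_of\<close>)
  also have "\<dots> = (\<integral>\<^sup>+\<omega>. indicator A (\<Theta> \<omega>) * emeasure (model (E J) (\<Theta> \<omega> J)) C \<partial>M)"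
  proof (rule nn_integral_cong)
    fix \<omega> assume \<omega>: "\<omega> \<in> space M"
    have "\<Theta> \<omega> J \<in> par_set (E J)" by (rule par_limitD(1)[OF measurable_space[OF \<Theta>_measurable \<omega>]])
    then have "prob_space (model (E J) (\<Theta> \<omega> J))" "sets (model (E J) (\<Theta> \<omega> J)) = sets (MX J)"
      using measurable_space[OF E.model_measurable, of "\<Theta> \<omega> J" J]
      by (simp_all add: E.topspace_par_top space_prob_algebra)
    then have "emeasure (model (E J) (\<Theta> \<omega> J)) (space (MX J)) = 1"
      using prob_space.emeasure_space_1 sets_eq_imp_space_eq by metis
    moreover have "(\<Prod>i<k. emeasure (model (E J) (\<Theta> \<omega> J)) (?C i)) = (\<Prod>i<k. emeasure (model (E J) (\<Theta> \<omega> J)) (space (MX J)))"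
      by (intro prod.cong) auto
    ultimately show "indicator (A \<times> space BY) (\<Theta> \<omega>, Y \<omega>) * (\<Prod>i<Suc k. emeasure (model (E J) (\<Theta> \<omega> J)) (?C i)) =
        indicator A (\<Theta> \<omega>) * emeasure (model (E J) (\<Theta> \<omega> J)) C"
      using measurable_space[OF Y_measurable \<omega>] by (simp add: indicator_def)
  qed
  finally show ?thesis .
qed

lemma joint_law_single:
  "distr M (LTh \<Otimes>\<^sub>M obs_carrier (E J)) (\<lambda>\<omega>. (\<Theta> \<omega>, X k \<omega> J)) =
   density (LTh \<Otimes>\<^sub>M obs_carrier (E J)) (\<lambda>z. E.lik J (snd z) (fst z J))"
proof -
  let ?N = "LTh \<Otimes>\<^sub>M obs_carrier (E J)"
  have W: "(\<lambda>\<omega>. (\<Theta> \<omega>, X k \<omega> J)) \<in> M \<rightarrow>\<^sub>M ?N"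
    using X_at_measurable[of k J] measurable_cong_sets[OF refl E.sets_obs_carrier[of J], of M]
    by (intro measurable_Pair) auto
  show ?thesis
  proof (rule measure_eqI_rectangles[where \<A>="sets LTh" and \<B>="sets (obs_carrier (E J))"])
    show "finite_measure (distr M ?N (\<lambda>\<omega>. (\<Theta> \<omega>, X k \<omega> J)))"
      using prob_space_distr[OF W] by (simp add: prob_space_def)
    fix A C assume A: "A \<in> sets LTh" and C: "C \<in> sets (obs_carrier (E J))"
    have A': "A \<in> sets BT" and C': "C \<in> sets (MX J)" using A C by (simp_all add: E.sets_obs_carrier)
    have mC: "(\<lambda>\<theta>. indicator A \<theta> * emeasure (model (E J) (\<theta> J)) C) \<in> borel_measurable BT"
      using A' by (intro borel_measurable_times_ennreal borel_measurable_indicator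
          emeasure_prob_kernel_measurable[OF measurable_compose[OF par_at_measurable E.model_measurable] C'])
    have "emeasure (distr M ?N (\<lambda>\<omega>. (\<Theta> \<omega>, X k \<omega> J))) (A \<times> C) =
        emeasure M {\<omega>\<in>space M. \<Theta> \<omega> \<in> A \<and> X k \<omega> J \<in> C}"
      using A C by (subst emeasure_distr[OF W]) (auto intro!: arg_cong[where f="emeasure M"])
    also have "\<dots> = (\<integral>\<^sup>+\<theta>. indicator A \<theta> * emeasure (model (E J) (\<theta> J)) C \<partial>LTh)"
      unfolding law_obs_single[OF C' A'] using mC by (subst nn_integral_distr) auto
    also have "\<dots> = (\<integral>\<^sup>+\<theta>. (\<integral>\<^sup>+x. E.lik J x (\<theta> J) * indicator (A \<times> C) (\<theta>, x) \<partial>obs_carrier (E J)) \<partial>LTh)"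
    proof (rule nn_integral_cong)
      fix \<theta> assume "\<theta> \<in> space LTh"
      then have \<theta>: "\<theta> J \<in> par_set (E J)" by (intro par_limitD(1)) simp
      have l: "(\<lambda>x. E.lik J x (\<theta> J) * indicator C x) \<in> borel_measurable (obs_carrier (E J))"
        using C by (intro borel_measurable_times_ennreal borel_measurable_indicator E.lik_measurable
            measurable_ident_sets[OF E.sets_obs_carrier] E.measurable_par[OF \<theta>])
      show "indicator A \<theta> * emeasure (model (E J) (\<theta> J)) C =
          (\<integral>\<^sup>+x. E.lik J x (\<theta> J) * indicator (A \<times> C) (\<theta>, x) \<partial>obs_carrier (E J))"
        unfolding E.emeasure_model[OF \<theta> C'] nn_integral_cmult[OF l, symmetric]
        by (intro nn_integral_cong) (simp add: indicator_def)
    qed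
    also have "\<dots> = (\<integral>\<^sup>+z. E.lik J (snd z) (fst z J) * indicator (A \<times> C) z \<partial>?N)"
      using A C lik_at_measurable[of J]
      by (subst E.obs.nn_integral_fst[symmetric]) (auto intro!: borel_measurable_times_ennreal)
    also have "\<dots> = emeasure (density ?N (\<lambda>z. E.lik J (snd z) (fst z J))) (A \<times> C)"
      using A C lik_at_measurable[of J] by (subst emeasure_density) auto
    finally show "emeasure (distr M ?N (\<lambda>\<omega>. (\<Theta> \<omega>, X k \<omega> J))) (A \<times> C) =
        emeasure (density ?N (\<lambda>z. E.lik J (snd z) (fst z J))) (A \<times> C)" .
  qed (rule sets_distr sets_density sets.Int_stable sets.space_closed sets.top sets.sigma_sets_eq[symmetric])+
qed

text \<open>
  Bayes' formula with the law of the parameter as prior, which may be any mixture of conjugate priors: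
  numerator and denominator contain the same factor \<open>H\<close>, and what remains is a function \<open>a\<close> of the
  statistic.
\<close>

lemma posterior_single_factors:
  assumes B: "B \<in> sets BT"
  shows "\<exists>w\<in>borel_measurable (borel_of (stat_top (E J))). AE \<omega> in M.
    given_prob M (\<lambda>\<omega>. X k \<omega> J) (MX J) (\<Theta> -` B \<inter> space M) \<omega> = w (stat (E J) (X k \<omega> J))"
proof -
  let ?MU = "borel_of (stat_top (E J))"
  interpret LTh: prob_space LTh by (rule prob_space_distr[OF \<Theta>_measurable])
  define a where "a B s = (\<integral>\<^sup>+\<theta>. E.stat_lik J s (\<theta> J) * indicator B \<theta> \<partial>LTh)" for B s
  have a: "a B \<in> borel_measurable ?MU" if "B \<in> sets BT" for B
  proof -
    have "(\<lambda>(s, \<theta>). E.stat_lik J s (\<theta> J) * indicator B \<theta>) \<in> borel_measurable (?MU \<Otimes>\<^sub>M LTh)"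
      unfolding case_prod_beta
    proof (intro borel_measurable_times_ennreal E.stat_lik_measurable measurable_fst)
      have LTh: "measurable (?MU \<Otimes>\<^sub>M LTh) L = measurable (?MU \<Otimes>\<^sub>M BT) L" for L :: "'c measure"
        by (intro measurable_cong_sets sets_pair_measure_cong sets_distr refl)
      show "(\<lambda>z. snd z J) \<in> ?MU \<Otimes>\<^sub>M LTh \<rightarrow>\<^sub>M MT J"
        unfolding LTh by (rule measurable_compose[OF measurable_snd par_at_measurable])
      show "(\<lambda>z. indicator B (snd z)) \<in> borel_measurable (?MU \<Otimes>\<^sub>M LTh)"
        unfolding LTh using that by measurable
    qed
    from LTh.borel_measurable_nn_integral[OF this] show ?thesis
      unfolding a_def by (simp add: fun_eq_iff[symmetric])
  qed
  (* where the evidence is positive and finite the quotient is at most 1; the minimum only gives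
     w this bound at the remaining points as well *)
  define w where "w s = min 1 (enn2real (a B s / a (space BT) s))" for s
  have w: "w \<in> borel_measurable ?MU"
    unfolding w_def using a[OF B] a[OF sets.top] by measurable
  have U: "\<Theta> \<in> M \<rightarrow>\<^sub>M LTh" by simp
  have V: "(\<lambda>\<omega>. X k \<omega> J) \<in> M \<rightarrow>\<^sub>M obs_carrier (E J)"
    using X_at_measurable[of k J] measurable_cong_sets[OF refl E.sets_obs_carrier[of J], of M] by blast
  note bayes = bayes_density[OF prob_space_axioms LTh.sigma_finite_measure_axioms E.obs.sigma_finite_measure_axioms
      U V lik_at_measurable joint_law_single]
  have factor: "(\<integral>\<^sup>+\<theta>. E.lik J x (\<theta> J) * indicator B \<theta> \<partial>LTh) = ennreal (base (E J) x) * a B (stat (E J) x)"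
    if x: "x \<in> topspace (obs_top (E J))" and B: "B \<in> sets BT" for x B
  proof -
    have m: "(\<lambda>\<theta>. E.stat_lik J (stat (E J) x) (\<theta> J) * indicator B \<theta>) \<in> borel_measurable LTh"
      using x B E.stat_in[OF x]
      by (intro borel_measurable_times_ennreal E.stat_lik_measurable borel_measurable_indicator)
        (auto intro: par_at_measurable)
    show ?thesis
      unfolding a_def nn_integral_cmult[OF m, symmetric]
      by (intro nn_integral_cong) (simp add: E.lik_factor[OF x par_limitD(1)] mult.assoc)
  qed
  have ev: "(\<integral>\<^sup>+\<theta>. E.lik J x (\<theta> J) \<partial>LTh) = ennreal (base (E J) x) * a (space BT) (stat (E J) x)"
    if x: "x \<in> topspace (obs_top (E J))" for x
    unfolding factor[OF x sets.top, symmetric] by (intro nn_integral_cong) simp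
  have ratio: "AE \<omega> in M. (\<integral>\<^sup>+\<theta>. E.lik J (X k \<omega> J) (\<theta> J) * indicator B \<theta> \<partial>LTh) / (\<integral>\<^sup>+\<theta>. E.lik J (X k \<omega> J) (\<theta> J) \<partial>LTh)
      = ennreal (w (stat (E J) (X k \<omega> J)))"
    using bayes(1) AE_space unfolding fst_conv snd_conv
  proof eventually_elim
    fix \<omega> assume m: "0 < (\<integral>\<^sup>+\<theta>. E.lik J (X k \<omega> J) (\<theta> J) \<partial>LTh) \<and> (\<integral>\<^sup>+\<theta>. E.lik J (X k \<omega> J) (\<theta> J) \<partial>LTh) < \<infinity>"
      and \<omega>: "\<omega> \<in> space M"
    let ?x = "X k \<omega> J"
    let ?s = "stat (E J) ?x"
    let ?b = "ennreal (base (E J) ?x)"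
    have x: "?x \<in> topspace (obs_top (E J))" using measurable_space[OF X_at_measurable \<omega>] by simp
    have b: "?b \<noteq> 0" and a0: "a (space BT) ?s \<noteq> 0" using m unfolding ev[OF x] by auto
    have atop: "a (space BT) ?s \<noteq> \<infinity>"
      using m b unfolding ev[OF x] by (auto simp: ennreal_mult_less_top)
    have "a B ?s \<le> a (space BT) ?s"
      unfolding a_def using sets.sets_into_space[OF B] by (intro nn_integral_mono) (auto simp: indicator_def)
    then have le: "a B ?s / a (space BT) ?s \<le> 1"
      using a0 atop divide_right_mono_ennreal[of "a B ?s" "a (space BT) ?s" "a (space BT) ?s"]
      by (simp add: less_top)
    have "(?b * a B ?s) / (?b * a (space BT) ?s) = a B ?s / a (space BT) ?s"
      unfolding mult.commute[of ?b] using b by (intro divide_mult_eq) auto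
    also have "\<dots> = ennreal (w ?s)"
    proof -
      have "enn2real (a B ?s / a (space BT) ?s) \<le> 1"
        using le enn2real_leI[of 1] by simp
      moreover have "a B ?s / a (space BT) ?s < \<top>" using le by (rule le_less_trans) simp
      ultimately show ?thesis unfolding w_def by (simp add: min_absorb2)
    qed
    finally show "(\<integral>\<^sup>+\<theta>. E.lik J ?x (\<theta> J) * indicator B \<theta> \<partial>LTh) / (\<integral>\<^sup>+\<theta>. E.lik J ?x (\<theta> J) \<partial>LTh) = ennreal (w ?s)"
      unfolding factor[OF x B] ev[OF x] .
  qed
  have set: "\<Theta> -` B \<inter> space M \<in> sets M" using B by measurable
  have wst: "(\<lambda>x. w (stat (E J) x)) \<in> borel_measurable (MX J)"
    by (rule measurable_compose[OF E.stat_measurable w])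
  have bd: "0 \<le> w s \<and> w s \<le> 1" for s unfolding w_def by simp
  have "AE \<omega> in M. given_prob M (\<lambda>\<omega>. X k \<omega> J) (MX J) (\<Theta> -` B \<inter> space M) \<omega> = w (stat (E J) (X k \<omega> J))"
  proof (subst given_prob_eq_iff[OF X_at_measurable set wst bd], intro ballI)
    fix C assume C: "C \<in> sets (MX J)"
    have "(\<Theta> -` B \<inter> space M) \<inter> ((\<lambda>\<omega>. X k \<omega> J) -` C \<inter> space M) = {\<omega>\<in>space M. \<Theta> \<omega> \<in> B \<and> X k \<omega> J \<in> C}" by auto
    then have "emeasure M ((\<Theta> -` B \<inter> space M) \<inter> ((\<lambda>\<omega>. X k \<omega> J) -` C \<inter> space M)) =
      (\<integral>\<^sup>+\<omega>. indicator C (X k \<omega> J) * ((\<integral>\<^sup>+\<theta>. E.lik J (X k \<omega> J) (\<theta> J) * indicator B \<theta> \<partial>LTh) /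
        (\<integral>\<^sup>+\<theta>. E.lik J (X k \<omega> J) (\<theta> J) \<partial>LTh)) \<partial>M)"
      using bayes(2)[of B C] B C by (simp add: E.sets_obs_carrier)
    also have "\<dots> = (\<integral>\<^sup>+\<omega>. indicator C (X k \<omega> J) * ennreal (w (stat (E J) (X k \<omega> J))) \<partial>M)"
      by (intro nn_integral_cong_AE, use ratio in eventually_elim) simp
    finally show "emeasure M ((\<Theta> -` B \<inter> space M) \<inter> ((\<lambda>\<omega>. X k \<omega> J) -` C \<inter> space M)) =
      (\<integral>\<^sup>+\<omega>. indicator C (X k \<omega> J) * ennreal (w (stat (E J) (X k \<omega> J))) \<partial>M)" .
  qed
  then show ?thesis using w by blast
qed

lemma posterior_given_stat:
  assumes B: "B \<in> sets BT"
  shows "AE \<omega> in M. given_prob M (X k) BX (\<Theta> -` B \<inter> space M) \<omega> =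
    given_prob M (\<lambda>\<omega>. limit_stat E (X k \<omega>)) BU (\<Theta> -` B \<inter> space M) \<omega>"
proof -
  let ?G = "\<lambda>J. vimage_algebra (space M) (\<lambda>\<omega>. X k \<omega> J) (MX J)"
  let ?F = "vimage_algebra (space M) (X k) BX"
  let ?H = "vimage_algebra (space M) (\<lambda>\<omega>. limit_stat E (X k \<omega>)) BU"
  have S: "(\<lambda>\<omega>. limit_stat E (X k \<omega>)) \<in> M \<rightarrow>\<^sub>M BU"
    by (rule measurable_compose[OF X_measurable limit_stat_measurable])
  have mono: "sets (?G I) \<subseteq> sets (?G J)" if "I \<le> J" for I J
    using obs_limitD(2)[OF measurable_space[OF X_measurable] that]
    by (intro sets_vimage_algebra_mono[OF X_at_measurable obs_connect_measurable[OF that]])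
  interpret directed_subalgebras M ?G
  proof
    show "subalgebra M (?G J)" for J by (rule subalgebra_vimage[OF X_at_measurable])
    show "\<exists>N. sets (?G I) \<subseteq> sets (?G N) \<and> sets (?G J) \<subseteq> sets (?G N)" for I J
      using directed mono by meson
  qed
  have GF: "sets (?G J) \<subseteq> sets ?F" for J
    by (rule sets_vimage_algebra_mono[OF X_measurable obs_at_measurable refl])
  have HF: "sets ?H \<subseteq> sets ?F"
    by (rule sets_vimage_algebra_mono[OF X_measurable limit_stat_measurable refl])
  have gen: "sets ?F \<subseteq> sigma_sets (space M) (\<Union>J. sets (?G J))"
  proof
    let ?S = "sigma (space M) (\<Union>J. sets (?G J))"
    have sub: "(\<Union>J. sets (?G J)) \<subseteq> Pow (space M)" using sets.space_closed[of "?G _"] by auto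
    have sp: "space ?S = space M" using sub by (rule space_measure_of)
    have XS: "X k \<in> ?S \<rightarrow>\<^sub>M BX"
    proof (rule measurable_into_BX)
      show "X k \<omega> \<in> space BX" if "\<omega> \<in> space ?S" for \<omega>
        using measurable_space[OF X_measurable] that unfolding sp by blast
      show "(\<lambda>\<omega>. X k \<omega> J) \<in> ?S \<rightarrow>\<^sub>M MX J" for J
      proof (rule measurableI)
        show "X k \<omega> J \<in> space (MX J)" if "\<omega> \<in> space ?S" for \<omega>
          using measurable_space[OF X_at_measurable] that unfolding sp by blast
        show "(\<lambda>\<omega>. X k \<omega> J) -` C \<inter> space ?S \<in> sets ?S" if "C \<in> sets (MX J)" for C
          unfolding sp sets_measure_of[OF sub] using in_vimage_algebra[OF that]
          by (intro sigma_sets.Basic UN_I[of J]) auto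
      qed
    qed
    fix D assume "D \<in> sets ?F"
    then obtain C where C: "C \<in> sets BX" "D = X k -` C \<inter> space M" by (rule sets_vimageE[OF X_measurable])
    from measurable_sets[OF XS C(1)] show "D \<in> sigma_sets (space M) (\<Union>J. sets (?G J))"
      unfolding sp sets_measure_of[OF sub] C(2) .
  qed
  have set: "\<Theta> -` B \<inter> space M \<in> sets M" using B by measurable
  show ?thesis
    unfolding given_prob_def
  proof (rule real_cond_exp_directed[OF _ gen])
    show "subalgebra M ?F" by (rule subalgebra_vimage[OF X_measurable])
    show "subalgebra ?F (?G J)" for J using GF[of J] by (simp add: subalgebra_def)
    show "subalgebra ?F ?H" using HF by (simp add: subalgebra_def)
    show "integrable M (indicator (\<Theta> -` B \<inter> space M) :: _ \<Rightarrow> real)"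
      using set by (simp add: integrable_real_indicator emeasure_eq_measure)
    fix J
    obtain w where w: "w \<in> borel_measurable (borel_of (stat_top (E J)))"
      and eq: "AE \<omega> in M. given_prob M (\<lambda>\<omega>. X k \<omega> J) (MX J) (\<Theta> -` B \<inter> space M) \<omega> = w (stat (E J) (X k \<omega> J))"
      using posterior_single_factors[OF B] by blast
    have "(\<lambda>\<omega>. w (limit_stat E (X k \<omega>) J)) \<in> borel_measurable ?H"
      by (rule measurable_comp_vimage_algebra[OF S measurable_compose[OF stat_at_measurable w]])
    then show "\<exists>v\<in>borel_measurable ?H. AE x in M. real_cond_exp M (?G J) (indicator (\<Theta> -` B \<inter> space M)) x = v x"
      by (rule bexI[rotated]) (use eq in \<open>simp only: given_prob_def limit_stat_def\<close>)
  qed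
qed

lemma sufficient_limit_stat: "sufficient_statistic M BX BT BU (X k) \<Theta> (limit_stat E)"
  unfolding sufficient_statistic_def
proof (intro conjI ballI)
  fix A assume "A \<in> sets BX"
  from cond_indep_swap[OF X_measurable \<Theta>_measurable limit_stat_measurable posterior_given_stat this]
  show "AE \<omega> in M. given_prob M (\<lambda>\<omega>. (limit_stat E (X k \<omega>), \<Theta> \<omega>)) (BU \<Otimes>\<^sub>M BT) (X k -` A \<inter> space M) \<omega> =
      given_prob M (\<lambda>\<omega>. limit_stat E (X k \<omega>)) BU (X k -` A \<inter> space M) \<omega>" .
qed (rule limit_stat_measurable)

end

section \<open>Pullback models\<close>

text \<open>
  A set \<open>B\<close> that covers \<open>A \<inter> R\<close>, together with the complement of \<open>A\<close>, covers \<open>R\<close> and hence has full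
  measure.
\<close>

lemma outer_measure_of_Int_full:
  assumes "prob_space \<nu>" and R: "R \<subseteq> space \<nu>" "outer_measure_of \<nu> R = 1" and A: "A \<in> sets \<nu>"
  shows "outer_measure_of \<nu> (A \<inter> R) = emeasure \<nu> A"
proof (rule antisym)
  interpret prob_space \<nu> by fact
  have "outer_measure_of \<nu> (A \<inter> R) \<le> outer_measure_of \<nu> A" by (rule outer_measure_of_mono) simp
  then show "outer_measure_of \<nu> (A \<inter> R) \<le> emeasure \<nu> A" using A by simp
  obtain B where B: "B \<in> sets \<nu>" "A \<inter> R \<subseteq> B" "outer_measure_of \<nu> (A \<inter> R) = emeasure \<nu> B"
    using outer_measure_of_attain[of "A \<inter> R" \<nu>] R(1) by blast
  have "1 \<le> outer_measure_of \<nu> (B \<union> (space \<nu> - A))"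
    unfolding R(2)[symmetric] using R(1) B(2) by (intro outer_measure_of_mono) blast
  also have "\<dots> = emeasure \<nu> (B \<union> (space \<nu> - A))" using A B(1) by simp
  also have "\<dots> = ennreal (measure \<nu> (B \<union> (space \<nu> - A)))" by (rule emeasure_eq_measure)
  finally have "1 \<le> measure \<nu> (B \<union> (space \<nu> - A))" by simp
  also have "\<dots> \<le> measure \<nu> B + measure \<nu> (space \<nu> - A)"
    using A B(1) by (intro measure_Un_le) auto
  also have "measure \<nu> (space \<nu> - A) = 1 - measure \<nu> A" using A by (rule prob_compl)
  finally have "measure \<nu> A \<le> measure \<nu> B" by simp
  then show "emeasure \<nu> A \<le> outer_measure_of \<nu> (A \<inter> R)"
    unfolding B(3) emeasure_eq_measure by (rule ennreal_leI)
qed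

text \<open>
  The pullback of \<open>\<nu>\<close> is the outer measure of the image.  On preimages it has the values of \<open>\<nu>\<close> by
  \<open>outer_measure_of_Int_full\<close>, from which countable additivity is inherited.
\<close>

lemma pullback_exists:
  assumes \<nu>: "prob_space \<nu>" and \<phi>: "\<phi> \<in> S \<rightarrow> space \<nu>" and outer: "outer_measure_of \<nu> (\<phi> ` S) = 1"
  shows "\<exists>N. sets N = sets (vimage_algebra S \<phi> \<nu>) \<and> distr N \<nu> \<phi> = \<nu>"
proof -
  interpret prob_space \<nu> by fact
  let ?V = "vimage_algebra S \<phi> \<nu>"
  let ?m = "\<lambda>B. outer_measure_of \<nu> (\<phi> ` B)"
  have V: "sets ?V = {\<phi> -` A \<inter> S | A. A \<in> sets \<nu>}" by (rule sets_vimage_algebra2[OF \<phi>])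
  have m: "?m (\<phi> -` A \<inter> S) = emeasure \<nu> A" if "A \<in> sets \<nu>" for A
  proof -
    have "\<phi> ` (\<phi> -` A \<inter> S) = A \<inter> \<phi> ` S" by blast
    then show ?thesis using outer_measure_of_Int_full[OF \<nu> _ outer that] \<phi> by auto
  qed
  have add: "countably_additive (sets ?V) ?m"
  proof (rule countably_additiveI)
    fix B :: "nat \<Rightarrow> _ set" assume "range B \<subseteq> sets ?V" and disj: "disjoint_family B"
    then have "\<exists>A. A \<in> sets \<nu> \<and> B i = \<phi> -` A \<inter> S" for i unfolding V by blast
    then obtain A where A: "\<And>i. A i \<in> sets \<nu>" "\<And>i. B i = \<phi> -` A i \<inter> S" by metis
    (* the sets A i need not be disjoint, but they can be made so without changing their preimages *)
    have A': "disjointed A i \<in> sets \<nu>" for i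
      using sets.range_disjointed_sets[of A \<nu>] A(1) by blast
    have B: "B i = \<phi> -` disjointed A i \<inter> S" for i
    proof -
      have "B i \<inter> B j = {}" if "j < i" for j using disj that by (auto simp: disjoint_family_on_def)
      then show ?thesis unfolding disjointed_def A(2) by fastforce
    qed
    have "(\<Union>i. B i) = \<phi> -` (\<Union>i. disjointed A i) \<inter> S" using B by blast
    then have "?m (\<Union>i. B i) = emeasure \<nu> (\<Union>i. disjointed A i)"
      using m[of "\<Union>i. disjointed A i"] A' by auto
    also have "\<dots> = (\<Sum>i. emeasure \<nu> (disjointed A i))"
      using A' by (intro suminf_emeasure[symmetric] disjoint_family_disjointed) auto
    also have "\<dots> = (\<Sum>i. ?m (B i))" unfolding B m[OF A'] ..
    finally show "(\<Sum>i. ?m (B i)) = ?m (\<Union>i. B i)" ..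
  qed
  define N where "N = measure_of S (sets ?V) ?m"
  have sp: "sets ?V \<subseteq> Pow S" using sets.space_closed[of ?V] by simp
  have sets_N: "sets N = sets ?V"
    unfolding N_def using sets_measure_of[OF sp] sets.sigma_sets_eq[of ?V] by simp
  have "emeasure N B = ?m B" if "B \<in> sets ?V" for B
  proof (rule emeasure_measure_of[OF N_def sp])
    show "B \<in> sets N" using that sets_N by simp
    show "positive (sets N) ?m" by (simp add: positive_def)
    show "countably_additive (sets N) ?m" using add sets_N by simp
  qed
  from this[OF in_vimage_algebra] have em: "emeasure N (\<phi> -` A \<inter> S) = emeasure \<nu> A" if "A \<in> sets \<nu>" for A
    using m[OF that] that by simp
  have space_N: "space N = S" using sets_eq_imp_space_eq[OF sets_N] by simp
  have "\<phi> \<in> N \<rightarrow>\<^sub>M \<nu>"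
    using measurable_vimage_algebra1[OF \<phi>] measurable_cong_sets[OF sets_N refl] by blast
  then have "distr N \<nu> \<phi> = \<nu>"
    using em by (intro measure_eqI) (auto simp: emeasure_distr space_N)
  with sets_N show ?thesis by blast
qed

lemma pullback_measure:
  assumes \<nu>: "prob_space \<nu>" and \<phi>: "\<phi> \<in> S \<rightarrow> space \<nu>" and outer: "outer_measure_of \<nu> (\<phi> ` S) = 1"
  shows sets_pullback_measure: "sets (pullback_measure S \<phi> \<nu>) = sets (vimage_algebra S \<phi> \<nu>)"
    and emeasure_pullback_measure:
      "A \<in> sets \<nu> \<Longrightarrow> emeasure (pullback_measure S \<phi> \<nu>) (\<phi> -` A \<inter> S) = emeasure \<nu> A"
proof -
  let ?R = "\<lambda>N. sets N = sets (vimage_algebra S \<phi> \<nu>) \<and> distr N \<nu> \<phi> = \<nu>"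
  have em: "emeasure N (\<phi> -` A \<inter> S) = emeasure \<nu> A" if "?R N" "A \<in> sets \<nu>" for N A
  proof -
    have sN: "space N = S" using that(1) sets_eq_imp_space_eq[of N "vimage_algebra S \<phi> \<nu>"] by simp
    have "\<phi> \<in> N \<rightarrow>\<^sub>M \<nu>"
      using measurable_vimage_algebra1[OF \<phi>] measurable_cong_sets[of N "vimage_algebra S \<phi> \<nu>" \<nu> \<nu>] that(1) by blast
    from emeasure_distr[OF this that(2)] show ?thesis using that(1) by (simp add: sN)
  qed
  have "\<exists>!N. ?R N"
  proof (rule ex_ex1I[OF pullback_exists[OF assms]])
    fix N N' assume N: "?R N" and N': "?R N'"
    show "N = N'"
    proof (rule measure_eqI)
      show "sets N = sets N'" using N N' by simp
      fix B assume "B \<in> sets N"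
      then obtain A where "A \<in> sets \<nu>" "B = \<phi> -` A \<inter> S"
        using N unfolding sets_vimage_algebra2[OF \<phi>] by blast
      then show "emeasure N B = emeasure N' B" using em[OF N] em[OF N'] by simp
    qed
  qed
  then have R: "?R (pullback_measure S \<phi> \<nu>)"
    unfolding pullback_measure_def by (rule theI')
  show "sets (pullback_measure S \<phi> \<nu>) = sets (vimage_algebra S \<phi> \<nu>)" using R by blast
  show "emeasure (pullback_measure S \<phi> \<nu>) (\<phi> -` A \<inter> S) = emeasure \<nu> A" if "A \<in> sets \<nu>"
    by (rule em[OF R that])
qed

lemma prob_space_pullback_measure:
  assumes \<nu>: "prob_space \<nu>" and \<phi>: "\<phi> \<in> S \<rightarrow> space \<nu>" and outer: "outer_measure_of \<nu> (\<phi> ` S) = 1"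
  shows "prob_space (pullback_measure S \<phi> \<nu>)"
proof (rule prob_spaceI)
  have "space (pullback_measure S \<phi> \<nu>) = S"
    using sets_eq_imp_space_eq[OF sets_pullback_measure[OF assms]] by simp
  also have "S = \<phi> -` space \<nu> \<inter> S" using \<phi> by auto
  finally show "emeasure (pullback_measure S \<phi> \<nu>) (space (pullback_measure S \<phi> \<nu>)) = 1"
    using emeasure_pullback_measure[OF assms sets.top] prob_space.emeasure_space_1[OF \<nu>] by simp
qed

text \<open>
  Only the \<open>\<sigma>\<close>-algebra generated by the conditioning variable matters.
\<close>

lemma given_prob_cong:
  assumes Z: "Z \<in> vimage_algebra (space M) Z' N' \<rightarrow>\<^sub>M N" and Z': "Z' \<in> vimage_algebra (space M) Z N \<rightarrow>\<^sub>M N'"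
  shows "given_prob M Z N = given_prob M Z' N'"
proof -
  have s: "sets (vimage_algebra (space M) Z N) = sets (vimage_algebra (space M) Z' N')"
    using Z Z' unfolding measurable_iff_sets by auto
  have "vimage_algebra (space M) Z N = vimage_algebra (space M) Z' N'"
  proof (rule measure_eqI[OF s])
    show "emeasure (vimage_algebra (space M) Z N) A = emeasure (vimage_algebra (space M) Z' N') A" for A
      by (simp add: vimage_algebra_def emeasure_sigma)
  qed
  then show ?thesis unfolding given_prob_def fun_eq_iff by simp
qed

text \<open>
  For an embedding the \<open>\<sigma>\<close>-algebra of the domain is recovered from the one of the target, so that
  maps into the domain are measurable once their composition with the embedding is.
\<close>

lemma borel_embedding_sets:
  assumes "borel_embedding N B \<phi>"
  shows "sets N = sets (vimage_algebra (space N) \<phi> B)"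
proof -
  have inj: "inj_on \<phi> (space N)" and \<phi>: "\<phi> \<in> N \<rightarrow>\<^sub>M B"
    and inv: "the_inv_into (space N) \<phi> \<in> restrict_space B (\<phi> ` space N) \<rightarrow>\<^sub>M N"
    using assms by (auto simp: borel_embedding_def)
  have sub: "\<phi> \<in> space N \<rightarrow> space B" using measurable_space[OF \<phi>] by blast
  show ?thesis
  proof (rule equalityI)
    show "sets (vimage_algebra (space N) \<phi> B) \<subseteq> sets N" using \<phi> unfolding measurable_iff_sets by simp
    show "sets N \<subseteq> sets (vimage_algebra (space N) \<phi> B)"
    proof
      fix C assume C: "C \<in> sets N"
      then have "the_inv_into (space N) \<phi> -` C \<inter> space (restrict_space B (\<phi> ` space N)) \<in>
          sets (restrict_space B (\<phi> ` space N))" using inv by (intro measurable_sets)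
      then obtain A where A: "A \<in> sets B"
        "the_inv_into (space N) \<phi> -` C \<inter> space (restrict_space B (\<phi> ` space N)) = \<phi> ` space N \<inter> A"
        unfolding sets_restrict_space by blast
      have "x \<in> C \<longleftrightarrow> \<phi> x \<in> A" if x: "x \<in> space N" for x
      proof -
        have "\<phi> x \<in> space (restrict_space B (\<phi> ` space N))" using x sub by (auto simp: space_restrict_space)
        then have "\<phi> x \<in> the_inv_into (space N) \<phi> -` C \<inter> space (restrict_space B (\<phi> ` space N)) \<longleftrightarrow> x \<in> C"
          using the_inv_into_f_f[OF inj x] by simp
        then show ?thesis unfolding A(2) using x by blast
      qed
      then have "C = \<phi> -` A \<inter> space N" using sets.sets_into_space[OF C] by blast
      then show "C \<in> sets (vimage_algebra (space N) \<phi> B)" using in_vimage_algebra[OF A(1)] by simp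
    qed
  qed
qed

text \<open>
  The spaces \<open>BT'\<close> and \<open>BY'\<close> are parameters tied by equations, as in the theorem.
\<close>

locale pullback_bayes = projective_limit_kernels E f g h P Q
  for E :: "'i::{order,countable} \<Rightarrow> ('x, 'u::real_vector) exp_data" and f g h P Q +
  fixes M :: "'w measure" and N :: "'z measure" and \<phi> :: "'z \<Rightarrow> ('i \<Rightarrow> 'x)"
    and X' :: "nat \<Rightarrow> 'w \<Rightarrow> 'z" and \<Theta>' :: "'w \<Rightarrow> ('i \<Rightarrow> 'u)"
    and Y' :: "'w \<Rightarrow> real \<times> ('i \<Rightarrow> 'u)"
    and BT' :: "('i \<Rightarrow> 'u) measure" and BY' :: "(real \<times> ('i \<Rightarrow> 'u)) measure"
  assumes BT'_def: "BT' = pullback_par N \<phi> (borel_of (par_limit E g)) P"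
    and BY'_def: "BY' = pullback_hyper BT' (borel_of (hyper_limit E h)) Q"
    and embedding: "borel_embedding N (borel_of (obs_limit E f)) \<phi>"
    and bayes': "bayesian_model M N BT' BY' (pullback_model N \<phi> P) (pullback_prior BT' Q) X' \<Theta>' Y'"
    and canonical': "AE \<omega> in M. Y' \<omega> \<in> limit_canonical_hyper E h"
begin

sublocale prob_space M
  using bayes' by (simp add: bayesian_model_def)

lemma X'_measurable [measurable]: "X' k \<in> M \<rightarrow>\<^sub>M N"
  and \<Theta>'_measurable [measurable]: "\<Theta>' \<in> M \<rightarrow>\<^sub>M BT'"
  and Y'_measurable [measurable]: "Y' \<in> M \<rightarrow>\<^sub>M BY'"
  using bayes' by (simp_all add: bayesian_model_def)

lemma \<phi>_measurable [measurable]: "\<phi> \<in> N \<rightarrow>\<^sub>M BX"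
  using embedding by (simp add: borel_embedding_def)

lemma sets_N: "sets N = sets (vimage_algebra (space N) \<phi> BX)"
  by (rule borel_embedding_sets[OF embedding])

lemma space_BT': "space BT' = {\<theta>\<in>space BT. outer_measure_of (P \<theta>) (\<phi> ` space N) = 1}"
  unfolding BT'_def pullback_par_def by (auto simp: space_restrict_space)

lemma BT'_restrict: "BT' = restrict_space BT (space BT')"
  unfolding space_BT' unfolding BT'_def pullback_par_def ..

lemma space_BY': "space BY' = {y\<in>space BY. outer_measure_of (Q y) (space BT') = 1}"
  unfolding BY'_def pullback_hyper_def by (auto simp: space_restrict_space)

lemma BY'_restrict: "BY' = restrict_space BY (space BY')"
  unfolding space_BY' unfolding BY'_def pullback_hyper_def ..

lemma BT'_subset: "space BT' \<subseteq> space BT" and BY'_subset: "space BY' \<subseteq> space BY"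
  by (auto simp only: space_BT' space_BY')

lemma sets_BT': "sets BT' = {A \<inter> space BT' | A. A \<in> sets BT}"
  by (subst BT'_restrict) (auto simp: sets_restrict_space)

lemma measurable_BT': "F \<in> L \<rightarrow>\<^sub>M BT' \<longleftrightarrow> F \<in> L \<rightarrow>\<^sub>M BT \<and> F \<in> space L \<rightarrow> space BT'"
proof -
  have "F \<in> L \<rightarrow>\<^sub>M restrict_space BT (space BT') \<longleftrightarrow> F \<in> space L \<rightarrow> space BT' \<and> F \<in> L \<rightarrow>\<^sub>M BT"
    using BT'_subset by (subst measurable_restrict_space2_iff) auto
  then show ?thesis using BT'_restrict by auto
qed


lemma measurable_BT'D: "F \<in> L \<rightarrow>\<^sub>M BT' \<Longrightarrow> F \<in> L \<rightarrow>\<^sub>M BT" "F \<in> L \<rightarrow>\<^sub>M BT' \<Longrightarrow> F \<in> space L \<rightarrow> space BT'"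
  by (simp_all only: measurable_BT')
lemma measurable_BY': "F \<in> L \<rightarrow>\<^sub>M BY' \<longleftrightarrow> F \<in> L \<rightarrow>\<^sub>M BY \<and> F \<in> space L \<rightarrow> space BY'"
proof -
  have "F \<in> L \<rightarrow>\<^sub>M restrict_space BY (space BY') \<longleftrightarrow> F \<in> space L \<rightarrow> space BY' \<and> F \<in> L \<rightarrow>\<^sub>M BY"
    using BY'_subset by (subst measurable_restrict_space2_iff) auto
  then show ?thesis using BY'_restrict by auto
qed


lemma measurable_BY'D: "F \<in> L \<rightarrow>\<^sub>M BY' \<Longrightarrow> F \<in> L \<rightarrow>\<^sub>M BY" "F \<in> L \<rightarrow>\<^sub>M BY' \<Longrightarrow> F \<in> space L \<rightarrow> space BY'"
  by (simp_all only: measurable_BY')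
lemma measurable_N:
  assumes "F \<in> space L \<rightarrow> space N" "(\<lambda>x. \<phi> (F x)) \<in> L \<rightarrow>\<^sub>M BX"
  shows "F \<in> L \<rightarrow>\<^sub>M N"
  using measurable_vimage_algebra2[OF assms] measurable_cong_sets[OF refl sets_N] by blast

lemma N_sets_iff: "B \<in> sets N \<longleftrightarrow> (\<exists>A\<in>sets BX. B = \<phi> -` A \<inter> space N)"
proof -
  have "\<phi> \<in> space N \<rightarrow> space BX" using measurable_space[OF \<phi>_measurable] by blast
  from sets_vimage_algebra2[OF this] show ?thesis unfolding sets_N by blast
qed

lemma measure_pullback_model:
  assumes \<theta>: "\<theta> \<in> space BT'" and A: "A \<in> sets BX"
  shows "measure (pullback_model N \<phi> P \<theta>) (\<phi> -` A \<inter> space N) = measure (P \<theta>) A"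
proof -
  have \<theta>': "\<theta> \<in> space BT" "outer_measure_of (P \<theta>) (\<phi> ` space N) = 1" using \<theta> by (simp_all only: space_BT' mem_Collect_eq)
  have "\<phi> \<in> space N \<rightarrow> space (P \<theta>)"
    using measurable_space[OF \<phi>_measurable] sets_eq_imp_space_eq[OF P_prob(2)[OF \<theta>'(1)]] by blast
  from emeasure_pullback_measure[OF P_prob(1)[OF \<theta>'(1)] this \<theta>'(2)] show ?thesis
    using A P_prob(2)[OF \<theta>'(1)] by (simp add: measure_def pullback_model_def)
qed

lemma pullback_prior_props:
  assumes y: "y \<in> space BY'"
  shows "prob_space (pullback_prior BT' Q y)" "sets (pullback_prior BT' Q y) = sets BT'"
    and "A \<in> sets BT \<Longrightarrow> emeasure (pullback_prior BT' Q y) (A \<inter> space BT') = emeasure (Q y) A"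
proof -
  have y': "y \<in> space BY" "outer_measure_of (Q y) (space BT') = 1" using y by (simp_all only: space_BY' mem_Collect_eq)
  note Q = Q_prob[OF y'(1)]
  have id: "(\<lambda>\<theta>. \<theta>) \<in> space BT' \<rightarrow> space (Q y)"
    using BT'_subset sets_eq_imp_space_eq[OF Q(2)] by blast
  have outer: "outer_measure_of (Q y) ((\<lambda>\<theta>. \<theta>) ` space BT') = 1" using y'(2) by simp
  note pb = Q(1) id outer
  show "prob_space (pullback_prior BT' Q y)"
    unfolding pullback_prior_def by (rule prob_space_pullback_measure[OF pb])
  have "sets (pullback_prior BT' Q y) = {A \<inter> space BT' | A. A \<in> sets BT}"
    unfolding pullback_prior_def sets_pullback_measure[OF pb] sets_vimage_algebra2[OF id] Q(2)
    by (simp add: vimage_def)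
  then show "sets (pullback_prior BT' Q y) = sets BT'" by (simp only: sets_BT')
  show "emeasure (pullback_prior BT' Q y) (A \<inter> space BT') = emeasure (Q y) A" if "A \<in> sets BT"
    using emeasure_pullback_measure[OF pb, of A] that unfolding pullback_prior_def Q(2)
    by (simp add: vimage_def Int_def)
qed

lemma measure_pullback_prior:
  "y \<in> space BY' \<Longrightarrow> A \<in> sets BT \<Longrightarrow>
    measure (pullback_prior BT' Q y) (A \<inter> space BT') = measure (Q y) A"
  using pullback_prior_props(3) by (simp add: measure_def)

lemma given_prob_hyper: "given_prob M Y' BY' = given_prob M Y' BY"
proof (rule given_prob_cong)
  have Y: "Y' \<in> M \<rightarrow>\<^sub>M BY" and sp: "Y' \<in> space M \<rightarrow> space BY'" 
    by (rule measurable_BY'D[OF Y'_measurable])+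
  have "Y' \<in> space M \<rightarrow> space BY" using measurable_space[OF Y] by blast
  then have "Y' \<in> vimage_algebra (space M) Y' BY \<rightarrow>\<^sub>M BY" by (rule measurable_vimage_algebra1)
  then show "Y' \<in> vimage_algebra (space M) Y' BY \<rightarrow>\<^sub>M BY'"
    unfolding measurable_BY' using sp by simp
  have "Y' \<in> vimage_algebra (space M) Y' BY' \<rightarrow>\<^sub>M BY'" using sp by (rule measurable_vimage_algebra1)
  then show "Y' \<in> vimage_algebra (space M) Y' BY' \<rightarrow>\<^sub>M BY" by (rule measurable_BY'D)
qed

lemma given_prob_pair_par:
  assumes W: "W \<in> M \<rightarrow>\<^sub>M L"
  shows "given_prob M (\<lambda>\<omega>. (W \<omega>, \<Theta>' \<omega>)) (L \<Otimes>\<^sub>M BT') = given_prob M (\<lambda>\<omega>. (W \<omega>, \<Theta>' \<omega>)) (L \<Otimes>\<^sub>M BT)"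
proof (rule given_prob_cong)
  let ?Z = "\<lambda>\<omega>. (W \<omega>, \<Theta>' \<omega>)"
  have sp: "\<Theta>' \<in> space M \<rightarrow> space BT'" "\<Theta>' \<in> M \<rightarrow>\<^sub>M BT" by (rule measurable_BT'D[OF \<Theta>'_measurable])+
  have Z: "?Z \<in> space M \<rightarrow> space (L \<Otimes>\<^sub>M BT)" and Z': "?Z \<in> space M \<rightarrow> space (L \<Otimes>\<^sub>M BT')"
    using sp(1) measurable_space[OF W] BT'_subset by (auto simp: space_pair_measure)
  note m = measurable_vimage_algebra1[OF Z] and m' = measurable_vimage_algebra1[OF Z']
  have "\<Theta>' \<in> vimage_algebra (space M) ?Z (L \<Otimes>\<^sub>M BT) \<rightarrow>\<^sub>M BT"
    using measurable_compose[OF m measurable_snd] by simp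
  then have "\<Theta>' \<in> vimage_algebra (space M) ?Z (L \<Otimes>\<^sub>M BT) \<rightarrow>\<^sub>M BT'"
    unfolding measurable_BT' using sp(1) by simp
  moreover have "W \<in> vimage_algebra (space M) ?Z (L \<Otimes>\<^sub>M BT) \<rightarrow>\<^sub>M L"
    using measurable_compose[OF m measurable_fst] by simp
  ultimately show "?Z \<in> vimage_algebra (space M) ?Z (L \<Otimes>\<^sub>M BT) \<rightarrow>\<^sub>M L \<Otimes>\<^sub>M BT'" by (intro measurable_Pair)
  have "\<Theta>' \<in> vimage_algebra (space M) ?Z (L \<Otimes>\<^sub>M BT') \<rightarrow>\<^sub>M BT'"
    using measurable_compose[OF m' measurable_snd] by simp
  then have "\<Theta>' \<in> vimage_algebra (space M) ?Z (L \<Otimes>\<^sub>M BT') \<rightarrow>\<^sub>M BT" by (rule measurable_BT'D)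
  moreover have "W \<in> vimage_algebra (space M) ?Z (L \<Otimes>\<^sub>M BT') \<rightarrow>\<^sub>M L"
    using measurable_compose[OF m' measurable_fst] by simp
  ultimately show "?Z \<in> vimage_algebra (space M) ?Z (L \<Otimes>\<^sub>M BT') \<rightarrow>\<^sub>M L \<Otimes>\<^sub>M BT" by (intro measurable_Pair)
qed

lemma given_prob_par_hyper:
  "given_prob M (\<lambda>\<omega>. (\<Theta>' \<omega>, Y' \<omega>)) (BT' \<Otimes>\<^sub>M BY') = given_prob M (\<lambda>\<omega>. (\<Theta>' \<omega>, Y' \<omega>)) (BT \<Otimes>\<^sub>M BY)"
proof (rule given_prob_cong)
  let ?Z = "\<lambda>\<omega>. (\<Theta>' \<omega>, Y' \<omega>)"
  have sp: "\<Theta>' \<in> space M \<rightarrow> space BT'" "Y' \<in> space M \<rightarrow> space BY'"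
    by (rule measurable_BT'D[OF \<Theta>'_measurable] measurable_BY'D[OF Y'_measurable])+
  have Z: "?Z \<in> space M \<rightarrow> space (BT \<Otimes>\<^sub>M BY)" and Z': "?Z \<in> space M \<rightarrow> space (BT' \<Otimes>\<^sub>M BY')"
    using sp BT'_subset BY'_subset unfolding space_pair_measure by (auto simp only: Pi_iff mem_Sigma_iff)
  note m = measurable_vimage_algebra1[OF Z] and m' = measurable_vimage_algebra1[OF Z']
  have "\<Theta>' \<in> vimage_algebra (space M) ?Z (BT \<Otimes>\<^sub>M BY) \<rightarrow>\<^sub>M BT'"
    unfolding measurable_BT' using measurable_compose[OF m measurable_fst] sp(1) by simp
  moreover have "Y' \<in> vimage_algebra (space M) ?Z (BT \<Otimes>\<^sub>M BY) \<rightarrow>\<^sub>M BY'"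
    unfolding measurable_BY' using measurable_compose[OF m measurable_snd] sp(2) by simp
  ultimately show "?Z \<in> vimage_algebra (space M) ?Z (BT \<Otimes>\<^sub>M BY) \<rightarrow>\<^sub>M BT' \<Otimes>\<^sub>M BY'" by (intro measurable_Pair)
  have "\<Theta>' \<in> vimage_algebra (space M) ?Z (BT' \<Otimes>\<^sub>M BY') \<rightarrow>\<^sub>M BT'"
    using measurable_compose[OF m' measurable_fst] by simp
  then have 1: "\<Theta>' \<in> vimage_algebra (space M) ?Z (BT' \<Otimes>\<^sub>M BY') \<rightarrow>\<^sub>M BT" by (rule measurable_BT'D)
  have "Y' \<in> vimage_algebra (space M) ?Z (BT' \<Otimes>\<^sub>M BY') \<rightarrow>\<^sub>M BY'"
    using measurable_compose[OF m' measurable_snd] by simp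
  then have "Y' \<in> vimage_algebra (space M) ?Z (BT' \<Otimes>\<^sub>M BY') \<rightarrow>\<^sub>M BY" by (rule measurable_BY'D)
  with 1 show "?Z \<in> vimage_algebra (space M) ?Z (BT' \<Otimes>\<^sub>M BY') \<rightarrow>\<^sub>M BT \<Otimes>\<^sub>M BY" by (intro measurable_Pair)
qed

lemma given_prob_obs_hyper:
  "given_prob M (\<lambda>\<omega>. (\<lambda>k\<in>{..<n}. X' k \<omega>, Y' \<omega>)) ((\<Pi>\<^sub>M k\<in>{..<n}. N) \<Otimes>\<^sub>M BY') =
   given_prob M (\<lambda>\<omega>. (\<lambda>k\<in>{..<n}. \<phi> (X' k \<omega>), Y' \<omega>)) ((\<Pi>\<^sub>M k\<in>{..<n}. BX) \<Otimes>\<^sub>M BY)"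
proof (rule given_prob_cong)
  let ?L' = "(\<Pi>\<^sub>M k\<in>{..<n}. N) \<Otimes>\<^sub>M BY'" and ?L = "(\<Pi>\<^sub>M k\<in>{..<n}. BX) \<Otimes>\<^sub>M BY"
  let ?Z' = "\<lambda>\<omega>. (\<lambda>k\<in>{..<n}. X' k \<omega>, Y' \<omega>)" and ?Z = "\<lambda>\<omega>. (\<lambda>k\<in>{..<n}. \<phi> (X' k \<omega>), Y' \<omega>)"
  have sp: "Y' \<in> space M \<rightarrow> space BY'" and Y: "Y' \<in> M \<rightarrow>\<^sub>M BY"
    by (rule measurable_BY'D[OF Y'_measurable])+
  have "?Z \<in> M \<rightarrow>\<^sub>M ?L" using Y by measurable
  then have Z: "?Z \<in> space M \<rightarrow> space ?L" by (rule funcsetI[OF measurable_space])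
  have "?Z' \<in> M \<rightarrow>\<^sub>M ?L'" by measurable
  then have Z': "?Z' \<in> space M \<rightarrow> space ?L'" by (rule funcsetI[OF measurable_space])
  note m = measurable_vimage_algebra1[OF Z] and m' = measurable_vimage_algebra1[OF Z']
  have "Y' \<in> vimage_algebra (space M) ?Z ?L \<rightarrow>\<^sub>M BY'"
    unfolding measurable_BY' using measurable_compose[OF m measurable_snd] sp by simp
  moreover have "(\<lambda>\<omega>. \<lambda>k\<in>{..<n}. X' k \<omega>) \<in> vimage_algebra (space M) ?Z ?L \<rightarrow>\<^sub>M (\<Pi>\<^sub>M k\<in>{..<n}. N)"
  proof (rule measurable_restrict, rule measurable_N)
    fix k assume k: "k \<in> {..<n}"
    show "X' k \<in> space (vimage_algebra (space M) ?Z ?L) \<rightarrow> space N"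
      using measurable_space[OF X'_measurable] by simp
    from measurable_compose[OF m measurable_compose[OF measurable_fst measurable_component_singleton[OF k]]]
    show "(\<lambda>x. \<phi> (X' k x)) \<in> vimage_algebra (space M) ?Z ?L \<rightarrow>\<^sub>M BX" using k by simp
  qed
  ultimately show "?Z' \<in> vimage_algebra (space M) ?Z ?L \<rightarrow>\<^sub>M ?L'" by (intro measurable_Pair)
  have "Y' \<in> vimage_algebra (space M) ?Z' ?L' \<rightarrow>\<^sub>M BY'"
    using measurable_compose[OF m' measurable_snd] by simp
  then have "Y' \<in> vimage_algebra (space M) ?Z' ?L' \<rightarrow>\<^sub>M BY" by (rule measurable_BY'D)
  moreover have "(\<lambda>\<omega>. \<lambda>k\<in>{..<n}. \<phi> (X' k \<omega>)) \<in> vimage_algebra (space M) ?Z' ?L' \<rightarrow>\<^sub>M (\<Pi>\<^sub>M k\<in>{..<n}. BX)"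
  proof (rule measurable_restrict)
    fix k assume k: "k \<in> {..<n}"
    from measurable_compose[OF m' measurable_compose[OF measurable_fst
          measurable_compose[OF measurable_component_singleton[OF k] \<phi>_measurable]]]
    show "(\<lambda>\<omega>. \<phi> (X' k \<omega>)) \<in> vimage_algebra (space M) ?Z' ?L' \<rightarrow>\<^sub>M BX" using k by simp
  qed
  ultimately show "?Z \<in> vimage_algebra (space M) ?Z' ?L' \<rightarrow>\<^sub>M ?L" by (intro measurable_Pair)
qed

lemma prior_given_prob:
  "B \<in> sets BT' \<Longrightarrow> AE \<omega> in M.
    given_prob M Y' BY' (\<Theta>' -` B \<inter> space M) \<omega> = measure (pullback_prior BT' Q (Y' \<omega>)) B"
  using bayes' unfolding bayesian_model_def by (elim conjE) (rule bspec)

lemma obs_given_prob: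
  "\<forall>k<n. A k \<in> sets N \<Longrightarrow> AE \<omega> in M.
    given_prob M (\<lambda>\<omega>. (\<Theta>' \<omega>, Y' \<omega>)) (BT' \<Otimes>\<^sub>M BY') {\<omega>\<in>space M. \<forall>k<n. X' k \<omega> \<in> A k} \<omega> =
      (\<Prod>k<n. measure (pullback_model N \<phi> P (\<Theta>' \<omega>)) (A k))"
  using bayes' unfolding bayesian_model_def by (elim conjE) (erule allE, erule allE, erule mp)

text \<open>
  Observations in the domain of \<open>\<phi>\<close> are mapped into the projective limit; parameter and
  hyperparameter are only regarded as elements of the larger spaces.
\<close>

lemma pushed_bayesian_model:
  "bayesian_model M BX BT BY P Q (\<lambda>k \<omega>. \<phi> (X' k \<omega>)) \<Theta>' Y'"
  unfolding bayesian_model_def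
proof (intro conjI allI impI ballI)
  show "prob_space M" by (rule prob_space_axioms)
  show "(\<lambda>\<omega>. \<phi> (X' k \<omega>)) \<in> M \<rightarrow>\<^sub>M BX" for k by measurable
  show "\<Theta>' \<in> M \<rightarrow>\<^sub>M BT" "Y' \<in> M \<rightarrow>\<^sub>M BY"
    by (rule measurable_BT'D[OF \<Theta>'_measurable] measurable_BY'D[OF Y'_measurable])+
  fix A assume A: "A \<in> sets BT"
  then have A': "A \<inter> space BT' \<in> sets BT'" unfolding sets_BT' by blast
  have eq: "\<Theta>' -` (A \<inter> space BT') \<inter> space M = \<Theta>' -` A \<inter> space M"
    using measurable_space[OF \<Theta>'_measurable] by blast
  have "AE \<omega> in M. given_prob M Y' BY (\<Theta>' -` A \<inter> space M) \<omega> =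
      measure (pullback_prior BT' Q (Y' \<omega>)) (A \<inter> space BT')"
    using prior_given_prob[OF A'] unfolding eq given_prob_hyper .
  then show "AE \<omega> in M. given_prob M Y' BY (\<Theta>' -` A \<inter> space M) \<omega> = measure (Q (Y' \<omega>)) A"
    using AE_space
    by eventually_elim (simp only: measure_pullback_prior[OF measurable_space[OF Y'_measurable] A])
next
  fix n :: nat and A :: "nat \<Rightarrow> ('i \<Rightarrow> 'x) set" assume A: "\<forall>k<n. A k \<in> sets BX"
  let ?A = "\<lambda>k. \<phi> -` A k \<inter> space N"
  have A': "\<forall>k<n. ?A k \<in> sets N" using A measurable_sets[OF \<phi>_measurable] by blast
  have eq: "{\<omega>\<in>space M. \<forall>k<n. X' k \<omega> \<in> ?A k} = {\<omega>\<in>space M. \<forall>k<n. \<phi> (X' k \<omega>) \<in> A k}"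
    using measurable_space[OF X'_measurable] by blast
  have "AE \<omega> in M. given_prob M (\<lambda>\<omega>. (\<Theta>' \<omega>, Y' \<omega>)) (BT \<Otimes>\<^sub>M BY)
        {\<omega>\<in>space M. \<forall>k<n. \<phi> (X' k \<omega>) \<in> A k} \<omega> = (\<Prod>k<n. measure (pullback_model N \<phi> P (\<Theta>' \<omega>)) (?A k))"
    using obs_given_prob[OF A'] unfolding eq given_prob_par_hyper .
  then show "AE \<omega> in M. given_prob M (\<lambda>\<omega>. (\<Theta>' \<omega>, Y' \<omega>)) (BT \<Otimes>\<^sub>M BY)
        {\<omega>\<in>space M. \<forall>k<n. \<phi> (X' k \<omega>) \<in> A k} \<omega> = (\<Prod>k<n. measure (P (\<Theta>' \<omega>)) (A k))"
    using AE_space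
  proof eventually_elim
    fix \<omega> assume eq: "given_prob M (\<lambda>\<omega>. (\<Theta>' \<omega>, Y' \<omega>)) (BT \<Otimes>\<^sub>M BY)
        {\<omega>\<in>space M. \<forall>k<n. \<phi> (X' k \<omega>) \<in> A k} \<omega> = (\<Prod>k<n. measure (pullback_model N \<phi> P (\<Theta>' \<omega>)) (?A k))"
      and \<omega>: "\<omega> \<in> space M"
    have "(\<Prod>k<n. measure (pullback_model N \<phi> P (\<Theta>' \<omega>)) (?A k)) = (\<Prod>k<n. measure (P (\<Theta>' \<omega>)) (A k))"
      using measure_pullback_model[OF measurable_space[OF \<Theta>'_measurable \<omega>]] A by (intro prod.cong) auto
    with eq show "given_prob M (\<lambda>\<omega>. (\<Theta>' \<omega>, Y' \<omega>)) (BT \<Otimes>\<^sub>M BY)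
        {\<omega>\<in>space M. \<forall>k<n. \<phi> (X' k \<omega>) \<in> A k} \<omega> = (\<Prod>k<n. measure (P (\<Theta>' \<omega>)) (A k))" by simp
  qed
qed

sublocale pushed: projective_limit_bayes E f g h P Q M "\<lambda>k \<omega>. \<phi> (X' k \<omega>)" \<Theta>' Y'
  by unfold_locales (use pushed_bayesian_model canonical' in auto)

lemma update_index_pushed:
  "update_index (limit_stat E \<circ> \<phi>) n (\<lambda>i\<in>{..<n}. X' i \<omega>) (Y' \<omega>) = pushed.index n \<omega>"
  by (simp add: pushed.index_def pushed.obs_def update_index_def)

text \<open>
  Measurability of the image of \<open>\<phi>\<close> makes the parameter space of the pullback model measurable, so
  that its complement can be inserted in the formula for the posterior.
\<close>

lemma pushed_index_in_hyper:
  assumes "\<phi> ` space N \<in> sets BX"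
  shows "AE \<omega> in M. pushed.index n \<omega> \<in> space BY'"
proof -
  have "outer_measure_of (P \<theta>) (\<phi> ` space N) = emeasure (P \<theta>) (\<phi> ` space N)" if "\<theta> \<in> space BT" for \<theta>
    using assms P_prob(2)[OF that] by (intro outer_measure_of_eq) simp
  then have "space BT' = {\<theta>\<in>space BT. emeasure (P \<theta>) (\<phi> ` space N) = 1}"
    unfolding space_BT' by (intro Collect_cong conj_cong) simp_all
  moreover have [measurable]: "(\<lambda>\<theta>. emeasure (P \<theta>) (\<phi> ` space N)) \<in> borel_measurable BT"
    by (rule emeasure_prob_kernel_measurable[OF P_measurable assms])
  have "{\<theta>\<in>space BT. emeasure (P \<theta>) (\<phi> ` space N) = 1} \<in> sets BT" by measurable
  ultimately have T: "space BT' \<in> sets BT" by (simp only:)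
  let ?A = "space BT - space BT'"
  let ?V = "(\<Pi>\<^sub>M k\<in>{..<n}. BX) \<Otimes>\<^sub>M BY"
  have A: "?A \<in> sets BT" using T by (intro sets.Diff sets.top)
  have empty: "{\<omega>\<in>space M. \<Theta>' \<omega> \<in> ?A \<and> (pushed.obs n \<omega>, Y' \<omega>) \<in> space ?V} = {}"
    using measurable_space[OF \<Theta>'_measurable] by blast
  have "(\<integral>\<^sup>+\<omega>. indicator (space ?V) (pushed.obs n \<omega>, Y' \<omega>) * emeasure (Q (pushed.index n \<omega>)) ?A \<partial>M) = 0"
    using pushed.posterior[OF A sets.top, of n] unfolding empty by (simp only: emeasure_empty)
  moreover have V: "(pushed.obs n \<omega>, Y' \<omega>) \<in> space ?V" if "\<omega> \<in> space M" for \<omega>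
    using measurable_space[OF pushed.obs_measurable that] measurable_space[OF pushed.Y_measurable that]
    by (simp only: space_pair_measure mem_Sigma_iff)
  have "(\<integral>\<^sup>+\<omega>. indicator (space ?V) (pushed.obs n \<omega>, Y' \<omega>) * emeasure (Q (pushed.index n \<omega>)) ?A \<partial>M) =
      (\<integral>\<^sup>+\<omega>. emeasure (Q (pushed.index n \<omega>)) ?A \<partial>M)"
    using V by (intro nn_integral_cong) (simp only: indicator_simps mult_1_left)
  ultimately have "(\<integral>\<^sup>+\<omega>. emeasure (Q (pushed.index n \<omega>)) ?A \<partial>M) = 0" by simp
  moreover have "(\<lambda>\<omega>. emeasure (Q (pushed.index n \<omega>)) ?A) \<in> borel_measurable M"
    by (rule measurable_compose[OF pushed.index_measurable emeasure_prob_kernel_measurable[OF Q_measurable A]])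
  ultimately have "AE \<omega> in M. emeasure (Q (pushed.index n \<omega>)) ?A = 0"
    by (subst (asm) nn_integral_0_iff_AE) auto
  then show ?thesis
    using AE_space
  proof eventually_elim
    fix \<omega> assume 0: "emeasure (Q (pushed.index n \<omega>)) ?A = 0" and \<omega>: "\<omega> \<in> space M"
    have i: "pushed.index n \<omega> \<in> space BY" by (rule measurable_space[OF pushed.index_measurable \<omega>])
    interpret Qi: prob_space "Q (pushed.index n \<omega>)" by (rule Q_prob(1)[OF i])
    have s: "sets (Q (pushed.index n \<omega>)) = sets BT" by (rule Q_prob(2)[OF i])
    have "emeasure (Q (pushed.index n \<omega>)) (space BT' \<union> ?A) = emeasure (Q (pushed.index n \<omega>)) (space BT')"
      using T A 0 s by (intro emeasure_Un_null_set) (simp_all add: null_sets_def)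
    moreover have "space BT' \<union> ?A = space (Q (pushed.index n \<omega>))"
      using BT'_subset sets_eq_imp_space_eq[OF s] by blast
    ultimately have "outer_measure_of (Q (pushed.index n \<omega>)) (space BT') = 1"
      using T s Qi.emeasure_space_1 by simp
    with i show "pushed.index n \<omega> \<in> space BY'" unfolding space_BY' by blast
  qed
qed

lemma pullback_prior_measurable: "pullback_prior BT' Q \<in> BY' \<rightarrow>\<^sub>M prob_algebra BT'"
proof (rule measurable_prob_algebraI)
  show "prob_space (pullback_prior BT' Q y)" if "y \<in> space BY'" for y
    by (rule pullback_prior_props(1)[OF that])
  show "pullback_prior BT' Q \<in> BY' \<rightarrow>\<^sub>M subprob_algebra BT'"
  proof (rule measurable_subprob_algebra)
    show "subprob_space (pullback_prior BT' Q y)" "sets (pullback_prior BT' Q y) = sets BT'"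
      if "y \<in> space BY'" for y
      using pullback_prior_props(1,2)[OF that] by (simp_all add: prob_space_imp_subprob_space)
    fix B assume "B \<in> sets BT'"
    then obtain A where A: "A \<in> sets BT" "B = A \<inter> space BT'" unfolding sets_BT' by blast
    have "(\<lambda>y. y) \<in> BY' \<rightarrow>\<^sub>M BY" by (rule measurable_BY'D[OF measurable_ident_sets[OF refl]])
    from measurable_compose[OF this emeasure_prob_kernel_measurable[OF Q_measurable A(1)]]
    show "(\<lambda>y. emeasure (pullback_prior BT' Q y) B) \<in> borel_measurable BY'"
      using pullback_prior_props(3) A by (simp cong: measurable_cong)
  qed
qed

lemma pullback_conjugate:
  assumes in_hyper: "\<And>n. AE \<omega> in M. pushed.index n \<omega> \<in> space BY'"
  shows "conjugate_posterior_index M N BT' BY' (pullback_prior BT' Q) X' \<Theta>' Y'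
    (hyper_limit E h) (update_index (limit_stat E \<circ> \<phi>))"
  unfolding conjugate_posterior_index_def posterior_index_def
proof (intro exI[of _ "space BY'"] exI[of _ "pullback_prior BT' Q"] conjI allI ballI impI)
  show "polish (hyper_limit E h)" by (rule polish_hyper_limit)
  show "space BY' \<subseteq> topspace (hyper_limit E h)" using BY'_subset by simp
  show "pullback_prior BT' Q \<in> restrict_space BY (space BY') \<rightarrow>\<^sub>M prob_algebra BT'"
    using pullback_prior_measurable by (simp only: BY'_restrict[symmetric])
  fix n :: nat
  let ?L = "(\<Pi>\<^sub>M i\<in>{..<n}. N) \<Otimes>\<^sub>M BY'"
  show "(\<lambda>(x, y). update_index (limit_stat E \<circ> \<phi>) n x y) \<in> ?L \<rightarrow>\<^sub>M BY"
  proof -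
    have "(\<lambda>z. update_index (limit_stat E) n (\<lambda>k. \<phi> (fst z k)) (snd z)) \<in> ?L \<rightarrow>\<^sub>M BY"
    proof (rule update_index_measurable)
      fix k assume "k < n"
      then have "k \<in> {..<n}" by simp
      from measurable_compose[OF measurable_fst measurable_compose[OF measurable_component_singleton[OF this] \<phi>_measurable]]
      show "(\<lambda>z. \<phi> (fst z k)) \<in> ?L \<rightarrow>\<^sub>M BX" .
    next
      have "snd \<in> ?L \<rightarrow>\<^sub>M BY'" by (rule measurable_snd)
      then show "snd \<in> ?L \<rightarrow>\<^sub>M BY" by (rule measurable_BY'D)
    qed
    moreover have "update_index (limit_stat E \<circ> \<phi>) n x y = update_index (limit_stat E) n (\<lambda>k. \<phi> (x k)) y" for x y
      by (simp add: update_index_def)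
    ultimately show ?thesis by (simp add: case_prod_beta')
  qed
  show "AE \<omega> in M. update_index (limit_stat E \<circ> \<phi>) n (\<lambda>i\<in>{..<n}. X' i \<omega>) (Y' \<omega>) \<in> space BY'"
    unfolding update_index_pushed by (rule in_hyper)
  fix B assume "B \<in> sets BT'"
  then obtain A where A: "A \<in> sets BT" "B = A \<inter> space BT'" unfolding sets_BT' by blast
  have "\<Theta>' -` B \<inter> space M = \<Theta>' -` A \<inter> space M"
    unfolding A(2) using measurable_space[OF \<Theta>'_measurable] by blast
  then have "AE \<omega> in M. given_prob M (\<lambda>\<omega>. (\<lambda>i\<in>{..<n}. X' i \<omega>, Y' \<omega>)) ?L (\<Theta>' -` B \<inter> space M) \<omega> =
      measure (Q (pushed.index n \<omega>)) A"
    using pushed.posterior_given_prob[OF A(1), of n] by (simp only: given_prob_obs_hyper pushed.obs_def)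
  then show "AE \<omega> in M. given_prob M (\<lambda>\<omega>. (\<lambda>i\<in>{..<n}. X' i \<omega>, Y' \<omega>)) ?L (\<Theta>' -` B \<inter> space M) \<omega> =
      measure (pullback_prior BT' Q (update_index (limit_stat E \<circ> \<phi>) n (\<lambda>i\<in>{..<n}. X' i \<omega>) (Y' \<omega>))) B"
    using in_hyper[of n] unfolding update_index_pushed A(2)
    by eventually_elim (simp only: measure_pullback_prior[OF _ A(1)])
qed simp_all

lemma pullback_sufficient: "sufficient_statistic M N BT' BU (X' k) \<Theta>' (limit_stat E \<circ> \<phi>)"
  unfolding sufficient_statistic_def
proof (intro conjI ballI)
  show "limit_stat E \<circ> \<phi> \<in> N \<rightarrow>\<^sub>M BU"
    by (rule measurable_comp[OF \<phi>_measurable limit_stat_measurable])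
  fix B assume "B \<in> sets N"
  then obtain A where A: "A \<in> sets BX" "B = \<phi> -` A \<inter> space N" unfolding N_sets_iff by blast
  have set: "X' k -` B \<inter> space M = (\<lambda>\<omega>. \<phi> (X' k \<omega>)) -` A \<inter> space M"
    unfolding A(2) using measurable_space[OF X'_measurable] by blast
  have S: "(\<lambda>\<omega>. limit_stat E (\<phi> (X' k \<omega>))) \<in> M \<rightarrow>\<^sub>M BU"
    by (rule measurable_compose[OF pushed.X_measurable limit_stat_measurable])
  have "AE \<omega> in M. given_prob M (\<lambda>\<omega>. (limit_stat E (\<phi> (X' k \<omega>)), \<Theta>' \<omega>)) (BU \<Otimes>\<^sub>M BT)
      ((\<lambda>\<omega>. \<phi> (X' k \<omega>)) -` A \<inter> space M) \<omega> =
      given_prob M (\<lambda>\<omega>. limit_stat E (\<phi> (X' k \<omega>))) BU ((\<lambda>\<omega>. \<phi> (X' k \<omega>)) -` A \<inter> space M) \<omega>"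
    using pushed.sufficient_limit_stat[of k] A(1) unfolding sufficient_statistic_def by blast
  then show "AE \<omega> in M. given_prob M (\<lambda>\<omega>. ((limit_stat E \<circ> \<phi>) (X' k \<omega>), \<Theta>' \<omega>)) (BU \<Otimes>\<^sub>M BT')
      (X' k -` B \<inter> space M) \<omega> =
      given_prob M (\<lambda>\<omega>. (limit_stat E \<circ> \<phi>) (X' k \<omega>)) BU (X' k -` B \<inter> space M) \<omega>"
    unfolding given_prob_pair_par[OF S, symmetric] set o_def .
qed

end

section \<open>The projective limit and the pullback model are conjugate\<close>

theorem corollary2:
  fixes E :: "'i::{order,countable} \<Rightarrow> ('x, 'u::real_vector) exp_data"
    and f :: "'i \<Rightarrow> 'i \<Rightarrow> 'x \<Rightarrow> 'x"
    and g h :: "'i \<Rightarrow> 'i \<Rightarrow> 'u \<Rightarrow> 'u"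
    and P :: "('i \<Rightarrow> 'u) \<Rightarrow> ('i \<Rightarrow> 'x) measure"
    and Q :: "real \<times> ('i \<Rightarrow> 'u) \<Rightarrow> ('i \<Rightarrow> 'u) measure"
    and M :: "'w measure"
    and X :: "nat \<Rightarrow> 'w \<Rightarrow> ('i \<Rightarrow> 'x)" and \<Theta> :: "'w \<Rightarrow> ('i \<Rightarrow> 'u)"
    and Y :: "'w \<Rightarrow> real \<times> ('i \<Rightarrow> 'u)"
    and N :: "'z measure" and \<phi> :: "'z \<Rightarrow> ('i \<Rightarrow> 'x)"
    and X' :: "nat \<Rightarrow> 'w \<Rightarrow> 'z" and \<Theta>' :: "'w \<Rightarrow> ('i \<Rightarrow> 'u)"
    and Y' :: "'w \<Rightarrow> real \<times> ('i \<Rightarrow> 'u)"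
  assumes directed: "\<forall>I J :: 'i. \<exists>K. I \<le> K \<and> J \<le> K"
    and obs_system: "projective_system (\<lambda>I. obs_top (E I)) f"
    and par_system: "projective_system (\<lambda>I. par_top (E I)) g"
    and stat_system: "projective_system (\<lambda>I. stat_top (E I)) h"
    and stat_linear: "\<forall>I J. I \<le> J \<longrightarrow> linear_between (stat_top (E J)) (stat_top (E I)) (h J I)"
    and models: "\<forall>I. exp_family_model (E I)"
    and priors: "\<forall>I. canonical_conjugate_prior (E I)"
    and proj_models: "projective_models E f g"
    and proj_priors: "projective_priors E g h"
    and proj_stats: "projective_statistics E f h"
    and limit: "projective_limit_model E f g h P Q"
  shows
    "(bayesian_model M (borel_of (obs_limit E f)) (borel_of (par_limit E g))
        (borel_of (hyper_limit E h)) P Q X \<Theta> Y \<and>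
      (AE \<omega> in M. Y \<omega> \<in> limit_canonical_hyper E h) \<longrightarrow>
        conjugate_posterior_index M (borel_of (obs_limit E f)) (borel_of (par_limit E g))
          (borel_of (hyper_limit E h)) Q X \<Theta> Y
          (hyper_limit E h) (update_index (limit_stat E)) \<and>
        (\<forall>k. sufficient_statistic M (borel_of (obs_limit E f)) (borel_of (par_limit E g))
          (borel_of (stat_limit E h)) (X k) \<Theta> (limit_stat E)))
     \<and>
     (\<forall>BT' BY'.
        BT' = pullback_par N \<phi> (borel_of (par_limit E g)) P \<and>
        BY' = pullback_hyper BT' (borel_of (hyper_limit E h)) Q \<and>
        borel_embedding N (borel_of (obs_limit E f)) \<phi> \<and>
        bayesian_model M N BT' BY' (pullback_model N \<phi> P) (pullback_prior BT' Q) X' \<Theta>' Y' \<and>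
        (AE \<omega> in M. Y' \<omega> \<in> limit_canonical_hyper E h) \<longrightarrow>
          (\<phi> ` space N \<in> sets (borel_of (obs_limit E f)) \<or>
           (\<forall>n. AE \<omega> in M.
              update_index (limit_stat E \<circ> \<phi>) n (\<lambda>i\<in>{..<n}. X' i \<omega>) (Y' \<omega>) \<in> space BY') \<longrightarrow>
           conjugate_posterior_index M N BT' BY' (pullback_prior BT' Q) X' \<Theta>' Y'
             (hyper_limit E h) (update_index (limit_stat E \<circ> \<phi>))) \<and>
          (\<forall>k. sufficient_statistic M N BT' (borel_of (stat_limit E h)) (X' k) \<Theta>'
             (limit_stat E \<circ> \<phi>)))"
proof -
  interpret projective_limit_kernels E f g h P Q
    by unfold_locales (fact assms)+
  show ?thesis
  proof (intro conjI impI allI)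
    assume "bayesian_model M BX BT BY P Q X \<Theta> Y \<and> (AE \<omega> in M. Y \<omega> \<in> limit_canonical_hyper E h)"
    then interpret projective_limit_bayes E f g h P Q M X \<Theta> Y
      by unfold_locales auto
    show "conjugate_posterior_index M BX BT BY Q X \<Theta> Y (hyper_limit E h) (update_index (limit_stat E))"
      by (rule conjugate_update)
    show "sufficient_statistic M BX BT BU (X k) \<Theta> (limit_stat E)" for k
      by (rule sufficient_limit_stat)
  next
    fix BT' BY'
    assume model: "BT' = pullback_par N \<phi> BT P \<and> BY' = pullback_hyper BT' BY Q \<and>
        borel_embedding N BX \<phi> \<and>
        bayesian_model M N BT' BY' (pullback_model N \<phi> P) (pullback_prior BT' Q) X' \<Theta>' Y' \<and>
        (AE \<omega> in M. Y' \<omega> \<in> limit_canonical_hyper E h)"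
    interpret pullback_bayes E f g h P Q M N \<phi> X' \<Theta>' Y' BT' BY'
      by unfold_locales (insert model, elim conjE, assumption)+
    show "sufficient_statistic M N BT' BU (X' k) \<Theta>' (limit_stat E \<circ> \<phi>)" for k
      by (rule pullback_sufficient)
    assume "\<phi> ` space N \<in> sets BX \<or>
        (\<forall>n. AE \<omega> in M.
          update_index (limit_stat E \<circ> \<phi>) n (\<lambda>i\<in>{..<n}. X' i \<omega>) (Y' \<omega>) \<in> space BY')"
    then show "conjugate_posterior_index M N BT' BY' (pullback_prior BT' Q) X' \<Theta>' Y'
        (hyper_limit E h) (update_index (limit_stat E \<circ> \<phi>))"
    proof
      assume "\<phi> ` space N \<in> sets BX"
      then show ?thesis by (intro pullback_conjugate pushed_index_in_hyper)
    next
      assume "\<forall>n. AE \<omega> in M.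
          update_index (limit_stat E \<circ> \<phi>) n (\<lambda>i\<in>{..<n}. X' i \<omega>) (Y' \<omega>) \<in> space BY'"
      then show ?thesis unfolding update_index_pushed by (intro pullback_conjugate) (rule spec)
    qed
  qed
qed

end
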